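(* Let $d\in\{2,3\}$. Let $\mathbf{P}_\bullet$ be a multilevel structure obtained from the initial one by finitely many multilevel refinements, with associated spaces $\mathbb{V}_\bullet\subseteq\widehat{\mathbb{V}}_\bullet$. Suppose that the saturation assumption with constant $0<q_{\rm sat}<1$ holds for both the primal solution $w=u$ and the (theoretical) dual solution $w=z[u]$, i.e., $|\!|\!|w-\widehat w_\bullet|\!|\!|\le q_{\rm sat}\,|\!|\!|w-w_\bullet|\!|\!|$ for $w\in\{u,z[u]\}$, where $w_\bullet\in\mathbb{V}_\bullet$ and $\widehat w_\bullet\in\widehat{\mathbb{V}}_\bullet$ are the Galerkin projections of $w$. Then there holds the a posteriori goal-oriented error estimate $$|g(u)-g(u_\bullet)|\le C_{\rm rel}\,\mu_\bullet\,\big[\mu_\bullet^2+\zeta_\bullet^2\big]^{1/2},$$ where $C_{\rm rel}>0$ depends only on the constants $C_{\rm goal}\ge0$, $C_{\rm est}\ge1$, and $0<q_{\rm sat}<1$.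
   Context: **Parametric problem.** Let $D\subset\mathbb{R}^d$, $d\in\{2,3\}$, be a bounded Lipschitz domain with polytopal boundary. Let $\Gamma=\prod_{m=1}^\infty[-1,1]$ with its Borel $\sigma$-algebra and the product probability measure $\pi=\prod_{m=1}^\infty\pi_m$, where each $\pi_m$ is a symmetric Borel probability measure on $[-1,1]$. Let $a(x,y)=a_0(x)+\sum_{m=1}^\infty y_m a_m(x)$ with $a_m\in L^\infty(D)$, $0<a_0^{\min}\le a_0(x)\le a_0^{\max}<\infty$ for a.e. $x\in D$, $\tau:=\frac1{a_0^{\min}}\big\|\sum_{m\ge1}|a_m|\big\|_{L^\infty(D)}<1$ and $\sum_{m\ge1}\|a_m\|_{L^\infty(D)}<\infty$. Let $f\in L^2_\pi(\Gamma;H^{-1}(D))$. Put $\mathbb{X}:=H^1_0(D)$, $\mathbb{V}:=L^2_\pi(\Gamma;\mathbb{X})$, and $$B(u,v):=\int_\Gamma\int_D a_0\nabla u\cdot\nabla v\,dx\,d\pi(y)+\sum_{m=1}^\infty\int_\Gamma\int_D y_m a_m\nabla u\cdot\nabla v\,dx\,d\pi(y),\qquad F(v):=\int_\Gamma\int_D f v\,dx\,d\pi(y)$$ (the inner integral in $F$ is understood as the $H^{-1}$–$H^1_0$ duality). $B$ is a symmetric, continuous, elliptic bilinear form on $\mathbb{V}$; $|\!|\!|v|\!|\!|:=B(v,v)^{1/2}$. The primal solution $u\in\mathbb{V}$ satisfies $B(u,v)=F(v)$ for all $v\in\mathbb{V}$. **Goal functional and dual problem.** $g:\mathbb{V}\to\mathbb{R}$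 is (possibly nonlinear) continuous and Gâteaux differentiable with continuous derivative $g':\mathbb{V}\to\mathbb{V}^*$, and there is $C_{\rm goal}\ge0$ with $|\langle g'(v)-g'(w),z\rangle|\le C_{\rm goal}|\!|\!|v-w|\!|\!|\,|\!|\!|z|\!|\!|$ for all $v,w,z\in\mathbb{V}$, where $\langle\cdot,\cdot\rangle$ is the duality pairing between $\mathbb{V}^*$ and $\mathbb{V}$. For $w\in\mathbb{V}$, $z[w]\in\mathbb{V}$ is the unique solution of $B(v,z[w])=\langle g'(w),v\rangle$ for all $v\in\mathbb{V}$. **Meshes.** A mesh is a conforming simplicial partition of $D$. $\mathcal{T}_0$ is an initial mesh; meshes are refined by newest vertex bisection (NVB), and $\mathrm{refine}(\mathcal{T}_0)$ is the set of all meshes obtained from $\mathcal{T}_0$ by finitely many NVB steps. For $\mathcal{T}\in\mathrm{refine}(\mathcal{T}_0)$: $\mathcal{N}$ is its vertex set; $\widehat{\mathcal{T}}$ is its uniform refinement (for $d=2$ each triangle is split into four by three successive bisections; for $d=3$ the uniform NVB refinement in which every edge is bisected), with vertex set $\widehat{\mathcal{N}}$; $\mathcal{N}^+:=(\widehat{\mathcal{N}}\setminus\mathcal{N})\setminus\partial D$. For $\mathcal{M}\subseteq\mathcal{N}^+$, $\mathrm{refine}(\mathcal{T},\mathcal{M})$ is the coarsest NVB refinement of $\mathcal{T}$ whose vertices include $\mathcal{M}$. $\mathcal{S}^1_0(\mathcal{T})\subset H_0^1(D)$ is the space of continuous $\mathcal{T}$-piecewise affine functions vanishing on $\partial D$;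 $\widehat\varphi_{\xi}$, $\xi\in\widehat{\mathcal N}\setminus\partial D$, are the hat functions of $\mathcal{S}^1_0(\widehat{\mathcal{T}})$. $\mathbb{X}_0:=\mathcal{S}^1_0(\mathcal{T}_0)$. **Index sets.** $(P^m_n)_{n\in\mathbb{N}_0}$ are the $L^2_{\pi_m}(-1,1)$-orthonormal polynomials, $\deg P_n^m=n$, $P_0^m\equiv1$. $\mathfrak{I}$ is the set of finitely supported sequences in $\mathbb{N}_0^{\mathbb{N}}$; $P_\nu(y):=\prod_m P^m_{\nu_m}(y_m)$. $\mathbf 0$ is the zero index and $\varepsilon_m$ the $m$-th unit sequence. For a finite $\mathfrak{P}\subset\mathfrak{I}$ containing $\mathbf 0$, $M_{\mathfrak{P}}:=\#\bigcup_{\nu\in\mathfrak{P}}\{m:\nu_m\ne0\}$, and the detail index set is $\mathfrak{Q}:=\{\mu\in\mathfrak{I}\setminus\mathfrak{P}:\mu=\nu\pm\varepsilon_m\text{ for some }\nu\in\mathfrak{P},\ m\in\{1,\dots,M_{\mathfrak{P}}+1\}\}$. **Multilevel structures and spaces.** A multilevel structure $\mathbf{P}_\bullet=[\mathfrak{P}_\bullet,(\mathcal{T}_{\bullet\nu})_{\nu\in\mathfrak{I}}]$ consists of a finite index set $\mathfrak{P}_\bullet\ni\mathbf 0$ and meshes $\mathcal{T}_{\bullet\nu}\in\mathrm{refine}(\mathcal{T}_0)$ with $\mathcal{T}_{\bullet\nu}=\mathcal{T}_0$ for $\nu\notin\mathfrak{P}_\bullet$. The initial one has index set $\{\mathbf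 0\}$ and all meshes equal to $\mathcal{T}_0$. One multilevel refinement step replaces $\mathfrak{P}_\bullet$ by $\mathfrak{P}_\bullet\cup\mathfrak{M}_\bullet$ with some $\mathfrak{M}_\bullet\subseteq\mathfrak{Q}_\bullet$, and $\mathcal{T}_{\bullet\nu}$ by $\mathrm{refine}(\mathcal{T}_{\bullet\nu},\mathcal{M}_{\bullet\nu})$ with some $\mathcal{M}_{\bullet\nu}\subseteq\mathcal{N}^+_{\bullet\nu}$ for $\nu\in\mathfrak{P}_\bullet$ (other meshes stay $\mathcal{T}_0$). Here subscripts $\bullet\nu$ denote the objects associated with $\mathcal{T}_{\bullet\nu}$, and $\mathfrak{Q}_\bullet$ is the detail index set of $\mathfrak{P}_\bullet$. Put $$\mathbb{V}_\bullet:=\bigoplus_{\nu\in\mathfrak{P}_\bullet}\mathcal{S}^1_0(\mathcal{T}_{\bullet\nu})\otimes\mathrm{span}\{P_\nu\},\qquad \widehat{\mathbb{V}}_\bullet:=\Big(\bigoplus_{\nu\in\mathfrak{P}_\bullet}\mathcal{S}^1_0(\widehat{\mathcal{T}}_{\bullet\nu})\otimes\mathrm{span}\{P_\nu\}\Big)\oplus\Big(\bigoplus_{\nu\in\mathfrak{Q}_\bullet}\mathbb{X}_0\otimes\mathrm{span}\{P_\nu\}\Big).$$ The Galerkin projections $w_\bullet\in\mathbb{V}_\bullet$, $\widehat w_\bullet\in\widehat{\mathbb{V}}_\bullet$ of $w\in\mathbb{V}$ are defined by $B(w_\bullet,v)=B(w,v)$ for all $v\in\mathbb{V}_\bullet$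 and $B(\widehat w_\bullet,v)=B(w,v)$ for all $v\in\widehat{\mathbb{V}}_\bullet$. In particular $u_\bullet$ is the Galerkin projection of $u$ onto $\mathbb{V}_\bullet$. **Error estimates.** Let $\langle w,v\rangle_D:=\int_D a_0\nabla w\cdot\nabla v\,dx$, $\|v\|_D:=\langle v,v\rangle_D^{1/2}$. For $\nu\in\mathfrak{Q}_\bullet$, $\tau_\bullet(w|\nu):=\|e_\nu\|_D$, where $e_\nu\in\mathbb{X}_0$ solves $\langle e_\nu,v_0\rangle_D=B(w-w_\bullet,v_0P_\nu)$ for all $v_0\in\mathbb{X}_0$. For $\nu\in\mathfrak{P}_\bullet$, $\xi\in\mathcal{N}^+_{\bullet\nu}$, $\tau_\bullet(w|\nu,\xi):=|B(w-w_\bullet,\widehat\varphi_{\bullet\nu,\xi}P_\nu)|/\|\widehat\varphi_{\bullet\nu,\xi}\|_D$. Set $\tau_\bullet(w):=\big(\sum_{\nu\in\mathfrak{P}_\bullet}\sum_{\xi\in\mathcal{N}^+_{\bullet\nu}}\tau_\bullet(w|\nu,\xi)^2+\sum_{\nu\in\mathfrak{Q}_\bullet}\tau_\bullet(w|\nu)^2\big)^{1/2}$, $\mu_\bullet:=\tau_\bullet(u)$ and $\zeta_\bullet:=\tau_\bullet(z[u_\bullet])$. **The constant $C_{\rm est}$.** By a known theorem, there is $C_{\rm est}\ge1$, depending only on $\mathcal{T}_0$, $a_0$ and $\lambda:=1-\tau$, $\Lambda:=1+\tau$, such that for every such multilevel structure and every $w\in\mathbb{V}$, $C_{\rm est}^{-1}|\!|\!|\widehat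 w_\bullet-w_\bullet|\!|\!|\le\tau_\bullet(w)\le C_{\rm est}|\!|\!|\widehat w_\bullet-w_\bullet|\!|\!|$; this is the $C_{\rm est}$ of the claim. *)

theory Defs
  imports "HOL-Probability.Probability" "HOL-Computational_Algebra.Polynomial"
begin

section \<open>Domains\<close>

text \<open>Near every boundary point, \<open>D\<close> is the strict subgraph of a Lipschitz function in the
  direction of a unit vector \<open>e\<close>; the function lives on the hyperplane orthogonal to \<open>e\<close>.\<close>

definition lipschitz_domain :: "(real^'n::finite) set \<Rightarrow> bool" where
  "lipschitz_domain D \<longleftrightarrow> open D \<and> connected D \<and> D \<noteq> {} \<and>
     (\<forall>p\<in>frontier D. \<exists>e r L \<phi>. norm e = 1 \<and> 0 < r \<and> L-lipschitz_on {x. e \<bullet> x = 0} \<phi> \<and>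
        D \<inter> ball p r = {x \<in> ball p r. e \<bullet> x < \<phi> (x - (e \<bullet> x) *\<^sub>R e)})"

definition polytopal_boundary :: "(real^'n::finite) set \<Rightarrow> bool" where
  "polytopal_boundary D \<longleftrightarrow>
     (\<exists>\<F>. finite \<F> \<and> (\<forall>p\<in>\<F>. polytope p \<and> aff_dim p = int CARD('n) - 1) \<and> frontier D = \<Union>\<F>)"


section \<open>Lebesgue and Sobolev spaces\<close>

text \<open>Elements of function spaces are represented by functions; two functions are the same
  element if their difference has (semi)norm zero. Functions on \<open>D\<close> are total functions whose
  values outside \<open>D\<close> are irrelevant. Differences of functions are taken with the pointwise
  minus of HOL.\<close>

definition L2 :: "'a measure \<Rightarrow> ('a \<Rightarrow> 'b::euclidean_space) set" where
  "L2 M = {f. f \<in> borel_measurable M \<and> integrable M (\<lambda>x. (norm (f x))\<^sup>2)}"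

definition Linf_norm :: "(real^'n::finite) set \<Rightarrow> (real^'n \<Rightarrow> real) \<Rightarrow> ereal" where
  "Linf_norm D f = esssup (lebesgue_on D) (\<lambda>x. ereal \<bar>f x\<bar>)"

definition Linf :: "(real^'n::finite) set \<Rightarrow> (real^'n \<Rightarrow> real) set" where
  "Linf D = {f. f \<in> borel_measurable (lebesgue_on D) \<and> Linf_norm D f < \<infinity>}"

definition partial :: "'n \<Rightarrow> (real^'n \<Rightarrow> real) \<Rightarrow> real^'n \<Rightarrow> real" where
  "partial i f x = frechet_derivative f (at x) (axis i 1)"

text \<open>\<open>C\<^sup>\<infinity>\<close>: all iterated partial derivatives are differentiable (hence continuous).\<close>

definition smooth :: "(real^'n \<Rightarrow> real) \<Rightarrow> bool" where
  "smooth f \<longleftrightarrow> (\<forall>is x. foldr partial is f differentiable (at x))"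

definition test_functions :: "(real^'n::finite) set \<Rightarrow> (real^'n \<Rightarrow> real) set" where
  "test_functions D = {\<phi>. smooth \<phi> \<and> compact (closure {x. \<phi> x \<noteq> 0}) \<and> closure {x. \<phi> x \<noteq> 0} \<subseteq> D}"

definition is_weak_gradient :: "(real^'n::finite) set \<Rightarrow> (real^'n \<Rightarrow> real) \<Rightarrow> (real^'n \<Rightarrow> real^'n) \<Rightarrow> bool" where
  "is_weak_gradient D u G \<longleftrightarrow> G \<in> L2 (lebesgue_on D) \<and>
     (\<forall>\<phi>\<in>test_functions D. \<forall>i.
        (LINT x|lebesgue_on D. u x * partial i \<phi> x) = - (LINT x|lebesgue_on D. G x $ i * \<phi> x))"

definition H1 :: "(real^'n::finite) set \<Rightarrow> (real^'n \<Rightarrow> real) set" where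
  "H1 D = {u \<in> L2 (lebesgue_on D). \<exists>G. is_weak_gradient D u G}"

text \<open>The weak gradient is unique up to a null set; some representative is chosen.\<close>

definition grad :: "(real^'n::finite) set \<Rightarrow> (real^'n \<Rightarrow> real) \<Rightarrow> real^'n \<Rightarrow> real^'n" where
  "grad D u = (SOME G. is_weak_gradient D u G)"

definition H1_norm :: "(real^'n::finite) set \<Rightarrow> (real^'n \<Rightarrow> real) \<Rightarrow> real" where
  "H1_norm D u = sqrt ((LINT x|lebesgue_on D. (u x)\<^sup>2) + (LINT x|lebesgue_on D. (norm (grad D u x))\<^sup>2))"

definition H10 :: "(real^'n::finite) set \<Rightarrow> (real^'n \<Rightarrow> real) set" where
  "H10 D = {u \<in> H1 D. \<forall>\<epsilon>>0. \<exists>\<phi>\<in>test_functions D. H1_norm D (u - \<phi>) < \<epsilon>}"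

definition dual_H10 :: "(real^'n::finite) set \<Rightarrow> ((real^'n \<Rightarrow> real) \<Rightarrow> real) set" where
  "dual_H10 D = {\<phi>. (\<forall>u\<in>H10 D. \<forall>v\<in>H10 D. \<forall>c. \<phi> (\<lambda>x. u x + c * v x) = \<phi> u + c * \<phi> v) \<and>
     (\<exists>C. \<forall>v\<in>H10 D. \<bar>\<phi> v\<bar> \<le> C * H1_norm D v)}"

definition dual_H10_norm :: "(real^'n::finite) set \<Rightarrow> ((real^'n \<Rightarrow> real) \<Rightarrow> real) \<Rightarrow> real" where
  "dual_H10_norm D \<phi> = (SUP v\<in>{v\<in>H10 D. H1_norm D v \<le> 1}. \<bar>\<phi> v\<bar>)"

text \<open>The Bochner space of square integrable, strongly measurable functions with values in a
  space \<open>X\<close> of real functions with (semi)norm \<open>N\<close>. Strong measurability asks for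
  convergence of simple functions at every point, so that no completion of \<open>M\<close> is needed.\<close>

definition bochner_L2 :: "'a measure \<Rightarrow> ('p \<Rightarrow> real) set \<Rightarrow> (('p \<Rightarrow> real) \<Rightarrow> real) \<Rightarrow> ('a \<Rightarrow> 'p \<Rightarrow> real) set" where
  "bochner_L2 M X N = {v. (\<forall>y\<in>space M. v y \<in> X) \<and>
     (\<exists>s. (\<forall>k::nat. simple_function M (s k) \<and> s k ` space M \<subseteq> X) \<and>
          (\<forall>y\<in>space M. (\<lambda>k. N (s k y - v y)) \<longlonglongrightarrow> 0)) \<and>
     integrable M (\<lambda>y. (N (v y))\<^sup>2)}"


section \<open>Simplicial meshes and newest vertex bisection\<close>

text \<open>Newest vertex bisection in arbitrary dimension (Maubach, Stevenson) acts on tagged simplices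
  \<open>([x\<^sub>0, \<dots>, x\<^sub>d], \<gamma>)\<close> with \<open>\<gamma> < d\<close>, whose refinement edge joins \<open>x\<^sub>0\<close> and \<open>x\<^sub>d\<close>.
  For \<open>d = 2\<close> the tag \<open>\<gamma>\<close> has no influence on the triangles, and the tagging amounts to a choice
  of one refinement edge per triangle.\<close>

type_synonym 'n tsimplex = "(real^'n) list \<times> nat"
type_synonym 'n mesh = "'n tsimplex set"

definition bisect :: "'n::finite tsimplex \<Rightarrow> 'n mesh" where
  "bisect K = (let xs = fst K; \<gamma> = snd K; d = length xs - 1;
       m = midpoint (hd xs) (last xs); inner = butlast (tl xs); \<gamma>' = (\<gamma> + 1) mod d
     in {(hd xs # m # inner, \<gamma>'), (last xs # m # take \<gamma> inner @ rev (drop \<gamma> inner), \<gamma>')})"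

definition hull_of :: "'n::finite tsimplex \<Rightarrow> (real^'n) set" where
  "hull_of K = convex hull (set (fst K))"

definition conforming_mesh :: "(real^'n::finite) set \<Rightarrow> 'n mesh \<Rightarrow> bool" where
  "conforming_mesh D T \<longleftrightarrow> finite T \<and>
     (\<forall>K\<in>T. length (fst K) = CARD('n) + 1 \<and> distinct (fst K) \<and>
            \<not> affine_dependent (set (fst K)) \<and> snd K < CARD('n)) \<and>
     (\<Union>K\<in>T. hull_of K) = closure D \<and>
     (\<forall>K\<in>T. \<forall>K'\<in>T. K \<noteq> K' \<longrightarrow> set (fst K) \<noteq> set (fst K') \<and>
        hull_of K \<inter> hull_of K' = convex hull (set (fst K) \<inter> set (fst K')))"

definition vertices :: "'n::finite mesh \<Rightarrow> (real^'n) set" where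
  "vertices T = (\<Union>K\<in>T. set (fst K))"

definition edge_midpoints :: "'n::finite mesh \<Rightarrow> (real^'n) set" where
  "edge_midpoints T = {midpoint p q | p q. p \<noteq> q \<and> (\<exists>K\<in>T. p \<in> set (fst K) \<and> q \<in> set (fst K))}"

definition bisection_step :: "'n::finite mesh \<Rightarrow> 'n mesh \<Rightarrow> bool" where
  "bisection_step T T' \<longleftrightarrow> (\<exists>K\<in>T. T' = (T - {K}) \<union> bisect K)"

definition refinements :: "(real^'n::finite) set \<Rightarrow> 'n mesh \<Rightarrow> 'n mesh set" where
  "refinements D T = {T'. bisection_step\<^sup>*\<^sup>* T T' \<and> conforming_mesh D T'}"

text \<open>\<open>is_refine D T N T'\<close>: \<open>T'\<close> is the coarsest refinement of \<open>T\<close> whose vertices include \<open>N\<close>.\<close>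

definition is_refine :: "(real^'n::finite) set \<Rightarrow> 'n mesh \<Rightarrow> (real^'n) set \<Rightarrow> 'n mesh \<Rightarrow> bool" where
  "is_refine D T N T' \<longleftrightarrow> T' \<in> refinements D T \<and> N \<subseteq> vertices T' \<and>
     (\<forall>T''\<in>refinements D T. N \<subseteq> vertices T'' \<longrightarrow> T'' \<in> refinements D T')"

text \<open>In two dimensions every triangle is split by three bisections (itself and both children).
  Otherwise it is the coarsest refinement in which every edge is bisected. Both this notion and
  the preceding one are relations, since existence of coarsest refinements in three dimensions
  depends on the tagging of the initial mesh.\<close>

definition is_uniform_refinement :: "(real^'n::finite) set \<Rightarrow> 'n mesh \<Rightarrow> 'n mesh \<Rightarrow> bool" where
  "is_uniform_refinement D T T' \<longleftrightarrow>
     (if CARD('n) = 2 then T' \<in> refinements D T \<and> T' = (\<Union>K\<in>T. \<Union>K'\<in>bisect K. bisect K')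
      else is_refine D T (edge_midpoints T) T')"

definition new_vertices :: "(real^'n::finite) set \<Rightarrow> 'n mesh \<Rightarrow> 'n mesh \<Rightarrow> (real^'n) set" where
  "new_vertices D T That = (vertices That - vertices T) - frontier D"

text \<open>Functions in \<open>S\<^sup>1\<^sub>0\<close> are extended by zero outside \<open>D\<close>.\<close>

definition S10 :: "(real^'n::finite) set \<Rightarrow> 'n mesh \<Rightarrow> (real^'n \<Rightarrow> real) set" where
  "S10 D T = {v \<in> H10 D. continuous_on UNIV v \<and> (\<forall>x. x \<notin> D \<longrightarrow> v x = 0) \<and>
     (\<forall>K\<in>T. \<exists>b c. \<forall>x\<in>hull_of K. v x = b \<bullet> x + c)}"

definition hat_function :: "(real^'n::finite) set \<Rightarrow> 'n mesh \<Rightarrow> real^'n \<Rightarrow> real^'n \<Rightarrow> real" where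
  "hat_function D T \<xi> = (THE \<phi>. \<phi> \<in> S10 D T \<and> \<phi> \<xi> = 1 \<and> (\<forall>\<eta>\<in>vertices T - {\<xi>}. \<phi> \<eta> = 0))"


section \<open>The parametric problem\<close>

text \<open>Parameters are numbered from 0: \<open>coeff pr m\<close>, \<open>prm pr m\<close> and \<open>opoly pr m\<close> belong
  to the \<open>(m+1)\<close>-st parameter; the mean field \<open>a\<^sub>0\<close> is \<open>coeff0 pr\<close>.\<close>

record ('n::finite) sgfem_data =
  dom :: "(real^'n) set"
  coeff0 :: "real^'n \<Rightarrow> real"
  coeff0_min :: real
  coeff0_max :: real
  coeff :: "nat \<Rightarrow> real^'n \<Rightarrow> real"
  prm :: "nat \<Rightarrow> real measure"
  opoly :: "nat \<Rightarrow> nat \<Rightarrow> real poly"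
  rhs :: "(nat \<Rightarrow> real) \<Rightarrow> (real^'n \<Rightarrow> real) \<Rightarrow> real"
  mesh0 :: "'n mesh"

definition tau :: "'n::finite sgfem_data \<Rightarrow> real" where
  "tau pr = real_of_ereal (Linf_norm (dom pr) (\<lambda>x. \<Sum>m. \<bar>coeff pr m x\<bar>)) / coeff0_min pr"

text \<open>The product measure; its space is the set of all sequences in \<open>[-1,1]\<close>.\<close>

definition par :: "'n::finite sgfem_data \<Rightarrow> (nat \<Rightarrow> real) measure" where
  "par pr = (\<Pi>\<^sub>M m\<in>UNIV. prm pr m)"

definition parametric_problem :: "'n::finite sgfem_data \<Rightarrow> bool" where
  "parametric_problem pr \<longleftrightarrow>
     lipschitz_domain (dom pr) \<and> bounded (dom pr) \<and> polytopal_boundary (dom pr) \<and>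
     (\<forall>m. prob_space (prm pr m) \<and> sets (prm pr m) = sets (restrict_space borel {-1..1}) \<and>
          distr (prm pr m) (prm pr m) uminus = prm pr m) \<and>
     coeff0 pr \<in> borel_measurable (lebesgue_on (dom pr)) \<and> 0 < coeff0_min pr \<and>
     (AE x in lebesgue_on (dom pr). coeff0_min pr \<le> coeff0 pr x \<and> coeff0 pr x \<le> coeff0_max pr) \<and>
     (\<forall>m. coeff pr m \<in> Linf (dom pr)) \<and>
     summable (\<lambda>m. real_of_ereal (Linf_norm (dom pr) (coeff pr m))) \<and> tau pr < 1 \<and>
     rhs pr \<in> bochner_L2 (par pr) (dual_H10 (dom pr)) (dual_H10_norm (dom pr)) \<and>
     (\<forall>m. opoly pr m 0 = 1 \<and> (\<forall>n. degree (opoly pr m n) = n) \<and>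
          (\<forall>i j. (LINT t|prm pr m. poly (opoly pr m i) t * poly (opoly pr m j) t) = (if i = j then 1 else 0))) \<and>
     conforming_mesh (dom pr) (mesh0 pr)"

text \<open>Elements \<open>v\<close> of the Bochner space are curried: \<open>v y x\<close> with parameter \<open>y\<close>, point \<open>x\<close>.\<close>

type_synonym 'n rfun = "(nat \<Rightarrow> real) \<Rightarrow> real^'n \<Rightarrow> real"

definition VV :: "'n::finite sgfem_data \<Rightarrow> 'n rfun set" where
  "VV pr = bochner_L2 (par pr) (H10 (dom pr)) (H1_norm (dom pr))"

definition V_norm :: "'n::finite sgfem_data \<Rightarrow> 'n rfun \<Rightarrow> real" where
  "V_norm pr v = sqrt (LINT y|par pr. (H1_norm (dom pr) (v y))\<^sup>2)"

definition BB :: "'n::finite sgfem_data \<Rightarrow> 'n rfun \<Rightarrow> 'n rfun \<Rightarrow> real" where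
  "BB pr u v =
     (LINT y|par pr. LINT x|lebesgue_on (dom pr).
        coeff0 pr x * (grad (dom pr) (u y) x \<bullet> grad (dom pr) (v y) x)) +
     (\<Sum>m. LINT y|par pr. LINT x|lebesgue_on (dom pr).
        y m * coeff pr m x * (grad (dom pr) (u y) x \<bullet> grad (dom pr) (v y) x))"

definition FF :: "'n::finite sgfem_data \<Rightarrow> 'n rfun \<Rightarrow> real" where
  "FF pr v = (LINT y|par pr. rhs pr y (v y))"

definition energy_norm :: "'n::finite sgfem_data \<Rightarrow> 'n rfun \<Rightarrow> real" where
  "energy_norm pr v = sqrt (BB pr v v)"

definition primal_solution :: "'n::finite sgfem_data \<Rightarrow> 'n rfun \<Rightarrow> bool" where
  "primal_solution pr u \<longleftrightarrow> u \<in> VV pr \<and> (\<forall>v\<in>VV pr. BB pr u v = FF pr v)"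

definition dual_V :: "'n::finite sgfem_data \<Rightarrow> ('n rfun \<Rightarrow> real) set" where
  "dual_V pr = {\<phi>. (\<forall>u\<in>VV pr. \<forall>v\<in>VV pr. \<forall>c. \<phi> (\<lambda>y x. u y x + c * v y x) = \<phi> u + c * \<phi> v) \<and>
     (\<exists>C. \<forall>v\<in>VV pr. \<bar>\<phi> v\<bar> \<le> C * V_norm pr v)}"

text \<open>\<open>g'\<close> is the Gateaux derivative of the goal functional \<open>g\<close>. Continuity with respect to the
  seminorm \<open>V_norm\<close> makes \<open>g\<close> and \<open>g'\<close> independent of representatives.\<close>

definition goal_functional ::
    "'n::finite sgfem_data \<Rightarrow> real \<Rightarrow> ('n rfun \<Rightarrow> real) \<Rightarrow> ('n rfun \<Rightarrow> 'n rfun \<Rightarrow> real) \<Rightarrow> bool" where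
  "goal_functional pr Cgoal g g' \<longleftrightarrow>
     (\<forall>v\<in>VV pr. \<forall>\<epsilon>>0. \<exists>\<delta>>0. \<forall>w\<in>VV pr. V_norm pr (w - v) < \<delta> \<longrightarrow> \<bar>g w - g v\<bar> < \<epsilon>) \<and>
     (\<forall>v\<in>VV pr. g' v \<in> dual_V pr) \<and>
     (\<forall>v\<in>VV pr. \<forall>z\<in>VV pr. ((\<lambda>t. (g (\<lambda>y x. v y x + t * z y x) - g v) / t) \<longlongrightarrow> g' v z) (at 0)) \<and>
     (\<forall>v\<in>VV pr. \<forall>\<epsilon>>0. \<exists>\<delta>>0. \<forall>w\<in>VV pr. V_norm pr (w - v) < \<delta> \<longrightarrow>
        (\<forall>z\<in>VV pr. \<bar>g' w z - g' v z\<bar> \<le> \<epsilon> * V_norm pr z)) \<and>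
     (\<forall>v\<in>VV pr. \<forall>w\<in>VV pr. \<forall>z\<in>VV pr.
        \<bar>g' v z - g' w z\<bar> \<le> Cgoal * energy_norm pr (v - w) * energy_norm pr z)"

definition dual_solution :: "'n::finite sgfem_data \<Rightarrow> ('n rfun \<Rightarrow> real) \<Rightarrow> 'n rfun \<Rightarrow> bool" where
  "dual_solution pr \<phi> z \<longleftrightarrow> z \<in> VV pr \<and> (\<forall>v\<in>VV pr. BB pr v z = \<phi> v)"


section \<open>Multilevel structures, Galerkin projections and error estimates\<close>

type_synonym mindex = "nat \<Rightarrow> nat"

definition multi_indices :: "mindex set" where
  "multi_indices = {\<nu>. finite {m. \<nu> m \<noteq> 0}}"

text \<open>The factors outside the support of \<open>\<nu>\<close> are 1.\<close>

definition PP :: "'n::finite sgfem_data \<Rightarrow> mindex \<Rightarrow> (nat \<Rightarrow> real) \<Rightarrow> real" where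
  "PP pr \<nu> y = (\<Prod>m\<in>{m. \<nu> m \<noteq> 0}. poly (opoly pr m (\<nu> m)) (y m))"

text \<open>With parameters numbered from 0, the range \<open>{1..M+1}\<close> becomes \<open>{0..M}\<close>.\<close>

definition detail_indices :: "mindex set \<Rightarrow> mindex set" where
  "detail_indices P = {\<mu> \<in> multi_indices - P.
     \<exists>\<nu>\<in>P. \<exists>m \<le> card (\<Union>\<nu>'\<in>P. {k. \<nu>' k \<noteq> 0}).
       \<mu> = \<nu>(m := \<nu> m + 1) \<or> (1 \<le> \<nu> m \<and> \<mu> = \<nu>(m := \<nu> m - 1))}"

record ('n::finite) mlevel =
  inds :: "mindex set"
  mesh :: "mindex \<Rightarrow> 'n mesh"

inductive multilevel_structure :: "'n::finite sgfem_data \<Rightarrow> 'n mlevel \<Rightarrow> bool"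
  for pr where
  initial: "multilevel_structure pr \<lparr>inds = {\<lambda>_. 0}, mesh = (\<lambda>_. mesh0 pr)\<rparr>"
| refined: "\<lbrakk>multilevel_structure pr P; \<M> \<subseteq> detail_indices (inds P);
    \<And>\<nu>. \<nu> \<in> inds P \<Longrightarrow> \<exists>That N. is_uniform_refinement (dom pr) (mesh P \<nu>) That \<and>
        N \<subseteq> new_vertices (dom pr) (mesh P \<nu>) That \<and> is_refine (dom pr) (mesh P \<nu>) N (T' \<nu>);
    \<And>\<nu>. \<nu> \<notin> inds P \<Longrightarrow> T' \<nu> = mesh0 pr\<rbrakk>
   \<Longrightarrow> multilevel_structure pr \<lparr>inds = inds P \<union> \<M>, mesh = T'\<rparr>"

text \<open>\<open>Th \<nu>\<close> is the uniform refinement of the mesh of \<open>\<nu>\<close>.\<close>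

definition uniform_refinements :: "'n::finite sgfem_data \<Rightarrow> 'n mlevel \<Rightarrow> (mindex \<Rightarrow> 'n mesh) \<Rightarrow> bool" where
  "uniform_refinements pr P Th \<longleftrightarrow> (\<forall>\<nu>\<in>inds P. is_uniform_refinement (dom pr) (mesh P \<nu>) (Th \<nu>))"

definition Vspace :: "'n::finite sgfem_data \<Rightarrow> 'n mlevel \<Rightarrow> 'n rfun set" where
  "Vspace pr P = {\<lambda>y x. \<Sum>\<nu>\<in>inds P. c \<nu> x * PP pr \<nu> y | c. \<forall>\<nu>\<in>inds P. c \<nu> \<in> S10 (dom pr) (mesh P \<nu>)}"

definition Vhat_space :: "'n::finite sgfem_data \<Rightarrow> 'n mlevel \<Rightarrow> (mindex \<Rightarrow> 'n mesh) \<Rightarrow> 'n rfun set" where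
  "Vhat_space pr P Th = {\<lambda>y x. (\<Sum>\<nu>\<in>inds P. c \<nu> x * PP pr \<nu> y) +
        (\<Sum>\<nu>\<in>detail_indices (inds P). c \<nu> x * PP pr \<nu> y) | c.
     (\<forall>\<nu>\<in>inds P. c \<nu> \<in> S10 (dom pr) (Th \<nu>)) \<and>
     (\<forall>\<nu>\<in>detail_indices (inds P). c \<nu> \<in> S10 (dom pr) (mesh0 pr))}"

text \<open>Galerkin projections onto these spaces exist and are unique up to null sets.\<close>

definition galerkin :: "'n::finite sgfem_data \<Rightarrow> 'n rfun set \<Rightarrow> 'n rfun \<Rightarrow> 'n rfun" where
  "galerkin pr W w = (SOME p. p \<in> W \<and> (\<forall>v\<in>W. BB pr p v = BB pr w v))"

definition ip_D :: "'n::finite sgfem_data \<Rightarrow> (real^'n \<Rightarrow> real) \<Rightarrow> (real^'n \<Rightarrow> real) \<Rightarrow> real" where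
  "ip_D pr w v = (LINT x|lebesgue_on (dom pr). coeff0 pr x * (grad (dom pr) w x \<bullet> grad (dom pr) v x))"

definition norm_D :: "'n::finite sgfem_data \<Rightarrow> (real^'n \<Rightarrow> real) \<Rightarrow> real" where
  "norm_D pr v = sqrt (ip_D pr v v)"

definition est_par :: "'n::finite sgfem_data \<Rightarrow> 'n mlevel \<Rightarrow> 'n rfun \<Rightarrow> mindex \<Rightarrow> real" where
  "est_par pr P w \<nu> = norm_D pr (THE e. e \<in> S10 (dom pr) (mesh0 pr) \<and>
     (\<forall>v0\<in>S10 (dom pr) (mesh0 pr).
        ip_D pr e v0 = BB pr (w - galerkin pr (Vspace pr P) w) (\<lambda>y x. v0 x * PP pr \<nu> y)))"

definition est_space ::
    "'n::finite sgfem_data \<Rightarrow> 'n mlevel \<Rightarrow> (mindex \<Rightarrow> 'n mesh) \<Rightarrow> 'n rfun \<Rightarrow> mindex \<Rightarrow> real^'n \<Rightarrow> real" where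
  "est_space pr P Th w \<nu> \<xi> = (let \<phi> = hat_function (dom pr) (Th \<nu>) \<xi> in
     \<bar>BB pr (w - galerkin pr (Vspace pr P) w) (\<lambda>y x. \<phi> x * PP pr \<nu> y)\<bar> / norm_D pr \<phi>)"

definition estimator ::
    "'n::finite sgfem_data \<Rightarrow> 'n mlevel \<Rightarrow> (mindex \<Rightarrow> 'n mesh) \<Rightarrow> 'n rfun \<Rightarrow> real" where
  "estimator pr P Th w = sqrt (
     (\<Sum>\<nu>\<in>inds P. \<Sum>\<xi>\<in>new_vertices (dom pr) (mesh P \<nu>) (Th \<nu>). (est_space pr P Th w \<nu> \<xi>)\<^sup>2) +
     (\<Sum>\<nu>\<in>detail_indices (inds P). (est_par pr P w \<nu>)\<^sup>2))"

text \<open>\<open>Cest\<close> is an admissible constant in the two-level estimate, for every multilevel structure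
  and every \<open>w\<close>.\<close>

definition two_level_constant :: "'n::finite sgfem_data \<Rightarrow> real \<Rightarrow> bool" where
  "two_level_constant pr Cest \<longleftrightarrow>
     (\<forall>P Th w. multilevel_structure pr P \<and> uniform_refinements pr P Th \<and> w \<in> VV pr \<longrightarrow>
        inverse Cest * energy_norm pr (galerkin pr (Vhat_space pr P Th) w - galerkin pr (Vspace pr P) w)
          \<le> estimator pr P Th w \<and>
        estimator pr P Th w
          \<le> Cest * energy_norm pr (galerkin pr (Vhat_space pr P Th) w - galerkin pr (Vspace pr P) w))"

definition saturation ::
    "'n::finite sgfem_data \<Rightarrow> 'n mlevel \<Rightarrow> (mindex \<Rightarrow> 'n mesh) \<Rightarrow> real \<Rightarrow> 'n rfun \<Rightarrow> bool" where
  "saturation pr P Th qsat w \<longleftrightarrow>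
     energy_norm pr (w - galerkin pr (Vhat_space pr P Th) w)
       \<le> qsat * energy_norm pr (w - galerkin pr (Vspace pr P) w)"

end

theory Submission
  imports Defs
begin

text \<open>Write \<open>e = u - u\<^sub>\<bullet>\<close> and \<open>\<parallel>v\<parallel>\<close> for the energy norm. The mean value theorem on the segment from
  \<open>u\<^sub>\<bullet>\<close> to \<open>u\<close> and the Lipschitz bound on \<open>g'\<close> replace \<open>g u - g u\<^sub>\<bullet>\<close> by \<open>g' u\<^sub>\<bullet> e\<close> up to
  \<open>Cgoal * \<parallel>e\<parallel>\<^sup>2\<close> (\<open>goal_linearization_error\<close>). By definition of the dual solution
  \<open>z = z[u\<^sub>\<bullet>]\<close> and Galerkin orthogonality, \<open>g' u\<^sub>\<bullet> e = B(e, z) = B(e, z - z\<^sub>\<bullet>)\<close>, so that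
  \<open>\<bar>g u - g u\<^sub>\<bullet>\<bar> \<le> \<parallel>e\<parallel> * (Cgoal * \<parallel>e\<parallel> + \<parallel>z - z\<^sub>\<bullet>\<parallel>)\<close> by the Cauchy-Schwarz inequality.

  Saturation and the triangle inequality bound a Galerkin error by the distance of the two
  Galerkin projections (\<open>saturated_error_le\<close>), hence by the estimator. For \<open>u\<close>, with estimator \<open>\<mu>\<close> and \<open>q = qsat\<close>, this gives
  \<open>\<parallel>e\<parallel> \<le> Cest / (1 - q) * \<mu>\<close>. For the dual problem saturation concerns \<open>z[u]\<close>, whereas
  the estimator \<open>\<zeta>\<close> belongs to \<open>z[u\<^sub>\<bullet>]\<close>. The two dual solutions differ by at most
  \<open>Cgoal * \<parallel>e\<parallel>\<close> (\<open>dual_solutions_dist\<close>) and Galerkin projections are nonexpansive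
  (\<open>galerkin_stable\<close>), so exchanging them costs a multiple of \<open>\<parallel>e\<parallel>\<close> only, and
  \<open>\<parallel>z - z\<^sub>\<bullet>\<parallel>\<close> is bounded by a combination of \<open>\<mu>\<close> and \<open>\<zeta>\<close>.

  This argument needs that \<open>B\<close> is a symmetric positive semidefinite bilinear form on the
  Bochner space and that the Galerkin projections exist. Both are proved for the concrete
  spaces. Since elements are represented by functions, \<open>B\<close> has a kernel, and the Hilbert
  space algebra is done for semidefinite forms (locale \<open>psd_form\<close>). Bilinearity rests on the
  almost everywhere linearity of \<open>grad\<close>, which is only some choice of a weak gradient: weak
  gradients are unique by the fundamental lemma of the calculus of variations
  (\<open>fundamental_lemma\<close>), for which bump functions exhausting a box are constructed.
  Semidefiniteness is the assumption \<open>\<tau> < 1\<close>, applied to partial sums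
  (\<open>grad_form_perturbation_le\<close>). The Galerkin projections exist because a finite element
  function is determined by its finitely many vertex values
  (\<open>riesz_finite_coordinates\<close>).\<close>

section \<open>Smooth bump functions\<close>

lemma smooth_differentiable: "smooth f \<Longrightarrow> f differentiable (at x)"
  unfolding smooth_def by (metis foldr.simps(1) id_apply)

lemma smooth_partial: "smooth f \<Longrightarrow> smooth (partial i f)"
  unfolding smooth_def
proof (intro allI)
  fix "is" x assume *: "\<forall>is x. foldr partial is f differentiable (at x)"
  have "foldr partial is (partial i f) = foldr partial (is @ [i]) f" by simp
  then show "foldr partial is (partial i f) differentiable (at x)" using * by metis
qed

lemma smooth_continuous: "smooth f \<Longrightarrow> continuous_on S f"
  by (metis smooth_differentiable differentiable_imp_continuous_within continuous_at_imp_continuous_on)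

lemma partial_eqI:
  assumes "(f has_derivative f') (at x)" shows "partial i f x = f' (axis i 1)"
  unfolding partial_def using frechet_derivative_at[OF assms] by simp

lemma differentiable_has_derivative_frechet:
  "f differentiable (at x) \<Longrightarrow> (f has_derivative frechet_derivative f (at x)) (at x)"
  using frechet_derivative_works by blast

lemma partial_add_mult:
  assumes "f differentiable (at x)" "g differentiable (at x)"
  shows "partial i (\<lambda>x. f x + c * g x) x = partial i f x + c * partial i g x"
proof -
  have "((\<lambda>x. f x + c * g x) has_derivative
      (\<lambda>h. frechet_derivative f (at x) h + c * frechet_derivative g (at x) h)) (at x)"
    by (intro derivative_intros differentiable_has_derivative_frechet assms)
  from partial_eqI[OF this] show ?thesis by (simp add: partial_def)
qed

lemma partial_mult:
  assumes "f differentiable (at x)" "g differentiable (at x)"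
  shows "partial i (\<lambda>x. f x * g x) x = f x * partial i g x + partial i f x * g x"
proof -
  have "((\<lambda>x. f x * g x) has_derivative
      (\<lambda>h. f x * frechet_derivative g (at x) h + frechet_derivative f (at x) h * g x)) (at x)"
    by (intro derivative_intros differentiable_has_derivative_frechet assms)
  from partial_eqI[OF this] show ?thesis by (simp add: partial_def)
qed

lemma smooth_lincomb:
  assumes "smooth f" "smooth g" shows "smooth (\<lambda>x. f x + c * g x)"
proof -
  have eq: "foldr partial is (\<lambda>x. f x + c * g x) = (\<lambda>x. foldr partial is f x + c * foldr partial is g x)" for "is"
  proof (induction "is")
    case (Cons i "is")
    have "foldr partial is f differentiable (at x)" "foldr partial is g differentiable (at x)" for x
      using assms unfolding smooth_def by auto
    then show ?case by (simp add: Cons partial_add_mult fun_eq_iff)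
  qed simp
  show ?thesis unfolding smooth_def eq
    using assms by (auto simp: smooth_def intro!: derivative_intros)
qed

text \<open>Smoothness involves all iterated partial derivatives at once; it is convenient to exhibit
  a class of differentiable functions that partial differentiation does not leave.\<close>

lemma smooth_coinduct:
  assumes "f \<in> A" "\<And>g x. g \<in> A \<Longrightarrow> g differentiable (at x)" "\<And>g i. g \<in> A \<Longrightarrow> partial i g \<in> A"
  shows "smooth f"
proof -
  have "foldr partial is f \<in> A" for "is" by (induction "is") (use assms in auto)
  then show ?thesis using assms(2) unfolding smooth_def by blast
qed

text \<open>The functions \<open>p(1/t) exp(-1/t)\<close>, extended by \<open>0\<close> to \<open>t \<le> 0\<close>, are closed under
  differentiation, which makes \<open>exp(-1/t)\<close> itself infinitely differentiable.\<close>

definition exp_flat :: "real poly \<Rightarrow> real \<Rightarrow> real" where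
  "exp_flat p t = (if t > 0 then poly p (1 / t) * exp (- 1 / t) else 0)"

lemma poly_mult_exp_minus_tendsto_0: "((\<lambda>s::real. poly p s * exp (- s)) \<longlongrightarrow> 0) at_top"
proof -
  have "((\<lambda>s::real. \<Sum>i\<le>degree p. Polynomial.coeff p i * (s ^ i / exp s)) \<longlongrightarrow> (\<Sum>i\<le>degree p. Polynomial.coeff p i * 0)) at_top"
    by (intro tendsto_intros tendsto_power_div_exp_0)
  then show ?thesis
    by (simp add: poly_altdef sum_distrib_right sum_divide_distrib exp_minus field_simps)
qed

lemma flat_has_real_derivative:
  "(exp_flat p has_real_derivative exp_flat ([:0, 0, 1:] * (p - pderiv p)) t) (at t)"
proof -
  consider "t > 0" | "t < 0" | "t = 0" by linarith
  then show ?thesis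
  proof cases
    case 1
    have "((\<lambda>t. poly p (1 / t) * exp (- 1 / t)) has_real_derivative exp_flat ([:0, 0, 1:] * (p - pderiv p)) t) (at t)"
      using 1 by (auto intro!: derivative_eq_intros simp: exp_flat_def field_simps power2_eq_square)
    moreover have "\<forall>\<^sub>F x in nhds t. exp_flat p x = poly p (1 / x) * exp (- 1 / x)"
      using eventually_nhds_in_open[of "{0<..}" t] 1 by (auto elim!: eventually_mono simp: exp_flat_def)
    ultimately show ?thesis by (subst DERIV_cong_ev) auto
  next
    case 2
    have "\<forall>\<^sub>F x in nhds t. exp_flat p x = 0"
      using eventually_nhds_in_open[of "{..<0}" t] 2 by (auto elim!: eventually_mono simp: exp_flat_def)
    moreover have "((\<lambda>t. 0) has_real_derivative exp_flat ([:0, 0, 1:] * (p - pderiv p)) t) (at t)"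
      using 2 by (auto simp: exp_flat_def)
    ultimately show ?thesis by (subst DERIV_cong_ev) auto
  next
    case 3
    \<comment> \<open>At the origin the two one-sided difference quotients are treated separately;
      on the right the substitution \<open>t = 1/s\<close> turns the limit into \<open>s p(s) exp(-s) \<longlongrightarrow> 0\<close>.\<close>
    have "((\<lambda>h. exp_flat p h / h) \<longlongrightarrow> 0) (at_left 0)"
      by (rule tendsto_eventually) (auto simp: eventually_at_filter exp_flat_def)
    moreover have "((\<lambda>h. exp_flat p h / h) \<longlongrightarrow> 0) (at_right 0)"
    proof -
      have "((\<lambda>s. exp_flat p (inverse s) / inverse s) \<longlongrightarrow> 0) at_top"
      proof (rule Lim_transform_eventually[OF poly_mult_exp_minus_tendsto_0[of "[:0, 1:] * p"]])
        show "\<forall>\<^sub>F s in at_top. poly ([:0, 1:] * p) s * exp (- s) = exp_flat p (inverse s) / inverse s"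
          using eventually_gt_at_top[of 0] by eventually_elim (auto simp: exp_flat_def field_simps)
      qed
      then show ?thesis by (simp add: filterlim_at_right_to_top)
    qed
    ultimately have "((\<lambda>h. exp_flat p h / h) \<longlongrightarrow> 0) (at 0)"
      using filterlim_split_at by blast
    then show ?thesis using 3 by (simp add: DERIV_def exp_flat_def)
  qed
qed

text \<open>The functions of several variables that are generated by the one-dimensional flat functions
  of affine functions of single coordinates. The chain, sum and product rules keep partial
  derivatives inside this algebra.\<close>

inductive_set flat_algebra :: "(real^'n::finite \<Rightarrow> real) set" where
  exp_flat: "(\<lambda>x. exp_flat p (\<alpha> * x $ (i::'n) + \<beta>)) \<in> flat_algebra"
| const: "(\<lambda>x. c) \<in> flat_algebra"
| add: "f \<in> flat_algebra \<Longrightarrow> g \<in> flat_algebra \<Longrightarrow> (\<lambda>x. f x + g x) \<in> flat_algebra"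
| mult: "f \<in> flat_algebra \<Longrightarrow> g \<in> flat_algebra \<Longrightarrow> (\<lambda>x. f x * g x) \<in> flat_algebra"

lemma flat_algebra_prod:
  "finite J \<Longrightarrow> (\<And>j. j \<in> J \<Longrightarrow> f j \<in> flat_algebra) \<Longrightarrow> (\<lambda>x. \<Prod>j\<in>J. f j x) \<in> flat_algebra"
  by (induction J rule: finite_induct) (auto intro: flat_algebra.intros)

lemma flat_algebra_closed:
  fixes f :: "real^'n::finite \<Rightarrow> real"
  shows "f \<in> flat_algebra \<Longrightarrow> (\<forall>x. f differentiable (at x)) \<and> (\<forall>i. partial i f \<in> flat_algebra)"
proof (induction rule: flat_algebra.induct)
  case (exp_flat p \<alpha> i \<beta>)
  let ?q = "[:0, 0, 1:] * (p - pderiv p)"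
  have D: "((\<lambda>x. exp_flat p (\<alpha> * x $ i + \<beta>)) has_derivative
      (\<lambda>h. (\<alpha> * h $ i) * exp_flat ?q (\<alpha> * x $ i + \<beta>))) (at x)" for x :: "real^'n"
  proof -
    have "((\<lambda>x. \<alpha> * x $ i + \<beta>) has_derivative (\<lambda>h. \<alpha> * h $ i)) (at x)"
      by (auto intro!: derivative_eq_intros bounded_linear_imp_has_derivative bounded_linear_vec_nth)
    from has_derivative_compose[OF this
        flat_has_real_derivative[of p "\<alpha> * x $ i + \<beta>", unfolded has_field_derivative_def]]
    show ?thesis by (simp add: mult_ac)
  qed
  have "partial j (\<lambda>x. exp_flat p (\<alpha> * x $ i + \<beta>)) = (\<lambda>x. (\<alpha> * axis j 1 $ i) * exp_flat ?q (\<alpha> * x $ i + \<beta>))" for j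
    using partial_eqI[OF D] by (simp add: fun_eq_iff)
  then show ?case using D unfolding differentiable_def
    by (auto intro!: flat_algebra.intros)
next
  case (const c)
  have "partial i (\<lambda>x. c) = (\<lambda>x. 0)" for i :: 'n
    by (auto intro!: partial_eqI derivative_eq_intros)
  then show ?case by (auto intro: flat_algebra.intros)
next
  case (add f g)
  have "partial i (\<lambda>x. f x + g x) = (\<lambda>x. partial i f x + partial i g x)" for i
    using partial_add_mult[of f _ g i 1] add.IH by (auto simp: fun_eq_iff)
  then show ?case using add.IH by (auto intro!: flat_algebra.intros derivative_intros)
next
  case (mult f g)
  have "partial i (\<lambda>x. f x * g x) = (\<lambda>x. f x * partial i g x + partial i f x * g x)" for i
    using partial_mult[of f _ g i] mult.IH by (auto simp: fun_eq_iff)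
  then show ?case using mult by (auto intro!: flat_algebra.intros derivative_intros)
qed

lemma smooth_flat_algebra: "f \<in> flat_algebra \<Longrightarrow> smooth f"
  by (rule smooth_coinduct[of f flat_algebra]) (use flat_algebra_closed in auto)

text \<open>Each factor \<open>exp(-1/(k s))\<close> vanishes for \<open>s \<le> 0\<close> and tends to \<open>1\<close> for \<open>s > 0\<close> as
  \<open>k\<close> grows. Hence all these functions live on the same box and converge pointwise to its
  indicator.\<close>

definition box_bump :: "real \<Rightarrow> real^'n \<Rightarrow> real^'n \<Rightarrow> real^'n::finite \<Rightarrow> real" where
  "box_bump k a b x = (\<Prod>i\<in>UNIV. exp_flat 1 (k * (x $ i - a $ i)) * exp_flat 1 (k * (b $ i - x $ i)))"

lemma flat_1_bounds: "0 \<le> exp_flat 1 t" "exp_flat 1 t \<le> 1"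
  by (auto simp: exp_flat_def)

lemma flat_1_eq_0_iff: "exp_flat 1 t = 0 \<longleftrightarrow> t \<le> 0"
  by (auto simp: exp_flat_def)

lemma box_bump_bounds: "0 \<le> box_bump k a b x" "box_bump k a b x \<le> 1"
  unfolding box_bump_def
  by (auto intro!: prod_nonneg prod_le_1 mult_le_one mult_nonneg_nonneg flat_1_bounds)

lemma box_bump_eq_0: "k > 0 \<Longrightarrow> x \<notin> box a b \<Longrightarrow> box_bump k a b x = 0"
  unfolding box_bump_def
  by (auto simp: mem_box_cart flat_1_eq_0_iff not_less mult_le_0_iff)

lemma smooth_box_bump: "smooth (box_bump k a b)"
proof -
  have 1: "(\<lambda>x. exp_flat 1 (k * (x $ i - a $ i))) \<in> flat_algebra" for i
    using flat_algebra.exp_flat[of 1 k i "- k * a $ i"] by (simp add: algebra_simps)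
  have 2: "(\<lambda>x. exp_flat 1 (k * (b $ i - x $ i))) \<in> flat_algebra" for i
    using flat_algebra.exp_flat[of 1 "- k" i "k * b $ i"] by (simp add: algebra_simps)
  have "box_bump k a b \<in> flat_algebra"
    unfolding box_bump_def[abs_def]
    by (intro flat_algebra_prod flat_algebra.mult 1 2) simp
  then show ?thesis by (rule smooth_flat_algebra)
qed

lemma box_bump_test_function:
  assumes "k > 0" "cbox a b \<subseteq> D" shows "box_bump k a b \<in> test_functions D"
proof -
  have "closure {x. box_bump k a b x \<noteq> 0} \<subseteq> cbox a b"
    by (intro closure_minimal subsetI) (use box_bump_eq_0[OF assms(1)] box_subset_cbox[of a b] in auto)
  moreover from this have "compact (closure {x. box_bump k a b x \<noteq> 0})"
    by (metis bounded_cbox bounded_subset closed_closure compact_eq_bounded_closed)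
  ultimately show ?thesis
    using assms smooth_box_bump unfolding test_functions_def by blast
qed

lemma flat_1_tendsto: "(\<lambda>n. exp_flat 1 (real (Suc n) * s)) \<longlonglongrightarrow> (if s > 0 then 1 else 0)"
proof (cases "s > 0")
  case True
  have "(\<lambda>n. exp (- ((1 / s) * inverse (real (Suc n))))) \<longlonglongrightarrow> exp (- ((1 / s) * 0))"
    by (intro tendsto_intros LIMSEQ_inverse_real_of_nat)
  moreover have "exp_flat 1 (real (Suc n) * s) = exp (- ((1 / s) * inverse (real (Suc n))))" for n
    using True by (simp add: exp_flat_def field_simps zero_less_mult_iff add_pos_nonneg)
  ultimately show ?thesis using True by simp
next
  case False
  then have "exp_flat 1 (real (Suc n) * s) = 0" for n
    by (simp add: flat_1_eq_0_iff mult_nonneg_nonpos)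
  then show ?thesis using False by simp
qed

lemma box_bump_tendsto: "(\<lambda>n. box_bump (real (Suc n)) a b x) \<longlonglongrightarrow> indicator (box a b) x"
proof -
  have "(\<lambda>n. box_bump (real (Suc n)) a b x) \<longlonglongrightarrow>
     (\<Prod>i\<in>UNIV. (if x $ i - a $ i > 0 then 1 else 0) * (if b $ i - x $ i > 0 then 1 else 0))"
    unfolding box_bump_def by (intro tendsto_prod tendsto_mult flat_1_tendsto)
  moreover have "(\<Prod>i\<in>UNIV. (if x $ i - a $ i > 0 then 1 else 0) * (if b $ i - x $ i > 0 then 1 else 0))
     = (indicator (box a b) x :: real)"
    by (auto simp: indicator_def mem_box_cart intro!: prod.neutral)
  ultimately show ?thesis by simp
qed

lemma test_functions_lincomb:
  assumes "\<phi> \<in> test_functions D" "\<psi> \<in> test_functions D"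
  shows "(\<lambda>x. \<phi> x + c * \<psi> x) \<in> test_functions D"
proof -
  let ?A = "closure {x. \<phi> x \<noteq> 0}" and ?B = "closure {x. \<psi> x \<noteq> 0}"
  let ?C = "closure {x. \<phi> x + c * \<psi> x \<noteq> 0}"
  have sub: "?C \<subseteq> ?A \<union> ?B"
  proof (rule closure_minimal)
    show "{x. \<phi> x + c * \<psi> x \<noteq> 0} \<subseteq> ?A \<union> ?B"
    proof
      fix x assume "x \<in> {x. \<phi> x + c * \<psi> x \<noteq> 0}"
      then have "x \<in> {x. \<phi> x \<noteq> 0} \<or> x \<in> {x. \<psi> x \<noteq> 0}" by auto
      then show "x \<in> ?A \<union> ?B"
        using subsetD[OF closure_subset, of x "{x. \<phi> x \<noteq> 0}"] subsetD[OF closure_subset, of x "{x. \<psi> x \<noteq> 0}"]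
        by (elim disjE) (simp_all only: Un_iff simp_thms)
    qed
  qed (intro closed_Un closed_closure)
  have AB: "compact ?A" "compact ?B" "?A \<subseteq> D" "?B \<subseteq> D" "smooth \<phi>" "smooth \<psi>"
    using assms unfolding test_functions_def by blast+
  have "compact ((?A \<union> ?B) \<inter> ?C)"
    by (intro compact_Int_closed compact_Un AB closed_closure)
  then have "compact ?C" using sub by (simp only: Int_absorb1)
  moreover have "?C \<subseteq> D" using sub AB(3,4) by (rule order_trans[OF _ Un_least])
  ultimately show ?thesis
    using smooth_lincomb[OF AB(5,6)] unfolding test_functions_def by (intro CollectI conjI)
qed

lemma zero_test_function: "(\<lambda>x. 0) \<in> test_functions D"
  using smooth_flat_algebra[OF flat_algebra.const] by (auto simp: test_functions_def)

section \<open>Square integrable functions\<close>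

lemma L2_inner_integrable:
  fixes f g :: "'a \<Rightarrow> 'b::euclidean_space"
  assumes "f \<in> L2 M" "g \<in> L2 M" shows "integrable M (\<lambda>x. f x \<bullet> g x)"
proof (rule Bochner_Integration.integrable_bound)
  show "integrable M (\<lambda>x. (norm (f x))\<^sup>2 + (norm (g x))\<^sup>2)" using assms by (auto simp: L2_def)
  show "(\<lambda>x. f x \<bullet> g x) \<in> borel_measurable M" using assms by (auto simp: L2_def)
  have "\<bar>f x \<bullet> g x\<bar> \<le> (norm (f x))\<^sup>2 + (norm (g x))\<^sup>2" for x
  proof -
    have "\<bar>f x \<bullet> g x\<bar> \<le> norm (f x) * norm (g x)" by (rule Cauchy_Schwarz_ineq2)
    also have "\<dots> \<le> 2 * (norm (f x) * norm (g x))" by simp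
    also have "\<dots> \<le> (norm (f x))\<^sup>2 + (norm (g x))\<^sup>2"
      using sum_squares_bound[of "norm (f x)" "norm (g x)"] by (simp add: power2_eq_square algebra_simps)
    finally show ?thesis .
  qed
  then show "AE x in M. norm (f x \<bullet> g x) \<le> norm ((norm (f x))\<^sup>2 + (norm (g x))\<^sup>2)" by simp
qed

lemma L2_mult_integrable:
  fixes f g :: "'a \<Rightarrow> real"
  assumes "f \<in> L2 M" "g \<in> L2 M" shows "integrable M (\<lambda>x. f x * g x)"
  using L2_inner_integrable[OF assms] by simp

lemma L2_lincomb:
  fixes f g :: "'a \<Rightarrow> 'b::euclidean_space"
  assumes "f \<in> L2 M" "g \<in> L2 M" shows "(\<lambda>x. f x + c *\<^sub>R g x) \<in> L2 M"
proof -
  have "integrable M (\<lambda>x. f x \<bullet> f x + 2 * c * (f x \<bullet> g x) + c\<^sup>2 * (g x \<bullet> g x))"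
    using assms by (intro Bochner_Integration.integrable_add integrable_mult_right L2_inner_integrable)
  moreover have "(norm (f x + c *\<^sub>R g x))\<^sup>2 = f x \<bullet> f x + 2 * c * (f x \<bullet> g x) + c\<^sup>2 * (g x \<bullet> g x)" for x
    unfolding power2_norm_eq_inner by (simp add: inner_simps inner_commute power2_eq_square algebra_simps)
  ultimately show ?thesis using assms by (auto simp: L2_def)
qed

lemma L2_nth:
  fixes G :: "'a \<Rightarrow> real^'n"
  assumes "G \<in> L2 M" shows "(\<lambda>x. G x $ i) \<in> L2 M"
proof -
  have eq: "G x $ i = G x \<bullet> axis i 1" for x by (simp add: inner_axis)
  have m: "(\<lambda>x. G x $ i) \<in> borel_measurable M" unfolding eq using assms by (auto simp: L2_def)
  have "integrable M (\<lambda>x. (norm (G x $ i))\<^sup>2)"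
  proof (rule Bochner_Integration.integrable_bound)
    show "integrable M (\<lambda>x. (norm (G x))\<^sup>2)" using assms by (auto simp: L2_def)
    show "AE x in M. norm ((norm (G x $ i))\<^sup>2) \<le> norm ((norm (G x))\<^sup>2)"
      by (intro always_eventually allI) (simp add: abs_le_square_iff[symmetric] component_le_norm_cart)
  qed (use m in measurable)
  then show ?thesis using m by (simp add: L2_def)
qed

lemma L2_vec:
  fixes g :: "'n::finite \<Rightarrow> 'a \<Rightarrow> real"
  assumes "\<And>i. g i \<in> L2 M" shows "(\<lambda>x. \<chi> i. g i x) \<in> L2 M"
proof -
  have "(\<lambda>x. \<Sum>i\<in>UNIV. g i x *\<^sub>R axis i 1 :: real^'n) \<in> borel_measurable M"
    using assms by (intro borel_measurable_sum borel_measurable_scaleR) (auto simp: L2_def)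
  moreover have "(\<lambda>x. \<Sum>i\<in>UNIV. g i x *\<^sub>R axis i 1) = (\<lambda>x. \<chi> i. g i x)"
    by (auto simp: vec_eq_iff fun_eq_iff axis_def if_distrib cong: if_cong)
  ultimately have "(\<lambda>x. \<chi> i. g i x) \<in> borel_measurable M" by simp
  moreover have "integrable M (\<lambda>x. \<Sum>i\<in>UNIV. g i x * g i x)"
    using assms by (intro Bochner_Integration.integrable_sum L2_mult_integrable) auto
  moreover have "(norm (\<chi> i. g i x))\<^sup>2 = (\<Sum>i\<in>UNIV. g i x * g i x)" for x
    by (simp add: power2_norm_eq_inner inner_vec_def)
  ultimately show ?thesis by (simp add: L2_def)
qed

section \<open>Integration by parts\<close>

lemma integral_lborel_translate:
  fixes f :: "'a::euclidean_space \<Rightarrow> real"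
  assumes [measurable]: "f \<in> borel_measurable borel"
  shows "(LINT x|lborel. f (c + x)) = (LINT x|lborel. f x)"
proof -
  have "(LINT x|distr lborel borel ((+) c). f x) = (LINT x|lborel. f (c + x))"
    by (rule integral_distr) auto
  then show ?thesis by (simp add: lborel_distr_plus)
qed

text \<open>The complement of \<open>K\<close> is open, so \<open>f\<close> vanishes near \<open>x\<close>.\<close>

lemma partial_eq_0_outside:
  assumes "closed K" "\<And>x. x \<notin> K \<Longrightarrow> f x = 0" "x \<notin> K"
  shows "partial i f x = 0"
proof -
  have "(f has_derivative (\<lambda>_. 0)) (at x)"
    by (rule has_derivative_transform_within_open[where f="\<lambda>_. 0" and s="- K"])
       (use assms in \<open>auto intro!: derivative_eq_intros\<close>)
  from partial_eqI[OF this] show ?thesis .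
qed

lemma integrable_compact_support:
  fixes f :: "real^'n \<Rightarrow> real"
  assumes "continuous_on UNIV f" "compact K" "\<And>x. x \<notin> K \<Longrightarrow> f x = 0"
  shows "integrable lborel f"
proof -
  have "integrable lborel (\<lambda>x. indicator K x *\<^sub>R f x)"
    using assms by (intro borel_integrable_compact) (auto intro: continuous_on_subset)
  moreover have "(\<lambda>x. indicator K x *\<^sub>R f x) = f" using assms(3) by (auto simp: indicator_def fun_eq_iff)
  ultimately show ?thesis by simp
qed

lemma has_real_derivative_line:
  fixes f :: "real^'n \<Rightarrow> real"
  assumes "f differentiable (at (x + t *\<^sub>R axis i 1))"
  shows "((\<lambda>t. f (x + t *\<^sub>R axis i 1)) has_real_derivative partial i f (x + t *\<^sub>R axis i 1)) (at t)"
proof -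
  let ?f' = "frechet_derivative f (at (x + t *\<^sub>R axis i 1))"
  have f: "(f has_derivative ?f') (at (x + t *\<^sub>R axis i 1))"
    by (rule differentiable_has_derivative_frechet[OF assms])
  have "((\<lambda>t. x + t *\<^sub>R axis i 1) has_derivative (\<lambda>h. h *\<^sub>R axis i 1)) (at t)"
    by (auto intro!: derivative_eq_intros)
  from has_derivative_compose[OF this f]
  have "((\<lambda>t. f (x + t *\<^sub>R axis i 1)) has_derivative (\<lambda>h. ?f' (h *\<^sub>R axis i 1))) (at t)" .
  moreover have "?f' (h *\<^sub>R axis i 1) = partial i f (x + t *\<^sub>R axis i 1) * h" for h
    using linear_cmul[OF has_derivative_linear[OF f], of h "axis i 1"] by (simp add: partial_def)
  ultimately show ?thesis by (simp add: has_field_derivative_def)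
qed

text \<open>The difference quotients of \<open>f\<close> in a coordinate direction have integral zero by translation
  invariance. They are bounded by the maximum of the derivative, and for step size at most
  one they vanish outside one ball, so dominated convergence applies.\<close>

lemma integral_partial_eq_0:
  fixes f :: "real^'n \<Rightarrow> real"
  assumes diff: "\<And>x. f differentiable (at x)" and cont: "continuous_on UNIV (partial i f)"
    and K: "compact K" and zero: "\<And>x. x \<notin> K \<Longrightarrow> f x = 0"
  shows "(LINT x|lborel. partial i f x) = 0"
proof -
  define e :: "real^'n" where "e = axis i 1"
  define h :: "nat \<Rightarrow> real" where "h n = inverse (real (Suc n))" for n
  define q where "q n x = (f (x + h n *\<^sub>R e) - f x) / h n" for n x
  have h: "0 < h n" "h n \<le> 1" for n by (auto simp: h_def field_simps)
  have norm_e: "norm e = 1" by (simp add: e_def)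
  have cf: "continuous_on UNIV f"
    using diff differentiable_imp_continuous_within continuous_at_imp_continuous_on by blast
  have [measurable]: "f \<in> borel_measurable borel"
    by (rule borel_measurable_continuous_onI[OF cf])
  have zero': "partial i f x = 0" if "x \<notin> K" for x
    using partial_eq_0_outside[OF compact_imp_closed[OF K] zero that] .
  have "bounded (partial i f ` K)"
    using K cont by (meson compact_continuous_image compact_imp_bounded continuous_on_subset subset_UNIV)
  then obtain C where C: "\<And>x. x \<in> K \<Longrightarrow> \<bar>partial i f x\<bar> \<le> C" "0 < C"
    unfolding bounded_pos by auto
  have C': "\<bar>partial i f x\<bar> \<le> C" for x
    by (cases "x \<in> K") (use C zero' in auto)
  obtain R where R: "\<And>x. x \<in> K \<Longrightarrow> norm x \<le> R"
    using compact_imp_bounded[OF K] unfolding bounded_iff by blast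
  have line: "((\<lambda>t. f (x + t *\<^sub>R e)) has_real_derivative partial i f (x + t *\<^sub>R e)) (at t)" for x t
    unfolding e_def by (rule has_real_derivative_line[OF diff])
  have lim: "(\<lambda>n. q n x) \<longlonglongrightarrow> partial i f x" for x
  proof -
    have "((\<lambda>s. (f (x + s *\<^sub>R e) - f x) / s) \<longlongrightarrow> partial i f x) (at 0)"
      using line[of x 0] by (simp add: DERIV_def)
    moreover have "filterlim h (at 0) sequentially"
    proof -
      have "h \<longlonglongrightarrow> 0" using LIMSEQ_inverse_real_of_nat unfolding h_def[abs_def] .
      then show ?thesis using h(1) by (simp add: filterlim_at less_imp_neq[THEN not_sym])
    qed
    ultimately show ?thesis unfolding q_def by (rule filterlim_compose)
  qed
  have bound: "norm (q n x) \<le> C * indicator (cball 0 (R + 1)) x" for n x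
  proof (cases "x \<in> cball 0 (R + 1)")
    case True
    obtain z where "f (x + h n *\<^sub>R e) - f (x + 0 *\<^sub>R e) = (h n - 0) * partial i f (x + z *\<^sub>R e)"
      using MVT2[OF h(1)[of n], of "\<lambda>t. f (x + t *\<^sub>R e)" "\<lambda>t. partial i f (x + t *\<^sub>R e)"] line by blast
    then have "q n x = partial i f (x + z *\<^sub>R e)"
      using h(1)[of n] by (simp add: q_def)
    then show ?thesis using C' True by simp
  next
    case False
    then have x: "norm x > R + 1" by simp
    have "norm x \<le> norm (x + h n *\<^sub>R e) + norm (h n *\<^sub>R e)"
      using norm_triangle_ineq4[of "x + h n *\<^sub>R e" "h n *\<^sub>R e"] by simp
    then have "norm (x + h n *\<^sub>R e) > R" using x h[of n] norm_e by simp
    then have "f (x + h n *\<^sub>R e) = 0" "f x = 0" using zero R x by force+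
    then show ?thesis using False by (simp add: q_def)
  qed
  have int_f: "integrable lborel f" by (rule integrable_compact_support[OF cf K zero])
  have "(LINT x|lborel. q n x) = 0" for n
  proof -
    have "integrable (distr lborel borel ((+) (h n *\<^sub>R e))) f"
      using int_f by (simp add: lborel_distr_plus)
    then have "integrable lborel (\<lambda>x. f (h n *\<^sub>R e + x))"
      by (rule integrable_distr[rotated]) auto
    then have "(LINT x|lborel. q n x) = ((LINT x|lborel. f (h n *\<^sub>R e + x)) - (LINT x|lborel. f x)) / h n"
      using int_f by (simp add: q_def add.commute)
    then show ?thesis by (simp add: integral_lborel_translate)
  qed
  moreover have "(\<lambda>n. LINT x|lborel. q n x) \<longlonglongrightarrow> (LINT x|lborel. partial i f x)"
  proof (rule integral_dominated_convergence)
    show "integrable lborel (\<lambda>x. C * indicator (cball 0 (R + 1)) x :: real)"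
      by (intro integrable_mult_right integrable_real_indicator) (auto intro: emeasure_lborel_cball_finite[unfolded infinity_ennreal_def])
    show "partial i f \<in> borel_measurable lborel"
      using borel_measurable_continuous_onI[OF cont] by simp
    show "q n \<in> borel_measurable lborel" for n unfolding q_def[abs_def] by measurable
  qed (use lim bound in auto)
  ultimately show ?thesis by (simp add: LIMSEQ_const_iff)
qed

lemma test_functionE:
  assumes "\<phi> \<in> test_functions D"
  obtains K where "compact K" "K \<subseteq> D" "\<And>x. x \<notin> K \<Longrightarrow> \<phi> x = 0" "\<And>i x. x \<notin> K \<Longrightarrow> partial i \<phi> x = 0"
proof -
  let ?K = "closure {x. \<phi> x \<noteq> 0}"
  have z: "\<phi> x = 0" if "x \<notin> ?K" for x
  proof (rule ccontr)
    assume "\<phi> x \<noteq> 0"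
    then have "x \<in> {x. \<phi> x \<noteq> 0}" by (rule CollectI)
    then show False using subsetD[OF closure_subset] that by (metis (lifting))
  qed
  have "compact ?K" "?K \<subseteq> D" using assms unfolding test_functions_def by blast+
  then show thesis
    by (rule that[OF _ _ z partial_eq_0_outside[OF closed_closure z]])
qed

lemma test_function_smooth: "\<phi> \<in> test_functions D \<Longrightarrow> smooth \<phi>"
  by (simp add: test_functions_def)

text \<open>Passes between integrals over \<open>D\<close> with respect to completed Lebesgue measure, in which
  weak gradients are defined, and integrals over the whole space with respect to Borel-Lebesgue
  measure.\<close>

lemma lebesgue_on_compact_support:
  fixes f :: "real^'n \<Rightarrow> real"
  assumes "open D" "continuous_on UNIV f" "compact K" "K \<subseteq> D" "\<And>x. x \<notin> K \<Longrightarrow> f x = 0"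
  shows "integrable (lebesgue_on D) f" "(LINT x|lebesgue_on D. f x) = (LINT x|lborel. f x)"
proof -
  have D: "D \<inter> space lebesgue \<in> sets lebesgue" using assms(1) by simp
  have eq: "(\<lambda>x. indicator D x *\<^sub>R f x) = f" using assms(4,5) by (auto simp: indicator_def fun_eq_iff)
  have m: "f \<in> borel_measurable lborel" using borel_measurable_continuous_onI[OF assms(2)] by simp
  show "integrable (lebesgue_on D) f"
    unfolding integrable_restrict_space[OF D] eq
    using integrable_compact_support[OF assms(2,3,5)] integrable_completion[OF m] by blast
  show "(LINT x|lebesgue_on D. f x) = (LINT x|lborel. f x)"
    unfolding integral_restrict_space[OF D] eq by (rule integral_completion[OF m])
qed

lemma continuous_lebesgue_on_measurable:
  fixes f :: "real^'n \<Rightarrow> real"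
  assumes "open D" "continuous_on UNIV f"
  shows "f \<in> borel_measurable (lebesgue_on D)"
  using assms by (intro continuous_imp_measurable_on_sets_lebesgue) (auto intro: continuous_on_subset)

lemma test_function_L2:
  assumes "open D" "\<phi> \<in> test_functions D"
  shows "\<phi> \<in> L2 (lebesgue_on D)" "partial i \<phi> \<in> L2 (lebesgue_on D)"
proof -
  obtain K where K: "compact K" "K \<subseteq> D" "\<And>x. x \<notin> K \<Longrightarrow> \<phi> x = 0" "\<And>i x. x \<notin> K \<Longrightarrow> partial i \<phi> x = 0"
    using test_functionE[OF assms(2)] by metis
  have s: "continuous_on UNIV \<phi>" "continuous_on UNIV (partial i \<phi>)"
    using smooth_continuous smooth_partial test_function_smooth[OF assms(2)] by blast+
  have "integrable (lebesgue_on D) (\<lambda>x. (norm (\<phi> x))\<^sup>2)"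
    by (rule lebesgue_on_compact_support(1)[OF assms(1) _ K(1,2)]) (use s K in \<open>auto intro!: continuous_intros\<close>)
  moreover have "integrable (lebesgue_on D) (\<lambda>x. (norm (partial i \<phi> x))\<^sup>2)"
    by (rule lebesgue_on_compact_support(1)[OF assms(1) _ K(1,2)]) (use s K in \<open>auto intro!: continuous_intros\<close>)
  ultimately show "\<phi> \<in> L2 (lebesgue_on D)" "partial i \<phi> \<in> L2 (lebesgue_on D)"
    using continuous_lebesgue_on_measurable[OF assms(1)] s by (auto simp: L2_def)
qed

text \<open>Apply the vanishing of \<open>\<integral> \<partial>\<^sub>i f\<close> to the product of the two functions.\<close>

lemma test_function_integration_by_parts:
  assumes D: "open D" and \<phi>: "\<phi> \<in> test_functions D" and \<psi>: "\<psi> \<in> test_functions D"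
  shows "(LINT x|lebesgue_on D. \<phi> x * partial i \<psi> x) = - (LINT x|lebesgue_on D. partial i \<phi> x * \<psi> x)"
proof -
  let ?f = "\<lambda>x. \<phi> x * \<psi> x"
  have d: "\<phi> differentiable (at x)" "\<psi> differentiable (at x)" for x
    using \<phi> \<psi> by (auto intro: smooth_differentiable test_function_smooth)
  have p: "partial i ?f = (\<lambda>x. \<phi> x * partial i \<psi> x + partial i \<phi> x * \<psi> x)"
    using partial_mult[OF d] by blast
  have c: "continuous_on UNIV (partial i ?f)"
    unfolding p using \<phi> \<psi>
    by (intro continuous_intros smooth_continuous smooth_partial test_function_smooth)
  obtain K where K: "compact K" "K \<subseteq> D" "\<And>x. x \<notin> K \<Longrightarrow> \<phi> x = 0" "\<And>i x. x \<notin> K \<Longrightarrow> partial i \<phi> x = 0"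
    using test_functionE[OF \<phi>] by metis
  have "(LINT x|lebesgue_on D. partial i ?f x) = (LINT x|lborel. partial i ?f x)"
    by (rule lebesgue_on_compact_support(2)[OF D c K(1,2)]) (simp add: p K)
  also have "\<dots> = 0"
    by (rule integral_partial_eq_0[OF _ c K(1)]) (use d K in \<open>auto intro!: derivative_intros\<close>)
  finally have "(LINT x|lebesgue_on D. \<phi> x * partial i \<psi> x + partial i \<phi> x * \<psi> x) = 0"
    by (simp add: p)
  then show ?thesis
    using D \<phi> \<psi> by (subst (asm) Bochner_Integration.integral_add)
      (auto intro!: L2_mult_integrable test_function_L2)
qed

section \<open>The fundamental lemma of the calculus of variations\<close>

lemma indicator_box_L2:
  fixes a b :: "real^'n"
  assumes D: "open D" and sub: "box a b \<subseteq> D"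
  shows "(indicator (box a b) :: _ \<Rightarrow> real) \<in> L2 (lebesgue_on D)"
proof -
  have DL: "D \<inter> space lebesgue \<in> sets lebesgue" using D by simp
  have eq: "(\<lambda>x. indicator D x *\<^sub>R (norm (indicator (box a b) x :: real))\<^sup>2) = indicator (box a b)"
    using sub by (auto simp: indicator_def fun_eq_iff)
  have "integrable lebesgue (indicator (box a b) :: _ \<Rightarrow> real)"
    by (intro integrable_real_indicator) (auto simp: emeasure_lborel_box_finite[unfolded infinity_ennreal_def])
  then have "integrable (lebesgue_on D) (\<lambda>x. (norm (indicator (box a b) x :: real))\<^sup>2)"
    unfolding integrable_restrict_space[OF DL] eq .
  moreover have "(indicator (box a b) :: _ \<Rightarrow> real) \<in> borel_measurable (lebesgue_on D)"
    by (intro borel_measurable_indicator') (auto simp: sets_restrict_space_iff D)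
  ultimately show ?thesis by (simp add: L2_def)
qed

text \<open>Dominated convergence along the bump functions, which converge to the indicator of the box.\<close>

lemma integral_box_eq_0:
  fixes f :: "real^'n \<Rightarrow> real"
  assumes D: "open D" and f: "f \<in> L2 (lebesgue_on D)"
    and zero: "\<And>\<phi>. \<phi> \<in> test_functions D \<Longrightarrow> (LINT x|lebesgue_on D. f x * \<phi> x) = 0"
    and sub: "cbox a b \<subseteq> D"
  shows "(LINT x|lebesgue_on D. f x * indicator (box a b) x) = 0"
proof -
  have f': "(\<lambda>x. \<bar>f x\<bar>) \<in> L2 (lebesgue_on D)" "f \<in> borel_measurable (lebesgue_on D)"
    using f by (auto simp: L2_def)
  have "box a b \<subseteq> D" using sub box_subset_cbox by blast
  note box_L2 = indicator_box_L2[OF D this]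
  then have box_m: "(indicator (box a b) :: _ \<Rightarrow> real) \<in> borel_measurable (lebesgue_on D)"
    by (simp add: L2_def)
  have bump: "box_bump (real (Suc n)) a b \<in> test_functions D" for n
    by (rule box_bump_test_function[OF _ sub]) simp
  have "(\<lambda>n. LINT x|lebesgue_on D. f x * box_bump (real (Suc n)) a b x)
      \<longlonglongrightarrow> (LINT x|lebesgue_on D. f x * indicator (box a b) x)"
  proof (rule integral_dominated_convergence)
    show "integrable (lebesgue_on D) (\<lambda>x. \<bar>f x\<bar> * indicator (box a b) x)"
      by (rule L2_mult_integrable[OF f'(1) box_L2])
    show "(\<lambda>x. f x * indicator (box a b) x) \<in> borel_measurable (lebesgue_on D)"
      using f'(2) box_m by (rule borel_measurable_times)
    show "(\<lambda>x. f x * box_bump (real (Suc n)) a b x) \<in> borel_measurable (lebesgue_on D)" for n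
      using test_function_L2(1)[OF D bump, of n] unfolding L2_def by (intro borel_measurable_times f'(2)) blast
    show "AE x in lebesgue_on D. (\<lambda>n. f x * box_bump (real (Suc n)) a b x) \<longlonglongrightarrow> f x * indicator (box a b) x"
      by (intro always_eventually allI tendsto_mult tendsto_const box_bump_tendsto)
    have "\<bar>f x * box_bump (real (Suc n)) a b x\<bar> \<le> \<bar>f x\<bar> * indicator (box a b) x" for n x
      using box_bump_eq_0[of "real (Suc n)" x a b] box_bump_bounds[of "real (Suc n)" a b x]
      by (cases "x \<in> box a b") (auto simp: abs_mult mult_left_le)
    then show "AE x in lebesgue_on D. norm (f x * box_bump (real (Suc n)) a b x) \<le> \<bar>f x\<bar> * indicator (box a b) x" for n
      by simp
  qed
  then show ?thesis using zero[OF bump] by (simp add: LIMSEQ_const_iff)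
qed

text \<open>Boxes form an intersection-stable generator of the Borel sets, so the integral of \<open>F\<close> over
  every Borel set vanishes by Dynkin's lemma.\<close>

lemma borel_AE_eq_0_if_box_integrals_eq_0:
  fixes F :: "'a::euclidean_space \<Rightarrow> real"
  assumes F: "integrable lborel F" and whole: "(LINT x|lborel. F x) = 0"
    and box: "\<And>a b. (LINT x:box a b|lborel. F x) = 0"
  shows "AE x in lborel. F x = 0"
proof (rule sigma_finite_measure.density_zero[OF sigma_finite_lborel F])
  fix A :: "'a set" assume "A \<in> sets lborel"
  have si: "set_integrable lborel A F" if "A \<in> sets borel" for A
    unfolding set_integrable_def using F that by (intro integrable_mult_indicator) simp_all
  have "Int_stable (range (\<lambda>(a, b). box a b :: 'a set))"
    by (auto simp: Int_stable_def box_Int_box)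
  moreover have "range (\<lambda>(a, b). box a b :: 'a set) \<subseteq> Pow UNIV" by auto
  moreover have "A \<in> sigma_sets UNIV (range (\<lambda>(a, b). box a b))"
    using \<open>A \<in> sets lborel\<close> unfolding sets_lborel borel_eq_box by simp
  ultimately show "(LINT x:A|lborel. F x) = 0"
  proof (induction rule: sigma_sets_induct_disjoint)
    case (basic A)
    then show ?case using box by auto
  next
    case empty
    then show ?case by (simp add: set_lebesgue_integral_def)
  next
    case (compl A)
    then have A: "A \<in> sets borel" by (simp add: borel_eq_box)
    have "(LINT x:(UNIV - A)|lborel. F x) + (LINT x:A|lborel. F x) = (LINT x:((UNIV - A) \<union> A)|lborel. F x)"
      by (rule set_integral_Un[symmetric]) (auto intro!: si sets.Diff A)
    also have "\<dots> = 0" using whole by (simp add: set_lebesgue_integral_def)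
    finally show ?case using compl.IH by simp
  next
    case (union A)
    then have A: "\<And>i. A i \<in> sets borel" by (auto simp: borel_eq_box subset_eq)
    have "(LINT x:(\<Union>i. A i)|lborel. F x) = (\<Sum>i. (LINT x:(A i)|lborel. F x))"
      by (rule lebesgue_integral_countable_add)
         (use A union in \<open>auto simp: disjoint_family_on_def intro!: si\<close>)
    then show ?case using union.IH by simp
  qed
qed

text \<open>On a box whose closure lies in \<open>D\<close>, the function \<open>f\<close> is integrable and its integrals over all
  smaller boxes vanish; countably many closed boxes cover \<open>D\<close>. A Borel representative of \<open>f\<close>
  on the box is needed because \<open>f\<close> is measurable only for the completed measure.\<close>

lemma fundamental_lemma:
  fixes f :: "real^'n \<Rightarrow> real"
  assumes D: "open D" and f: "f \<in> L2 (lebesgue_on D)"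
    and zero: "\<And>\<phi>. \<phi> \<in> test_functions D \<Longrightarrow> (LINT x|lebesgue_on D. f x * \<phi> x) = 0"
  shows "AE x in lebesgue_on D. f x = 0"
proof -
  have DL: "D \<inter> space lebesgue \<in> sets lebesgue" using D by simp
  have "AE x in lebesgue. x \<in> box c d \<longrightarrow> f x = 0" if sub: "cbox c d \<subseteq> D" for c d
  proof -
    have boxD: "box c d \<subseteq> D" using sub box_subset_cbox by blast
    define F where "F = (\<lambda>x. f x * indicator (box c d) x)"
    have FD: "(\<lambda>x. indicator D x *\<^sub>R F x) = F"
      using boxD by (auto simp: F_def indicator_def fun_eq_iff)
    have int_box: "(LINT x|lebesgue. indicator (box a b) x *\<^sub>R F x) = 0" for a b
    proof -
      obtain p q where pq: "box a b \<inter> box c d = box p q" by (rule that[OF box_Int_box])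
      \<comment> \<open>A nonempty open box has the closed box as its closure; for an empty one \<open>cbox p q\<close>
        could leave \<open>D\<close>, but the integral is trivially zero.\<close>
      have "cbox p q \<subseteq> D \<or> box p q = {}"
      proof (cases "box p q = {}")
        case False
        have "box p q \<subseteq> cbox c d" using pq box_subset_cbox[of c d] by (metis Int_lower2 order_trans)
        then have "closure (box p q) \<subseteq> cbox c d" by (rule closure_minimal[OF _ closed_cbox])
        then show ?thesis unfolding closure_box[OF False] using sub by blast
      qed simp
      then have "(LINT x|lebesgue_on D. f x * indicator (box p q) x) = 0"
        by (elim disjE) (rule integral_box_eq_0[OF D f zero], simp_all)
      moreover have "(\<lambda>x. indicator D x *\<^sub>R (f x * indicator (box p q) x)) = (\<lambda>x. indicator (box a b) x *\<^sub>R F x)"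
        unfolding pq[symmetric] F_def using boxD by (auto simp: indicator_def fun_eq_iff)
      ultimately show ?thesis unfolding integral_restrict_space[OF DL] by simp
    qed
    have iF: "integrable lebesgue F"
    proof -
      have "integrable (lebesgue_on D) F"
        unfolding F_def by (rule L2_mult_integrable[OF f indicator_box_L2[OF D boxD]])
      then show ?thesis unfolding integrable_restrict_space[OF DL] FD .
    qed
    obtain F' where F'[measurable]: "F' \<in> borel_measurable lborel" and ae: "AE x in lborel. F x = F' x"
      using completion_ex_borel_measurable_real[of F lborel] iF by auto
    have ae': "AE x in lebesgue. F x = F' x" using AE_completion[OF ae] .
    have F'L: "F' \<in> borel_measurable lebesgue" using measurable_completion[OF F'] .
    have "integrable lebesgue F'"
      using iF ae' F'L by (subst integrable_cong_AE[of _ _ F]) (auto simp: eq_commute)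
    then have iF': "integrable lborel F'" by (simp add: integrable_completion)
    have int_box': "(LINT x:box a b|lborel. F' x) = 0" for a b
    proof -
      have "(LINT x|lborel. indicator (box a b) x *\<^sub>R F' x) = (LINT x|lebesgue. indicator (box a b) x *\<^sub>R F' x)"
        by (rule integral_completion[symmetric]) measurable
      also have "\<dots> = (LINT x|lebesgue. indicator (box a b) x *\<^sub>R F x)"
        using iF ae' F'L by (intro integral_cong_AE) (auto intro!: borel_measurable_times borel_measurable_indicator)
      finally show ?thesis using int_box by (simp add: set_lebesgue_integral_def)
    qed
    have "AE x in lborel. F' x = 0"
    proof (rule borel_AE_eq_0_if_box_integrals_eq_0[OF iF' _ int_box'])
      have "(LINT x|lborel. F' x) = (LINT x|lborel. indicator (box c d) x *\<^sub>R F' x)"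
      proof (rule integral_cong_AE)
        show "AE x in lborel. F' x = indicator (box c d) x *\<^sub>R F' x"
          using ae by eventually_elim (auto simp: F_def indicator_def split: if_splits)
      qed auto
      then show "(LINT x|lborel. F' x) = 0" using int_box' by (simp add: set_lebesgue_integral_def)
    qed
    then have "AE x in lebesgue. F' x = 0" by (rule AE_completion)
    with ae' show ?thesis by eventually_elim (auto simp: F_def)
  qed
  note on_box = this
  obtain \<D> where \<D>: "countable \<D>" "\<D> \<subseteq> Pow D" "\<And>X. X \<in> \<D> \<Longrightarrow> \<exists>a b. X = cbox a b" "\<Union>\<D> = D"
    using open_countable_Union_open_cbox[OF D] by blast
  have "AE x in lebesgue. x \<in> X \<longrightarrow> f x = 0" if "X \<in> \<D>" for X
  proof -
    obtain a b where ab: "X = cbox a b" using \<D>(3) \<open>X \<in> \<D>\<close> by blast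
    \<comment> \<open>Integrals are controlled on open boxes, whereas the cover is by closed ones;
      the difference is a null set.\<close>
    have "cbox a b - box a b \<in> null_sets lebesgue"
      using negligible_frontier_interval[of a b] by (simp add: negligible_iff_null_sets)
    then have "AE x in lebesgue. x \<notin> cbox a b - box a b" by (rule AE_not_in)
    moreover have "AE x in lebesgue. x \<in> box a b \<longrightarrow> f x = 0"
      using on_box \<D>(2) that ab by blast
    ultimately show ?thesis by eventually_elim (auto simp: ab)
  qed
  then have "AE x in lebesgue. \<forall>X\<in>\<D>. x \<in> X \<longrightarrow> f x = 0"
    unfolding AE_ball_countable[OF \<D>(1)] by blast
  then have "AE x in lebesgue. x \<in> D \<longrightarrow> f x = 0"
    by eventually_elim (use \<D>(4) in blast)
  then show ?thesis using AE_restrict_space_iff[OF DL] by simp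
qed

section \<open>Weak gradients\<close>

text \<open>Every component of the difference of two weak gradients is orthogonal to all test functions.\<close>

lemma weak_gradient_unique:
  assumes D: "open D" and G: "is_weak_gradient D u G" and H: "is_weak_gradient D u H"
  shows "AE x in lebesgue_on D. G x = H x"
proof -
  have L2: "G \<in> L2 (lebesgue_on D)" "H \<in> L2 (lebesgue_on D)"
    using G H by (auto simp: is_weak_gradient_def)
  have "AE x in lebesgue_on D. G x $ i + (-1) *\<^sub>R H x $ i = 0" for i
  proof (rule fundamental_lemma[OF D])
    show "(\<lambda>x. G x $ i + (-1) *\<^sub>R H x $ i) \<in> L2 (lebesgue_on D)"
      by (intro L2_lincomb L2_nth L2)
    fix \<phi> assume \<phi>: "\<phi> \<in> test_functions D"
    have "(LINT x|lebesgue_on D. G x $ i * \<phi> x) = (LINT x|lebesgue_on D. H x $ i * \<phi> x)"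
    proof -
      have "(LINT x|lebesgue_on D. u x * partial i \<phi> x) = - (LINT x|lebesgue_on D. G x $ i * \<phi> x)"
        using G \<phi> unfolding is_weak_gradient_def by blast
      moreover have "(LINT x|lebesgue_on D. u x * partial i \<phi> x) = - (LINT x|lebesgue_on D. H x $ i * \<phi> x)"
        using H \<phi> unfolding is_weak_gradient_def by blast
      ultimately show ?thesis by linarith
    qed
    then show "(LINT x|lebesgue_on D. (G x $ i + (-1) *\<^sub>R H x $ i) * \<phi> x) = 0"
      using L2_mult_integrable[OF L2_nth[OF L2(1)] test_function_L2(1)[OF D \<phi>], of i]
        L2_mult_integrable[OF L2_nth[OF L2(2)] test_function_L2(1)[OF D \<phi>], of i]
      by (simp add: left_diff_distrib)
  qed
  then have "AE x in lebesgue_on D. \<forall>i. G x $ i + (-1) *\<^sub>R H x $ i = 0"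
    by (intro eventually_all_finite)
  then show ?thesis by eventually_elim (simp add: vec_eq_iff)
qed

lemma weak_gradient_lincomb:
  assumes D: "open D" and u: "u \<in> L2 (lebesgue_on D)" "is_weak_gradient D u G"
    and v: "v \<in> L2 (lebesgue_on D)" "is_weak_gradient D v H"
  shows "is_weak_gradient D (\<lambda>x. u x + c * v x) (\<lambda>x. G x + c *\<^sub>R H x)"
  unfolding is_weak_gradient_def
proof (intro conjI ballI allI)
  have L2: "G \<in> L2 (lebesgue_on D)" "H \<in> L2 (lebesgue_on D)"
    using u v by (auto simp: is_weak_gradient_def)
  show "(\<lambda>x. G x + c *\<^sub>R H x) \<in> L2 (lebesgue_on D)" by (rule L2_lincomb[OF L2])
  fix \<phi> i assume \<phi>: "\<phi> \<in> test_functions D"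
  note t = test_function_L2[OF D \<phi>]
  have "(LINT x|lebesgue_on D. (u x + c * v x) * partial i \<phi> x)
     = (LINT x|lebesgue_on D. u x * partial i \<phi> x) + c * (LINT x|lebesgue_on D. v x * partial i \<phi> x)"
    using L2_mult_integrable[OF u(1) t(2)[of i]] L2_mult_integrable[OF v(1) t(2)[of i]]
    by (simp add: distrib_right mult.assoc)
  also have "\<dots> = - (LINT x|lebesgue_on D. G x $ i * \<phi> x) - c * (LINT x|lebesgue_on D. H x $ i * \<phi> x)"
    using u(2) v(2) \<phi> by (simp add: is_weak_gradient_def)
  also have "\<dots> = - (LINT x|lebesgue_on D. (G x + c *\<^sub>R H x) $ i * \<phi> x)"
    using L2_mult_integrable[OF L2_nth[OF L2(1)] t(1), of i] L2_mult_integrable[OF L2_nth[OF L2(2)] t(1), of i]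
    by (simp add: distrib_right mult.assoc)
  finally show "(LINT x|lebesgue_on D. (u x + c * v x) * partial i \<phi> x)
     = - (LINT x|lebesgue_on D. (G x + c *\<^sub>R H x) $ i * \<phi> x)" .
qed

lemma grad_is_weak_gradient: "u \<in> H1 D \<Longrightarrow> is_weak_gradient D u (grad D u)"
  unfolding H1_def grad_def using someI_ex[of "is_weak_gradient D u"] by blast

lemma H1_L2: "u \<in> H1 D \<Longrightarrow> u \<in> L2 (lebesgue_on D)" "u \<in> H1 D \<Longrightarrow> grad D u \<in> L2 (lebesgue_on D)"
  using grad_is_weak_gradient by (auto simp: H1_def is_weak_gradient_def)

text \<open>The combination of the chosen gradients is a weak gradient of the combination, so the chosen
  gradient of the combination agrees with it almost everywhere.\<close>

lemma H1_lincomb: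
  assumes "open D" "u \<in> H1 D" "v \<in> H1 D"
  shows "(\<lambda>x. u x + c * v x) \<in> H1 D"
    and "AE x in lebesgue_on D. grad D (\<lambda>x. u x + c * v x) x = grad D u x + c *\<^sub>R grad D v x"
proof -
  have w: "is_weak_gradient D (\<lambda>x. u x + c * v x) (\<lambda>x. grad D u x + c *\<^sub>R grad D v x)"
    using assms by (intro weak_gradient_lincomb H1_L2 grad_is_weak_gradient)
  moreover have "(\<lambda>x. u x + c * v x) \<in> L2 (lebesgue_on D)"
    using L2_lincomb[OF H1_L2(1) H1_L2(1), of u D v c] assms by simp
  ultimately show *: "(\<lambda>x. u x + c * v x) \<in> H1 D" by (auto simp: H1_def)
  show "AE x in lebesgue_on D. grad D (\<lambda>x. u x + c * v x) x = grad D u x + c *\<^sub>R grad D v x"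
    by (rule weak_gradient_unique[OF assms(1) grad_is_weak_gradient[OF *] w])
qed

text \<open>Integration by parts says that the classical gradient is a weak one. This is what makes
  \<open>u - \<phi>\<close> an element of \<open>H1\<close> in the definition of \<open>H10\<close>, so that the triangle inequality
  for \<open>H1_norm\<close> becomes available there.\<close>

lemma test_function_H1:
  assumes "open D" "\<phi> \<in> test_functions D" shows "\<phi> \<in> H1 D"
proof -
  have "is_weak_gradient D \<phi> (\<lambda>x. \<chi> i. partial i \<phi> x)"
    unfolding is_weak_gradient_def
    using L2_vec[OF test_function_L2(2)[OF assms]] test_function_integration_by_parts[OF assms] by simp
  then show ?thesis using test_function_L2(1)[OF assms] by (auto simp: H1_def)
qed

section \<open>Positive semidefinite forms\<close>

text \<open>The carriers are sets of functions of one or two (curried) arguments and, later, families of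
  coefficient functions; none of them is a type of a vector space class. Therefore a linear
  combination is a parameter: \<open>comb u c v\<close> stands for \<open>u + c v\<close>. The form may vanish on
  nonzero elements, so \<open>nrm\<close> is only a seminorm.\<close>

locale psd_form =
  fixes S :: "'a set" and comb :: "'a \<Rightarrow> real \<Rightarrow> 'a \<Rightarrow> 'a" and b :: "'a \<Rightarrow> 'a \<Rightarrow> real"
  assumes comb_closed: "u \<in> S \<Longrightarrow> v \<in> S \<Longrightarrow> comb u c v \<in> S"
    and comb_left: "u \<in> S \<Longrightarrow> v \<in> S \<Longrightarrow> w \<in> S \<Longrightarrow> b (comb u c v) w = b u w + c * b v w"
    and sym: "u \<in> S \<Longrightarrow> v \<in> S \<Longrightarrow> b u v = b v u"
    and nonneg: "u \<in> S \<Longrightarrow> 0 \<le> b u u"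
begin

definition nrm :: "'a \<Rightarrow> real" where "nrm v = sqrt (b v v)"

lemma nrm_nonneg: "v \<in> S \<Longrightarrow> 0 \<le> nrm v"
  by (simp add: nrm_def nonneg)

lemma nrm_square: "v \<in> S \<Longrightarrow> (nrm v)\<^sup>2 = b v v"
  by (simp add: nrm_def nonneg)

lemma comb_right: "u \<in> S \<Longrightarrow> v \<in> S \<Longrightarrow> w \<in> S \<Longrightarrow> b w (comb u c v) = b w u + c * b w v"
  by (metis comb_closed comb_left sym)

lemma comb_square:
  assumes "u \<in> S" "v \<in> S"
  shows "b (comb u c v) (comb u c v) = b u u + 2 * c * b u v + c\<^sup>2 * b v v"
  using assms comb_closed[of u v c]
  by (simp add: comb_left comb_right sym[of v u] power2_eq_square algebra_simps)

text \<open>The quadratic \<open>t \<mapsto> b (u + t v) (u + t v)\<close> is nonnegative. If \<open>b v v = 0\<close> it is affine in \<open>t\<close>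
  and must be constant; otherwise evaluate it at its minimum.\<close>

lemma cauchy_schwarz_square:
  assumes "u \<in> S" "v \<in> S" shows "(b u v)\<^sup>2 \<le> b u u * b v v"
proof -
  have q: "0 \<le> b u u + 2 * t * b u v + t\<^sup>2 * b v v" for t
    using nonneg[OF comb_closed[OF assms, of t]] unfolding comb_square[OF assms] .
  show ?thesis
  proof (cases "b v v = 0")
    case True
    have "b u v = 0"
    proof (rule ccontr)
      assume "b u v \<noteq> 0"
      then show False using q[of "- (b u u + 1) / (2 * b u v)"] True by (simp add: field_simps)
    qed
    then show ?thesis using True by simp
  next
    case False
    then have pos: "b v v > 0" using nonneg[OF assms(2)] by simp
    have "b u u + 2 * (- b u v / b v v) * b u v + (- b u v / b v v)\<^sup>2 * b v v = b u u - (b u v)\<^sup>2 / b v v"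
      using pos by (simp add: power2_eq_square field_simps)
    then have "(b u v)\<^sup>2 / b v v \<le> b u u" using q[of "- b u v / b v v"] by simp
    then show ?thesis using pos by (simp add: divide_le_eq)
  qed
qed

lemma cauchy_schwarz:
  assumes "u \<in> S" "v \<in> S" shows "\<bar>b u v\<bar> \<le> nrm u * nrm v"
proof -
  have "\<bar>b u v\<bar> \<le> sqrt (b u u * b v v)"
    using cauchy_schwarz_square[OF assms] by (rule real_le_rsqrt[of "\<bar>b u v\<bar>", unfolded power2_abs])
  then show ?thesis by (simp add: nrm_def real_sqrt_mult)
qed

lemma nrm_triangle:
  assumes "u \<in> S" "v \<in> S" shows "nrm (comb u c v) \<le> nrm u + \<bar>c\<bar> * nrm v"
proof (rule power2_le_imp_le)
  have "(nrm (comb u c v))\<^sup>2 = (nrm u)\<^sup>2 + 2 * c * b u v + c\<^sup>2 * (nrm v)\<^sup>2"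
    using assms by (simp add: nrm_square comb_closed comb_square)
  moreover have "c * b u v \<le> \<bar>c\<bar> * (nrm u * nrm v)"
    using cauchy_schwarz[OF assms] by (metis abs_ge_self abs_ge_zero abs_mult mult_left_mono order_trans)
  ultimately show "(nrm (comb u c v))\<^sup>2 \<le> (nrm u + \<bar>c\<bar> * nrm v)\<^sup>2"
    by (simp add: power2_sum power_mult_distrib mult_ac)
  show "0 \<le> nrm u + \<bar>c\<bar> * nrm v" using assms by (simp add: nrm_nonneg)
qed

lemma null_right: "u \<in> S \<Longrightarrow> v \<in> S \<Longrightarrow> b v v = 0 \<Longrightarrow> b u v = 0"
  using cauchy_schwarz_square[of u v] by simp

lemma psd_form_subset:
  assumes "T \<subseteq> S" "\<And>u v c. u \<in> T \<Longrightarrow> v \<in> T \<Longrightarrow> comb u c v \<in> T"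
  shows "psd_form T comb b"
proof
  show "b u v = b v u" if "u \<in> T" "v \<in> T" for u v using that assms(1) by (blast intro: sym)
qed (use assms(1) in \<open>auto simp: subset_iff intro: assms(2) comb_left nonneg\<close>)

text \<open>Used to replace functions by families of coefficients that represent them, possibly
  non-uniquely.\<close>

lemma psd_form_pullback:
  assumes "\<And>c. c \<in> C \<Longrightarrow> L c \<in> S" "\<And>c d r. c \<in> C \<Longrightarrow> d \<in> C \<Longrightarrow> comb' c r d \<in> C"
    and "\<And>c d r. c \<in> C \<Longrightarrow> d \<in> C \<Longrightarrow> L (comb' c r d) = comb (L c) r (L d)"
  shows "psd_form C comb' (\<lambda>c d. b (L c) (L d))"
proof
  show "b (L c) (L d) = b (L d) (L c)" if "c \<in> C" "d \<in> C" for c d using that assms(1) by (blast intro: sym)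
qed (auto simp: assms intro: comb_left nonneg)

end

lemma psd_form_L2: "psd_form (L2 M) (\<lambda>u c v x. u x + c * v x) (\<lambda>f g :: 'a \<Rightarrow> real. LINT x|M. f x * g x)"
proof
  fix u v w :: "'a \<Rightarrow> real" and c assume uv: "u \<in> L2 M" "v \<in> L2 M"
  show "(\<lambda>x. u x + c * v x) \<in> L2 M" using L2_lincomb[OF uv, of c] by simp
  assume "w \<in> L2 M"
  then show "(LINT x|M. (u x + c * v x) * w x) = (LINT x|M. u x * w x) + c * (LINT x|M. v x * w x)"
    using L2_mult_integrable[OF uv(1), of w] L2_mult_integrable[OF uv(2), of w]
    by (simp add: distrib_right mult.assoc)
qed (simp_all add: mult.commute)

section \<open>Forms on Sobolev spaces\<close>

text \<open>The bound \<open>K\<close> only has to hold almost everywhere: it plays the role of the norm in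
  \<open>L\<^sup>\<infinity>(D)\<close>.\<close>

definition bounded_coefficient :: "(real^'n::finite) set \<Rightarrow> (real^'n \<Rightarrow> real) \<Rightarrow> real \<Rightarrow> bool" where
  "bounded_coefficient D a K \<longleftrightarrow> a \<in> borel_measurable (lebesgue_on D) \<and> 0 \<le> K \<and>
     (AE x in lebesgue_on D. \<bar>a x\<bar> \<le> K)"

definition grad_form :: "(real^'n::finite) set \<Rightarrow> (real^'n \<Rightarrow> real) \<Rightarrow> (real^'n \<Rightarrow> real) \<Rightarrow> (real^'n \<Rightarrow> real) \<Rightarrow> real" where
  "grad_form D a u v = (LINT x|lebesgue_on D. a x * (grad D u x \<bullet> grad D v x))"

definition H1_form :: "(real^'n::finite) set \<Rightarrow> (real^'n \<Rightarrow> real) \<Rightarrow> (real^'n \<Rightarrow> real) \<Rightarrow> real" where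
  "H1_form D u v = (LINT x|lebesgue_on D. u x * v x) + grad_form D (\<lambda>_. 1) u v"

lemma bounded_coefficient_const: "bounded_coefficient D (\<lambda>_. c) \<bar>c\<bar>"
  by (simp add: bounded_coefficient_def)

lemma H1_norm_eq: "H1_norm D u = sqrt (H1_form D u u)"
  by (simp add: H1_norm_def H1_form_def grad_form_def power2_norm_eq_inner power2_eq_square[of "u _"])

lemma grad_form_sym: "grad_form D a u v = grad_form D a v u"
  by (simp add: grad_form_def inner_commute)

lemma grad_form_integrable:
  assumes a: "bounded_coefficient D a K" and u: "u \<in> H1 D" and v: "v \<in> H1 D"
  shows "integrable (lebesgue_on D) (\<lambda>x. a x * (grad D u x \<bullet> grad D v x))"
proof (rule Bochner_Integration.integrable_bound)
  have i: "integrable (lebesgue_on D) (\<lambda>x. grad D u x \<bullet> grad D v x)"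
    using L2_inner_integrable H1_L2(2) u v by blast
  then show "integrable (lebesgue_on D) (\<lambda>x. K * (grad D u x \<bullet> grad D v x))" by simp
  show "(\<lambda>x. a x * (grad D u x \<bullet> grad D v x)) \<in> borel_measurable (lebesgue_on D)"
    using a i by (auto simp: bounded_coefficient_def intro!: borel_measurable_times)
  have "AE x in lebesgue_on D. \<bar>a x\<bar> \<le> K" "0 \<le> K" using a by (auto simp: bounded_coefficient_def)
  then show "AE x in lebesgue_on D. norm (a x * (grad D u x \<bullet> grad D v x)) \<le> norm (K * (grad D u x \<bullet> grad D v x))"
    by (elim eventually_mono) (simp add: abs_mult mult_right_mono)
qed

lemma grad_form_lincomb:
  assumes D: "open D" and a: "bounded_coefficient D a K" and u: "u \<in> H1 D" and v: "v \<in> H1 D" and w: "w \<in> H1 D"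
  shows "grad_form D a (\<lambda>x. u x + c * v x) w = grad_form D a u w + c * grad_form D a v w"
proof -
  have uv: "(\<lambda>x. u x + c * v x) \<in> H1 D" by (rule H1_lincomb[OF D u v])
  have "grad_form D a (\<lambda>x. u x + c * v x) w
     = (LINT x|lebesgue_on D. a x * (grad D u x \<bullet> grad D w x) + c * (a x * (grad D v x \<bullet> grad D w x)))"
    unfolding grad_form_def
  proof (rule integral_cong_AE)
    show "AE x in lebesgue_on D. a x * (grad D (\<lambda>x. u x + c * v x) x \<bullet> grad D w x) =
        a x * (grad D u x \<bullet> grad D w x) + c * (a x * (grad D v x \<bullet> grad D w x))"
      using H1_lincomb(2)[OF D u v, of c] by eventually_elim (simp add: inner_simps algebra_simps)
    show "(\<lambda>x. a x * (grad D (\<lambda>x. u x + c * v x) x \<bullet> grad D w x)) \<in> borel_measurable (lebesgue_on D)"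
      using grad_form_integrable[OF a uv w] by blast
    show "(\<lambda>x. a x * (grad D u x \<bullet> grad D w x) + c * (a x * (grad D v x \<bullet> grad D w x))) \<in> borel_measurable (lebesgue_on D)"
      using grad_form_integrable[OF a u w] grad_form_integrable[OF a v w] by auto
  qed
  also have "\<dots> = grad_form D a u w + c * grad_form D a v w"
    using grad_form_integrable[OF a u w] grad_form_integrable[OF a v w] by (simp add: grad_form_def)
  finally show ?thesis .
qed

lemma H1_form_psd:
  fixes D :: "(real^'n::finite) set"
  assumes D: "open D" shows "psd_form (H1 D) (\<lambda>u c v x. u x + c * v x) (H1_form D)"
proof
  fix u v w :: "real^'n \<Rightarrow> real" and c assume uv: "u \<in> H1 D" "v \<in> H1 D"
  show "(\<lambda>x. u x + c * v x) \<in> H1 D" by (rule H1_lincomb[OF D uv])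
  show "H1_form D u v = H1_form D v u" by (simp add: H1_form_def grad_form_sym mult.commute)
  show "0 \<le> H1_form D u u" by (simp add: H1_form_def grad_form_def)
  assume w: "w \<in> H1 D"
  show "H1_form D (\<lambda>x. u x + c * v x) w = H1_form D u w + c * H1_form D v w"
    using psd_form.comb_left[OF psd_form_L2 H1_L2(1)[OF uv(1)] H1_L2(1)[OF uv(2)] H1_L2(1)[OF w], of c]
      grad_form_lincomb[OF D bounded_coefficient_const uv w, of 1 c]
    by (simp add: H1_form_def algebra_simps)
qed

lemma H1_norm_nrm: "open D \<Longrightarrow> psd_form.nrm (H1_form D) = H1_norm D"
  by (simp add: fun_eq_iff psd_form.nrm_def[OF H1_form_psd] H1_norm_eq)

lemma H1_norm_triangle:
  "open D \<Longrightarrow> u \<in> H1 D \<Longrightarrow> v \<in> H1 D \<Longrightarrow> H1_norm D (\<lambda>x. u x + c * v x) \<le> H1_norm D u + \<bar>c\<bar> * H1_norm D v"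
  using psd_form.nrm_triangle[OF H1_form_psd, of D u v c] by (simp add: H1_norm_nrm)

lemma H1_norm_nonneg: "0 \<le> H1_norm D u"
  by (simp add: H1_norm_def)

text \<open>Both the Cauchy-Schwarz inequality for vectors and that for integrals are applied; the
  gradient part of \<open>H1_norm\<close> dominates the latter.\<close>

lemma grad_form_bound:
  assumes D: "open D" and a: "bounded_coefficient D a K" and u: "u \<in> H1 D" and v: "v \<in> H1 D"
  shows "\<bar>grad_form D a u v\<bar> \<le> K * (H1_norm D u * H1_norm D v)"
proof -
  let ?M = "lebesgue_on D"
  let ?gu = "\<lambda>x. norm (grad D u x)" and ?gv = "\<lambda>x. norm (grad D v x)"
  have L2: "?gu \<in> L2 ?M" "?gv \<in> L2 ?M" using H1_L2(2)[OF u] H1_L2(2)[OF v] by (auto simp: L2_def)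
  have K: "0 \<le> K" "AE x in ?M. \<bar>a x\<bar> \<le> K" using a by (auto simp: bounded_coefficient_def)
  have norm: "sqrt (LINT x|?M. norm (grad D w x) * norm (grad D w x)) \<le> H1_norm D w" for w
    by (simp add: H1_norm_def power2_eq_square)
  have "\<bar>grad_form D a u v\<bar> \<le> (LINT x|?M. K * (?gu x * ?gv x))"
    unfolding grad_form_def
  proof (rule order_trans[OF integral_abs_bound integral_mono_AE])
    show "integrable ?M (\<lambda>x. \<bar>a x * (grad D u x \<bullet> grad D v x)\<bar>)"
      by (intro integrable_abs grad_form_integrable[OF a u v])
    show "integrable ?M (\<lambda>x. K * (?gu x * ?gv x))"
      by (intro integrable_mult_right L2_mult_integrable[OF L2])
    show "AE x in ?M. \<bar>a x * (grad D u x \<bullet> grad D v x)\<bar> \<le> K * (?gu x * ?gv x)"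
      using K(2) by eventually_elim (auto simp: abs_mult intro!: mult_mono Cauchy_Schwarz_ineq2 K)
  qed
  also have "\<dots> = K * (LINT x|?M. ?gu x * ?gv x)" by simp
  also have "(LINT x|?M. ?gu x * ?gv x) \<le> H1_norm D u * H1_norm D v"
    using psd_form.cauchy_schwarz[OF psd_form_L2 L2] mult_mono[OF norm[of u] norm[of v]]
    by (simp add: psd_form.nrm_def[OF psd_form_L2] H1_norm_nonneg)
  finally show ?thesis using K(1) by (simp add: mult_left_mono)
qed

lemma H10_H1: "u \<in> H10 D \<Longrightarrow> u \<in> H1 D"
  by (simp add: H10_def)

lemma H10_lincomb:
  assumes D: "open D" and u: "u \<in> H10 D" and v: "v \<in> H10 D"
  shows "(\<lambda>x. u x + c * v x) \<in> H10 D"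
  unfolding H10_def
proof (intro CollectI conjI allI impI)
  show "(\<lambda>x. u x + c * v x) \<in> H1 D" using H1_lincomb(1)[OF D] u v by (simp add: H10_H1)
  fix \<epsilon> :: real assume \<epsilon>: "\<epsilon> > 0"
  \<comment> \<open>The factor 2 makes the final inequality strict.\<close>
  define \<delta> where "\<delta> = \<epsilon> / (2 * (1 + \<bar>c\<bar>))"
  have \<delta>: "0 < \<delta>" "\<delta> + \<bar>c\<bar> * \<delta> < \<epsilon>" using \<epsilon> by (auto simp: \<delta>_def field_simps add_pos_nonneg)
  obtain \<phi> \<psi> where t: "\<phi> \<in> test_functions D" "\<psi> \<in> test_functions D"
    and le: "H1_norm D (u - \<phi>) < \<delta>" "H1_norm D (v - \<psi>) < \<delta>"
    using u v \<delta>(1) unfolding H10_def by blast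
  have eq: "w - p = (\<lambda>x. w x + (-1) * p x)" for w p :: "real^'n \<Rightarrow> real" by (simp add: fun_eq_iff)
  have H1: "u - \<phi> \<in> H1 D" "v - \<psi> \<in> H1 D"
    unfolding eq by (intro H1_lincomb(1)[OF D] H10_H1 u v test_function_H1[OF D] t)+
  have "H1_norm D ((\<lambda>x. u x + c * v x) - (\<lambda>x. \<phi> x + c * \<psi> x)) = H1_norm D (\<lambda>x. (u - \<phi>) x + c * (v - \<psi>) x)"
    by (rule arg_cong[where f="H1_norm D"]) (simp add: fun_eq_iff algebra_simps)
  also have "\<dots> \<le> H1_norm D (u - \<phi>) + \<bar>c\<bar> * H1_norm D (v - \<psi>)"
    by (rule H1_norm_triangle[OF D H1])
  also have "\<dots> \<le> \<delta> + \<bar>c\<bar> * \<delta>" using le by (intro add_mono mult_left_mono) auto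
  finally show "\<exists>\<phi>\<in>test_functions D. H1_norm D ((\<lambda>x. u x + c * v x) - \<phi>) < \<epsilon>"
    using \<delta>(2) test_functions_lincomb[OF t, of c] by (intro bexI) auto
qed

lemma H10_form_psd:
  "open D \<Longrightarrow> psd_form (H10 D) (\<lambda>u c v x. u x + c * v x) (H1_form D)"
  by (rule psd_form.psd_form_subset[OF H1_form_psd]) (auto simp: H10_H1 H10_lincomb)

lemma zero_H10:
  fixes D :: "(real^'n::finite) set"
  assumes "open D" shows "(\<lambda>x. 0) \<in> H10 D"
proof -
  have z: "(\<lambda>x. 0) \<in> H1 D" using test_function_H1[OF assms zero_test_function] .
  have "H1_norm D (\<lambda>x. 0 + (-1) * 0) \<le> 0"
  proof -
    have "H1_form D (\<lambda>x. 0 + (-1) * 0) (\<lambda>x. 0 + (-1) * 0) = 0"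
      unfolding psd_form.comb_square[OF H1_form_psd[OF assms] z z] by simp
    then show ?thesis by (simp add: H1_norm_eq)
  qed
  then have "H1_norm D ((\<lambda>x. 0) - (\<lambda>x. 0)) \<le> 0" by (simp add: fun_diff_def)
  then show ?thesis using z zero_test_function[of D] unfolding H10_def
    by (intro CollectI conjI allI impI bexI[of _ "\<lambda>x. 0"]) auto
qed

section \<open>Bochner spaces\<close>

text \<open>The function spaces over which Bochner spaces are formed: the seminorm comes from a
  semidefinite form \<open>h\<close>.\<close>

locale function_form = psd_form X "\<lambda>u c v x. u x + c * v x" h
  for X :: "('p \<Rightarrow> real) set" and h
begin

definition strongly_measurable :: "'a measure \<Rightarrow> ('a \<Rightarrow> 'p \<Rightarrow> real) \<Rightarrow> bool" where
  "strongly_measurable M v \<longleftrightarrow> (\<forall>y\<in>space M. v y \<in> X) \<and>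
     (\<exists>s. (\<forall>k::nat. simple_function M (s k) \<and> s k ` space M \<subseteq> X) \<and>
          (\<forall>y\<in>space M. (\<lambda>k. nrm (s k y - v y)) \<longlonglongrightarrow> 0))"

lemma bochner_L2_iff:
  "v \<in> bochner_L2 M X nrm \<longleftrightarrow> strongly_measurable M v \<and> integrable M (\<lambda>y. (nrm (v y))\<^sup>2)"
  by (auto simp: bochner_L2_def strongly_measurable_def)

lemma diff_eq: "u - v = (\<lambda>x. u x + (-1) * v x)" for u v :: "'p \<Rightarrow> real"
  by (simp add: fun_eq_iff)

lemma diff_closed: "u \<in> X \<Longrightarrow> v \<in> X \<Longrightarrow> u - v \<in> X"
  unfolding diff_eq by (rule comb_closed)

lemma scale_closed: "u \<in> X \<Longrightarrow> (\<lambda>x. r * u x) \<in> X"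
  using comb_closed[of u u "r - 1"] by (simp add: algebra_simps)

lemma nrm_scale: 
  assumes "u \<in> X" shows "nrm (\<lambda>x. r * u x) = \<bar>r\<bar> * nrm u"
proof -
  have "(\<lambda>x. r * u x) = (\<lambda>x. u x + (r - 1) * u x)" by (simp add: algebra_simps)
  then have "h (\<lambda>x. r * u x) (\<lambda>x. r * u x) = r\<^sup>2 * h u u"
    using comb_square[OF assms assms, of "r - 1"] by (simp add: power2_eq_square algebra_simps)
  then show ?thesis by (simp add: nrm_def real_sqrt_mult)
qed

lemma strongly_measurable_lincomb:
  assumes u: "strongly_measurable M u" and v: "strongly_measurable M v"
  shows "strongly_measurable M (\<lambda>y x. u y x + c * v y x)"
proof -
  obtain s where s: "\<And>k. simple_function M (s k)" "\<And>k y. y \<in> space M \<Longrightarrow> s k y \<in> X"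
    "\<And>y. y \<in> space M \<Longrightarrow> (\<lambda>k. nrm (s k y - u y)) \<longlonglongrightarrow> 0"
    using u unfolding strongly_measurable_def by blast
  obtain t where t: "\<And>k. simple_function M (t k)" "\<And>k y. y \<in> space M \<Longrightarrow> t k y \<in> X"
    "\<And>y. y \<in> space M \<Longrightarrow> (\<lambda>k. nrm (t k y - v y)) \<longlonglongrightarrow> 0"
    using v unfolding strongly_measurable_def by blast
  have uX: "u y \<in> X" and vX: "v y \<in> X" if "y \<in> space M" for y
    using u v that by (auto simp: strongly_measurable_def)
  let ?r = "\<lambda>k y x. s k y x + c * t k y x"
  have "(\<lambda>k. nrm (?r k y - (\<lambda>x. u y x + c * v y x))) \<longlonglongrightarrow> 0" if y: "y \<in> space M" for y
  proof (rule tendsto_sandwich[OF _ _ tendsto_const])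
    have d: "s k y - u y \<in> X" "t k y - v y \<in> X" for k
      using diff_closed s(2) t(2) uX vX y by blast+
    have eq: "?r k y - (\<lambda>x. u y x + c * v y x) = (\<lambda>x. (s k y - u y) x + c * (t k y - v y) x)" for k
      by (simp add: fun_eq_iff algebra_simps)
    show "\<forall>\<^sub>F k in sequentially. 0 \<le> nrm (?r k y - (\<lambda>x. u y x + c * v y x))"
      unfolding eq using nrm_nonneg[OF comb_closed[OF d]] by simp
    show "\<forall>\<^sub>F k in sequentially. nrm (?r k y - (\<lambda>x. u y x + c * v y x))
        \<le> nrm (s k y - u y) + \<bar>c\<bar> * nrm (t k y - v y)"
      unfolding eq using nrm_triangle[OF d] by simp
    show "(\<lambda>k. nrm (s k y - u y) + \<bar>c\<bar> * nrm (t k y - v y)) \<longlonglongrightarrow> 0"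
      using tendsto_add[OF s(3)[OF y] tendsto_mult_left[OF t(3)[OF y], of "\<bar>c\<bar>"]] by simp
  qed
  moreover have "simple_function M (?r k)" for k
    by (rule simple_function_compose2[OF s(1) t(1)])
  moreover have "?r k y \<in> X" if "y \<in> space M" for k y
    using comb_closed s(2) t(2) that by blast
  ultimately show ?thesis unfolding strongly_measurable_def
    using comb_closed uX vX by (intro conjI exI[of _ ?r]) auto
qed

definition bounded_form :: "(('p \<Rightarrow> real) \<Rightarrow> ('p \<Rightarrow> real) \<Rightarrow> real) \<Rightarrow> real \<Rightarrow> bool" where
  "bounded_form \<beta> K \<longleftrightarrow>
     (\<forall>u\<in>X. \<forall>v\<in>X. \<forall>w\<in>X. \<forall>c. \<beta> (\<lambda>x. u x + c * v x) w = \<beta> u w + c * \<beta> v w) \<and>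
     (\<forall>u\<in>X. \<forall>v\<in>X. \<beta> u v = \<beta> v u) \<and> 0 \<le> K \<and> (\<forall>u\<in>X. \<forall>v\<in>X. \<bar>\<beta> u v\<bar> \<le> K * (nrm u * nrm v))"

lemma bounded_form_self: "bounded_form h 1"
  unfolding bounded_form_def using comb_left sym cauchy_schwarz by auto

text \<open>For the approximating simple functions \<open>s k\<close> and \<open>t k\<close> the function
  \<open>y \<mapsto> \<beta> (s k y) (t k y)\<close> is simple, and it converges pointwise because \<open>\<beta>\<close> is continuous.\<close>

lemma bounded_form_measurable:
  assumes \<beta>: "bounded_form \<beta> K" and u: "strongly_measurable M u" and v: "strongly_measurable M v"
  shows "(\<lambda>y. \<beta> (u y) (v y)) \<in> borel_measurable M"
proof -
  obtain s where s: "\<And>k. simple_function M (s k)" "\<And>k y. y \<in> space M \<Longrightarrow> s k y \<in> X"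
    "\<And>y. y \<in> space M \<Longrightarrow> (\<lambda>k. nrm (s k y - u y)) \<longlonglongrightarrow> 0"
    using u unfolding strongly_measurable_def by blast
  obtain t where t: "\<And>k. simple_function M (t k)" "\<And>k y. y \<in> space M \<Longrightarrow> t k y \<in> X"
    "\<And>y. y \<in> space M \<Longrightarrow> (\<lambda>k. nrm (t k y - v y)) \<longlonglongrightarrow> 0"
    using v unfolding strongly_measurable_def by blast
  have left: "\<And>u v w c. u \<in> X \<Longrightarrow> v \<in> X \<Longrightarrow> w \<in> X \<Longrightarrow> \<beta> (\<lambda>x. u x + c * v x) w = \<beta> u w + c * \<beta> v w"
    and symm: "\<And>u v. u \<in> X \<Longrightarrow> v \<in> X \<Longrightarrow> \<beta> u v = \<beta> v u"
    and K: "0 \<le> K" "\<And>u v. u \<in> X \<Longrightarrow> v \<in> X \<Longrightarrow> \<bar>\<beta> u v\<bar> \<le> K * (nrm u * nrm v)"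
    using \<beta> unfolding bounded_form_def by auto
  show ?thesis
  proof (rule borel_measurable_LIMSEQ_real)
    show "(\<lambda>y. \<beta> (s k y) (t k y)) \<in> borel_measurable M" for k
      by (rule borel_measurable_simple_function[OF simple_function_compose2[OF s(1) t(1)]])
    fix y assume y: "y \<in> space M"
    have uX: "u y \<in> X" and vX: "v y \<in> X"
      using u v y by (auto simp: strongly_measurable_def)
    have sX: "s k y \<in> X" and tX: "t k y \<in> X" for k using s(2) t(2) y by auto
    let ?a = "\<lambda>k. nrm (s k y - u y)" and ?b = "\<lambda>k. nrm (t k y - v y)"
    have bound: "\<bar>\<beta> (s k y) (t k y) - \<beta> (u y) (v y)\<bar> \<le> K * (?a k * (nrm (v y) + ?b k)) + K * (nrm (u y) * ?b k)" for k
    proof -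
      have 1: "\<beta> (s k y - u y) (t k y) = \<beta> (s k y) (t k y) - \<beta> (u y) (t k y)"
        unfolding diff_eq left[OF sX uX tX] by simp
      have 2: "\<beta> (t k y - v y) (u y) = \<beta> (u y) (t k y) - \<beta> (u y) (v y)"
        unfolding diff_eq left[OF tX vX uX] using symm[OF uX tX] symm[OF uX vX] by simp
      have 3: "\<bar>\<beta> (s k y - u y) (t k y)\<bar> \<le> K * (?a k * nrm (t k y))"
        by (rule K(2)[OF diff_closed[OF sX uX] tX])
      have 4: "\<bar>\<beta> (t k y - v y) (u y)\<bar> \<le> K * (nrm (u y) * ?b k)"
        using K(2)[OF diff_closed[OF tX vX] uX, of k] by (simp add: mult.commute)
      have "nrm (t k y) = nrm (\<lambda>x. v y x + 1 * (t k y - v y) x)" by (simp add: algebra_simps)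
      also have "\<dots> \<le> nrm (v y) + ?b k" using nrm_triangle[OF vX diff_closed[OF tX vX], of 1] by simp
      finally have "K * (?a k * nrm (t k y)) \<le> K * (?a k * (nrm (v y) + ?b k))"
        using K(1) nrm_nonneg[OF diff_closed[OF sX uX]] by (intro mult_left_mono)
      then show ?thesis using 1 2 3 4 by linarith
    qed
    have "(\<lambda>k. K * (?a k * (nrm (v y) + ?b k)) + K * (nrm (u y) * ?b k)) \<longlonglongrightarrow> K * (0 * (nrm (v y) + 0)) + K * (nrm (u y) * 0)"
      by (intro tendsto_intros s(3) t(3) y)
    then have lim: "(\<lambda>k. K * (?a k * (nrm (v y) + ?b k)) + K * (nrm (u y) * ?b k)) \<longlonglongrightarrow> 0" by simp
    have "(\<lambda>k. \<beta> (s k y) (t k y) - \<beta> (u y) (v y)) \<longlonglongrightarrow> 0"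
      by (rule Lim_null_comparison[OF _ lim]) (simp only: real_norm_def bound eventually_True)
    then show "(\<lambda>k. \<beta> (s k y) (t k y)) \<longlonglongrightarrow> \<beta> (u y) (v y)" by (rule LIM_zero_cancel)
  qed
qed

text \<open>The weight \<open>p\<close> is going to be \<open>1\<close> or a parameter \<open>y m\<close>. The bound by squared norms suffices
  for the summability over all parameters.\<close>

lemma bounded_form_integrable:
  assumes \<beta>: "bounded_form \<beta> K" and u: "u \<in> bochner_L2 M X nrm" and v: "v \<in> bochner_L2 M X nrm"
    and p: "p \<in> borel_measurable M" "\<And>y. y \<in> space M \<Longrightarrow> \<bar>p y\<bar> \<le> 1"
  shows "integrable M (\<lambda>y. p y * \<beta> (u y) (v y))"
    and "\<bar>LINT y|M. p y * \<beta> (u y) (v y)\<bar> \<le> K * (LINT y|M. (nrm (u y))\<^sup>2 + (nrm (v y))\<^sup>2)"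
proof -
  have m: "(\<lambda>y. p y * \<beta> (u y) (v y)) \<in> borel_measurable M"
    using bounded_form_measurable[OF \<beta>, of M u v] u v p(1) by (auto simp: bochner_L2_iff intro!: borel_measurable_times)
  have i: "integrable M (\<lambda>y. K * ((nrm (u y))\<^sup>2 + (nrm (v y))\<^sup>2))"
    using u v by (auto simp: bochner_L2_iff)
  have b: "\<bar>p y * \<beta> (u y) (v y)\<bar> \<le> K * ((nrm (u y))\<^sup>2 + (nrm (v y))\<^sup>2)" if y: "y \<in> space M" for y
  proof -
    have X: "u y \<in> X" "v y \<in> X" using u v y by (auto simp: bochner_L2_def)
    have "\<bar>p y * \<beta> (u y) (v y)\<bar> \<le> 1 * \<bar>\<beta> (u y) (v y)\<bar>"
      unfolding abs_mult using p(2)[OF y] by (intro mult_right_mono) auto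
    also have "\<dots> \<le> K * (nrm (u y) * nrm (v y))" using \<beta> X by (auto simp: bounded_form_def)
    also have "\<dots> \<le> K * ((nrm (u y))\<^sup>2 + (nrm (v y))\<^sup>2)"
    proof (rule mult_left_mono)
      have "0 \<le> nrm (u y) * nrm (v y)" using nrm_nonneg X by simp
      then show "nrm (u y) * nrm (v y) \<le> (nrm (u y))\<^sup>2 + (nrm (v y))\<^sup>2"
        using sum_squares_bound[of "nrm (u y)" "nrm (v y)"] by linarith
    qed (use \<beta> in \<open>simp add: bounded_form_def\<close>)
    finally show ?thesis .
  qed
  show int: "integrable M (\<lambda>y. p y * \<beta> (u y) (v y))"
    using b by (intro Bochner_Integration.integrable_bound[OF i m] AE_I2) (auto intro: order_trans[OF _ abs_ge_self])
  have "\<bar>LINT y|M. p y * \<beta> (u y) (v y)\<bar> \<le> (LINT y|M. K * ((nrm (u y))\<^sup>2 + (nrm (v y))\<^sup>2))"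
    using b by (intro order_trans[OF integral_abs_bound integral_mono] integrable_abs int i) auto
  then show "\<bar>LINT y|M. p y * \<beta> (u y) (v y)\<bar> \<le> K * (LINT y|M. (nrm (u y))\<^sup>2 + (nrm (v y))\<^sup>2)"
    by simp
qed

text \<open>The squared norm of the combination expands into three integrals of the bounded form \<open>h\<close>.\<close>

lemma bochner_L2_lincomb:
  assumes u: "u \<in> bochner_L2 M X nrm" and v: "v \<in> bochner_L2 M X nrm"
  shows "(\<lambda>y x. u y x + c * v y x) \<in> bochner_L2 M X nrm"
proof -
  have sm: "strongly_measurable M (\<lambda>y x. u y x + c * v y x)"
    using u v strongly_measurable_lincomb by (auto simp: bochner_L2_iff)
  have X: "u y \<in> X" "v y \<in> X" if "y \<in> space M" for y using u v that by (auto simp: bochner_L2_def)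
  have "integrable M (\<lambda>y. 1 * h (u y) (u y) + 2 * c * (1 * h (u y) (v y)) + c\<^sup>2 * (1 * h (v y) (v y)))"
    by (intro Bochner_Integration.integrable_add integrable_mult_right
        bounded_form_integrable(1)[OF bounded_form_self, where p="\<lambda>_. 1"] u v) auto
  then have "integrable M (\<lambda>y. (nrm (\<lambda>x. u y x + c * v y x))\<^sup>2)"
    using X by (subst Bochner_Integration.integrable_cong[OF refl]) (auto simp: nrm_square comb_closed comb_square)
  with sm show ?thesis by (simp add: bochner_L2_iff)
qed

text \<open>Simple functions that converge to the scalar factor \<open>p\<close> yield simple functions with values
  in the line spanned by \<open>c\<close>.\<close>

lemma bochner_L2_elementary:
  assumes M: "finite_measure M" and c: "c \<in> X"
    and p: "p \<in> borel_measurable M" "\<And>y. y \<in> space M \<Longrightarrow> \<bar>p y\<bar> \<le> C"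
  shows "(\<lambda>y x. c x * p y) \<in> bochner_L2 M X nrm"
proof -
  interpret finite_measure M by fact
  obtain F where F: "\<And>i. simple_function M (F i)" "\<And>y. y \<in> space M \<Longrightarrow> (\<lambda>i. F i y) \<longlonglongrightarrow> p y"
    using borel_measurable_implies_sequence_metric[OF p(1), of 0] by blast
  have cr: "(\<lambda>x. c x * r) \<in> X" for r using scale_closed[OF c, of r] by (simp add: mult.commute)
  have nrm_c: "nrm (\<lambda>x. c x * r) = \<bar>r\<bar> * nrm c" for r using nrm_scale[OF c, of r] by (simp add: mult.commute)
  have "strongly_measurable M (\<lambda>y x. c x * p y)"
    unfolding strongly_measurable_def
  proof (intro conjI ballI exI[of _ "\<lambda>k y x. c x * F k y"] allI)
    show "simple_function M (\<lambda>y x. c x * F k y)" for k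
      by (rule simple_function_compose1[OF F(1)])
    show "(\<lambda>k. nrm ((\<lambda>x. c x * F k y) - (\<lambda>x. c x * p y))) \<longlonglongrightarrow> 0" if "y \<in> space M" for y
    proof -
      have "(\<lambda>x. c x * F k y) - (\<lambda>x. c x * p y) = (\<lambda>x. c x * (F k y - p y))" for k
        by (simp add: fun_eq_iff algebra_simps)
      moreover have "(\<lambda>k. \<bar>F k y - p y\<bar> * nrm c) \<longlonglongrightarrow> \<bar>p y - p y\<bar> * nrm c"
        by (intro tendsto_intros F that)
      ultimately show ?thesis by (simp add: nrm_c)
    qed
  qed (use cr in auto)
  moreover have "integrable M (\<lambda>y. (nrm (\<lambda>x. c x * p y))\<^sup>2)"
  proof (rule integrable_const_bound)
    show "AE y in M. norm ((nrm (\<lambda>x. c x * p y))\<^sup>2) \<le> (C * nrm c)\<^sup>2"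
      using p(2) nrm_nonneg[OF c] by (intro AE_I2) (auto simp: nrm_c intro!: power_mono mult_right_mono)
    show "(\<lambda>y. (nrm (\<lambda>x. c x * p y))\<^sup>2) \<in> borel_measurable M" unfolding nrm_c using p(1) by measurable
  qed
  ultimately show ?thesis by (simp add: bochner_L2_iff)
qed

lemma bochner_L2_sum:
  assumes M: "finite_measure M" and z: "(\<lambda>x. 0) \<in> X"
    and w: "\<And>i. i \<in> I \<Longrightarrow> w i \<in> bochner_L2 M X nrm"
  shows "(\<lambda>y x. \<Sum>i\<in>I. w i y x) \<in> bochner_L2 M X nrm"
proof -
  have zero: "(\<lambda>y x. 0) \<in> bochner_L2 M X nrm"
    using bochner_L2_elementary[OF M z, of "\<lambda>_. 0" 0] by simp
  show ?thesis using w
  proof (induction I rule: infinite_finite_induct)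
    case (insert i I)
    then show ?case using bochner_L2_lincomb[of "w i" M "\<lambda>y x. \<Sum>i\<in>I. w i y x" 1] by simp
  qed (use zero in simp_all)
qed

end

lemma function_form_H10: "open D \<Longrightarrow> function_form (H10 D) (H1_form D)"
  by (simp add: function_form_def H10_form_psd)

lemma grad_form_bounded_form:
  assumes D: "open D" and a: "bounded_coefficient D a K"
  shows "function_form.bounded_form (H10 D) (H1_form D) (grad_form D a) K"
  unfolding function_form.bounded_form_def[OF function_form_H10[OF D]] H1_norm_nrm[OF D]
  using grad_form_lincomb[OF D a] grad_form_sym grad_form_bound[OF D a] a
  by (auto simp: H10_H1 bounded_coefficient_def)

section \<open>The energy form\<close>

locale sgfem =
  fixes pr :: "'n::finite sgfem_data"
  assumes problem: "parametric_problem pr"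
begin

abbreviation "D \<equiv> dom pr"

lemma open_D: "open D" and D_nonempty: "D \<noteq> {}"
  using problem by (auto simp: parametric_problem_def lipschitz_domain_def)

sublocale H10: function_form "H10 D" "H1_form D"
  by (rule function_form_H10[OF open_D])

lemma nrm_H10: "H10.nrm = H1_norm D"
  by (rule H1_norm_nrm[OF open_D])

text \<open>A nonempty open set has positive measure. Hence an essential supremum over \<open>D\<close> of a
  nonnegative function is nonnegative, and its conversion from extended to real numbers
  loses nothing when it is finite.\<close>

lemma AE_D_False: "\<not> (AE x in lebesgue_on D. False)"
proof
  assume "AE x in lebesgue_on D. False"
  then have "AE x in lebesgue. x \<notin> D"
    using open_D by (simp add: AE_restrict_space_iff)
  then have "D \<in> null_sets lebesgue"
    using open_D by (simp add: AE_iff_null_sets)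
  then show False using open_not_negligible[OF open_D D_nonempty] by (simp add: negligible_iff_null_sets)
qed

definition coeff_bound :: "nat \<Rightarrow> real" where
  "coeff_bound m = real_of_ereal (Linf_norm D (sgfem_data.coeff pr m))"

lemma summable_coeff_bound: "summable coeff_bound"
  using problem by (simp add: parametric_problem_def coeff_bound_def[abs_def])

lemma coeff_bounded: "bounded_coefficient D (sgfem_data.coeff pr m) (coeff_bound m)"
proof -
  let ?a = "sgfem_data.coeff pr m"
  have L: "?a \<in> borel_measurable (lebesgue_on D)" "Linf_norm D ?a < \<infinity>"
    using problem by (auto simp: parametric_problem_def Linf_def)
  have ae: "AE x in lebesgue_on D. ereal \<bar>?a x\<bar> \<le> Linf_norm D ?a"
    unfolding Linf_norm_def by (rule esssup_AE)
  have nn: "0 \<le> Linf_norm D ?a"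
  proof (rule ccontr)
    assume "\<not> 0 \<le> Linf_norm D ?a"
    then have "\<not> ereal \<bar>?a x\<bar> \<le> Linf_norm D ?a" for x
      by (metis abs_ge_zero ereal_less_eq(5) order_trans)
    then show False using ae AE_D_False by simp
  qed
  then have "ereal (coeff_bound m) = Linf_norm D ?a"
    using L(2) unfolding coeff_bound_def by (intro ereal_real') auto
  then have "AE x in lebesgue_on D. \<bar>?a x\<bar> \<le> coeff_bound m" using ae by (metis (no_types, lifting) ereal_less_eq(3) eventually_mono)
  moreover have "0 \<le> coeff_bound m" using nn by (simp add: coeff_bound_def real_of_ereal_pos)
  ultimately show ?thesis using L(1) by (simp add: bounded_coefficient_def)
qed

lemma coeff0_bounded: "bounded_coefficient D (coeff0 pr) \<bar>coeff0_max pr\<bar>"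
proof -
  have "AE x in lebesgue_on D. coeff0_min pr \<le> coeff0 pr x \<and> coeff0 pr x \<le> coeff0_max pr"
    and pos: "0 < coeff0_min pr" and "coeff0 pr \<in> borel_measurable (lebesgue_on D)"
    using problem by (auto simp: parametric_problem_def)
  moreover from this(1) have "AE x in lebesgue_on D. \<bar>coeff0 pr x\<bar> \<le> \<bar>coeff0_max pr\<bar>"
    by eventually_elim (use pos in linarith)
  ultimately show ?thesis by (simp add: bounded_coefficient_def)
qed

text \<open>By definition \<open>\<tau> * coeff0_min\<close> is the essential supremum of \<open>\<Sum>m. \<bar>a\<^sub>m\<bar>\<close>, provided that this
  supremum is finite; it is, being at most the sum of the norms of the \<open>a\<^sub>m\<close>. So \<open>\<tau> < 1\<close>
  lets the mean field dominate the whole perturbation.\<close>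

lemma AE_perturbation_le: 
  "AE x in lebesgue_on D. \<forall>k. (\<Sum>m<k. \<bar>sgfem_data.coeff pr m x\<bar>) \<le> coeff0 pr x"
proof -
  let ?M = "lebesgue_on D" and ?a = "\<lambda>m. sgfem_data.coeff pr m"
  let ?S = "\<lambda>x. \<Sum>m. \<bar>?a m x\<bar>"
  have m: "?a m \<in> borel_measurable ?M" for m using coeff_bounded by (simp add: bounded_coefficient_def)
  have ab: "AE x in ?M. \<forall>m. \<bar>?a m x\<bar> \<le> coeff_bound m"
    using coeff_bounded by (simp add: AE_all_countable bounded_coefficient_def)
  have sm: "summable (\<lambda>m. \<bar>?a m x\<bar>)" "?S x \<le> suminf coeff_bound" "0 \<le> ?S x"
    if "\<forall>m. \<bar>?a m x\<bar> \<le> coeff_bound m" for x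
  proof -
    show 1: "summable (\<lambda>m. \<bar>?a m x\<bar>)"
      by (rule summable_comparison_test'[OF summable_coeff_bound, of 0]) (use that in simp)
    show "?S x \<le> suminf coeff_bound" using that by (intro suminf_le 1 summable_coeff_bound) auto
    show "0 \<le> ?S x" by (intro suminf_nonneg 1) simp
  qed
  define e where "e = Linf_norm D ?S"
  \<comment> \<open>Both infinite values of \<open>e\<close> are excluded, since \<open>tau\<close> converts \<open>e\<close> to a real number.\<close>
  have "e \<le> ereal (suminf coeff_bound)"
    unfolding e_def Linf_norm_def
  proof (rule esssup_I)
    show "(\<lambda>x. ereal \<bar>?S x\<bar>) \<in> borel_measurable ?M" using m by measurable
    show "AE x in ?M. ereal \<bar>?S x\<bar> \<le> ereal (suminf coeff_bound)"
      using ab by eventually_elim (use sm in auto)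
  qed
  moreover have ae: "AE x in ?M. ereal \<bar>?S x\<bar> \<le> e" unfolding e_def Linf_norm_def by (rule esssup_AE)
  moreover have "e \<noteq> - \<infinity>"
  proof
    assume "e = - \<infinity>"
    then show False using ae AE_D_False by simp
  qed
  ultimately obtain r where r: "e = ereal r" by (cases e) auto
  have "tau pr < 1" "0 < coeff0_min pr" using problem by (auto simp: parametric_problem_def)
  then have r1: "r < coeff0_min pr" using r by (simp add: tau_def e_def[symmetric] divide_less_eq)
  have a0: "AE x in ?M. coeff0_min pr \<le> coeff0 pr x"
    using problem by (auto simp: parametric_problem_def)
  show ?thesis using ab ae a0
  proof eventually_elim
    case (elim x)
    have "(\<Sum>m<k. \<bar>?a m x\<bar>) \<le> ?S x" for k
      by (rule sum_le_suminf[OF sm(1)[OF elim(1)]]) auto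
    moreover have "?S x \<le> r" using elim(2) r by simp
    ultimately show ?case using r1 elim(3) by (meson less_eq_real_def order_trans)
  qed
qed

lemma grad_form_perturbation_le:
  assumes w: "w \<in> H1 D"
  shows "(\<Sum>m<k. \<bar>grad_form D (sgfem_data.coeff pr m) w w\<bar>) \<le> grad_form D (coeff0 pr) w w"
proof -
  let ?M = "lebesgue_on D" and ?a = "\<lambda>m. sgfem_data.coeff pr m"
  let ?g = "\<lambda>x. grad D w x \<bullet> grad D w x"
  have i: "integrable ?M (\<lambda>x. ?a m x * ?g x)" for m by (rule grad_form_integrable[OF coeff_bounded w w])
  have i': "integrable ?M (\<lambda>x. \<bar>?a m x\<bar> * ?g x)" for m
    using integrable_abs[OF i[of m]] by (simp add: abs_mult)
  have "(\<Sum>m<k. \<bar>grad_form D (?a m) w w\<bar>) \<le> (\<Sum>m<k. LINT x|?M. \<bar>?a m x\<bar> * ?g x)"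
    unfolding grad_form_def
    by (intro sum_mono order_trans[OF integral_abs_bound]) (simp add: abs_mult)
  also have "\<dots> = (LINT x|?M. (\<Sum>m<k. \<bar>?a m x\<bar> * ?g x))"
    by (rule Bochner_Integration.integral_sum[symmetric]) (rule i')
  also have "\<dots> \<le> grad_form D (coeff0 pr) w w"
    unfolding grad_form_def
  proof (rule integral_mono_AE)
    show "AE x in ?M. (\<Sum>m<k. \<bar>?a m x\<bar> * ?g x) \<le> coeff0 pr x * ?g x"
      using AE_perturbation_le
      by eventually_elim (auto simp: sum_distrib_right[symmetric] intro!: mult_right_mono)
  qed (use i' grad_form_integrable[OF coeff0_bounded w w] in auto)
  finally show ?thesis .
qed

lemma prob_par: "prob_space (par pr)"
  using problem unfolding par_def parametric_problem_def by (intro prob_space_PiM) auto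

lemma space_prm: "space (prm pr m) = {-1..1}"
proof -
  have "sets (prm pr m) = sets (restrict_space borel {-1..1})"
    using problem by (simp add: parametric_problem_def)
  from sets_eq_imp_space_eq[OF this] show ?thesis by (simp add: space_restrict_space)
qed

lemma par_component_bound: "y \<in> space (par pr) \<Longrightarrow> \<bar>y m\<bar> \<le> 1"
  unfolding par_def space_PiM using space_prm by (force simp: PiE_iff abs_le_iff)

lemma par_component_measurable: "(\<lambda>y. y m) \<in> borel_measurable (par pr)"
proof -
  have "sets (prm pr m) = sets (restrict_space borel {-1..1})"
    using problem by (simp add: parametric_problem_def)
  moreover have "(\<lambda>t::real. t) \<in> borel_measurable (restrict_space borel {-1..1})"
    by (rule measurable_restrict_space1) simp
  ultimately have "(\<lambda>t. t) \<in> borel_measurable (prm pr m)"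
    using measurable_cong_sets[of "prm pr m" "restrict_space borel {-1..1}" borel borel] by simp
  moreover have "(\<lambda>y. y m) \<in> measurable (par pr) (prm pr m)"
    unfolding par_def by (rule measurable_component_singleton) simp
  ultimately show ?thesis using measurable_compose by blast
qed

lemma VV_eq: "VV pr = bochner_L2 (par pr) (H10 D) H10.nrm"
  by (simp add: VV_def nrm_H10)

text \<open>The bilinear form splits into the contribution of the mean field and one contribution per
  parameter, where the factor \<open>y m\<close> is taken out of the spatial integral.\<close>

definition mean_form :: "'n rfun \<Rightarrow> 'n rfun \<Rightarrow> real" where
  "mean_form u v = (LINT y|par pr. grad_form D (coeff0 pr) (u y) (v y))"

definition mode_form :: "nat \<Rightarrow> 'n rfun \<Rightarrow> 'n rfun \<Rightarrow> real" where
  "mode_form m u v = (LINT y|par pr. y m * grad_form D (sgfem_data.coeff pr m) (u y) (v y))"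

lemma BB_eq: "BB pr u v = mean_form u v + (\<Sum>m. mode_form m u v)"
  by (simp add: BB_def mean_form_def mode_form_def grad_form_def mult.assoc)

lemma mean_form_integrable:
  "u \<in> VV pr \<Longrightarrow> v \<in> VV pr \<Longrightarrow> integrable (par pr) (\<lambda>y. grad_form D (coeff0 pr) (u y) (v y))"
  using H10.bounded_form_integrable(1)[OF grad_form_bounded_form[OF open_D coeff0_bounded], of u "par pr" v "\<lambda>_. 1"]
  by (simp add: VV_eq)

lemma mode_form_integrable:
  "u \<in> VV pr \<Longrightarrow> v \<in> VV pr \<Longrightarrow> integrable (par pr) (\<lambda>y. y m * grad_form D (sgfem_data.coeff pr m) (u y) (v y))"
  by (rule H10.bounded_form_integrable(1)[OF grad_form_bounded_form[OF open_D coeff_bounded]])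
    (simp_all add: VV_eq par_component_bound par_component_measurable)

lemma mode_form_summable:
  assumes "u \<in> VV pr" "v \<in> VV pr" shows "summable (\<lambda>m. mode_form m u v)"
proof -
  have "\<bar>mode_form m u v\<bar> \<le> coeff_bound m * (LINT y|par pr. (H10.nrm (u y))\<^sup>2 + (H10.nrm (v y))\<^sup>2)" for m
    unfolding mode_form_def
    by (rule H10.bounded_form_integrable(2)[OF grad_form_bounded_form[OF open_D coeff_bounded]])
      (use assms in \<open>simp_all add: VV_eq par_component_bound par_component_measurable\<close>)
  then show ?thesis
    by (intro summable_comparison_test'[OF summable_mult2[OF summable_coeff_bound], of 0]) auto
qed

lemma VV_H1: "u \<in> VV pr \<Longrightarrow> y \<in> space (par pr) \<Longrightarrow> u y \<in> H1 D"
  by (auto simp: VV_def bochner_L2_def H10_H1)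

lemma VV_lincomb: "u \<in> VV pr \<Longrightarrow> v \<in> VV pr \<Longrightarrow> (\<lambda>y x. u y x + c * v y x) \<in> VV pr"
  unfolding VV_eq by (rule H10.bochner_L2_lincomb)

text \<open>Since \<open>\<bar>y m\<bar> \<le> 1\<close>, the negative part of each partial sum over the parameters is absorbed by
  the mean field, pointwise in \<open>y\<close> (\<open>grad_form_perturbation_le\<close>). Arguing with partial sums
  avoids exchanging the infinite sum with the integrals.\<close>

lemma BB_nonneg: 
  assumes u: "u \<in> VV pr" shows "0 \<le> BB pr u u"
proof -
  let ?b = "\<lambda>m w. grad_form D (sgfem_data.coeff pr m) w w"
  have ib: "integrable (par pr) (\<lambda>y. \<bar>?b m (u y)\<bar>)" for m
    using H10.bounded_form_integrable(1)[OF grad_form_bounded_form[OF open_D coeff_bounded], of u "par pr" u "\<lambda>_. 1"] u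
    by (intro integrable_abs) (simp add: VV_eq)
  have "(\<Sum>m<k. - mode_form m u u) \<le> mean_form u u" for k
  proof -
    have "- mode_form m u u \<le> (LINT y|par pr. \<bar>?b m (u y)\<bar>)" for m
    proof -
      have "\<bar>mode_form m u u\<bar> \<le> (LINT y|par pr. \<bar>?b m (u y)\<bar>)"
        unfolding mode_form_def
      proof (rule order_trans[OF integral_abs_bound integral_mono])
        show "\<bar>y m * ?b m (u y)\<bar> \<le> \<bar>?b m (u y)\<bar>" if "y \<in> space (par pr)" for y
          unfolding abs_mult using par_component_bound[OF that, of m] by (simp add: mult_left_le_one_le)
      qed (use ib mode_form_integrable[OF u u] in auto)
      then show ?thesis by linarith
    qed
    then have "(\<Sum>m<k. - mode_form m u u) \<le> (\<Sum>m<k. LINT y|par pr. \<bar>?b m (u y)\<bar>)"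
      by (intro sum_mono)
    also have "\<dots> = (LINT y|par pr. (\<Sum>m<k. \<bar>?b m (u y)\<bar>))"
      using ib by (intro Bochner_Integration.integral_sum[symmetric])
    also have "\<dots> \<le> mean_form u u"
      unfolding mean_form_def using ib mean_form_integrable[OF u u] grad_form_perturbation_le VV_H1[OF u]
      by (intro integral_mono) auto
    finally show ?thesis .
  qed
  then have "(\<Sum>m. - mode_form m u u) \<le> mean_form u u"
    by (intro suminf_le_const summable_minus mode_form_summable u)
  then show ?thesis using suminf_minus[OF mode_form_summable[OF u u]] by (simp add: BB_eq)
qed

sublocale energy: psd_form "VV pr" "\<lambda>u c v y x. u y x + c * v y x" "BB pr"
proof
  fix u v w :: "'n rfun" and c assume u: "u \<in> VV pr" and v: "v \<in> VV pr"
  show "(\<lambda>y x. u y x + c * v y x) \<in> VV pr" by (rule VV_lincomb[OF u v])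
  show "BB pr u v = BB pr v u"
    by (simp add: BB_eq mean_form_def mode_form_def grad_form_sym)
  show "0 \<le> BB pr u u" by (rule BB_nonneg[OF u])
  assume w: "w \<in> VV pr"
  have gf: "grad_form D a (\<lambda>x. u y x + c * v y x) (w y) = grad_form D a (u y) (w y) + c * grad_form D a (v y) (w y)"
    if "bounded_coefficient D a K" "y \<in> space (par pr)" for a K y
    using grad_form_lincomb[OF open_D that(1)] VV_H1[OF _ that(2)] u v w by blast
  have "mean_form (\<lambda>y x. u y x + c * v y x) w
      = (LINT y|par pr. grad_form D (coeff0 pr) (u y) (w y) + c * grad_form D (coeff0 pr) (v y) (w y))"
    unfolding mean_form_def by (intro Bochner_Integration.integral_cong refl gf[OF coeff0_bounded])
  also have "\<dots> = mean_form u w + c * mean_form v w"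
    using mean_form_integrable u v w by (simp add: mean_form_def)
  finally have 1: "mean_form (\<lambda>y x. u y x + c * v y x) w = mean_form u w + c * mean_form v w" .
  have 2: "mode_form m (\<lambda>y x. u y x + c * v y x) w = mode_form m u w + c * mode_form m v w" for m
  proof -
    let ?b = "grad_form D (sgfem_data.coeff pr m)"
    have "mode_form m (\<lambda>y x. u y x + c * v y x) w
        = (LINT y|par pr. y m * ?b (u y) (w y) + c * (y m * ?b (v y) (w y)))"
      unfolding mode_form_def
      by (intro Bochner_Integration.integral_cong refl) (simp add: gf[OF coeff_bounded] algebra_simps)
    also have "\<dots> = mode_form m u w + c * mode_form m v w"
      using mode_form_integrable u v w by (simp add: mode_form_def)
    finally show ?thesis .
  qed
  show "BB pr (\<lambda>y x. u y x + c * v y x) w = BB pr u w + c * BB pr v w"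
    unfolding BB_eq 1 2
    using suminf_add[OF mode_form_summable[OF u w] summable_mult[OF mode_form_summable[OF v w], of c]]
      suminf_mult[OF mode_form_summable[OF v w], of c]
    by (simp add: algebra_simps)
qed

lemma energy_norm_eq: "energy_norm pr = energy.nrm"
  by (simp add: fun_eq_iff energy_norm_def energy.nrm_def)

end

section \<open>Riesz representation in finitely many coordinates\<close>

context psd_form
begin

text \<open>Represents the functional \<open>l\<close> by the form on a space \<open>W\<close> on which finitely many linear
  coordinates determine an element up to the kernel of the form. The induction on the number of coordinates splits off the hyperplane \<open>W0\<close> where one
  coordinate vanishes and makes one complementary direction orthogonal to \<open>W0\<close>, as in the
  Gram-Schmidt process. The orthogonalization itself is an instance of the induction
  hypothesis, for the functional \<open>b a\<close>.\<close>

lemma riesz_finite_coordinates: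
  fixes ev :: "'i \<Rightarrow> 'a \<Rightarrow> real"
  assumes "finite F" "W \<subseteq> S" "W \<noteq> {}" "\<And>u v c. u \<in> W \<Longrightarrow> v \<in> W \<Longrightarrow> comb u c v \<in> W"
    and ev: "\<And>i u v c. u \<in> S \<Longrightarrow> v \<in> S \<Longrightarrow> ev i (comb u c v) = ev i u + c * ev i v"
    and "\<And>w. w \<in> W \<Longrightarrow> (\<And>i. i \<in> F \<Longrightarrow> ev i w = 0) \<Longrightarrow> b w w = 0"
    and "\<And>u v c. u \<in> S \<Longrightarrow> v \<in> S \<Longrightarrow> l (comb u c v) = l u + c * l v"
    and "\<And>w. w \<in> S \<Longrightarrow> b w w = 0 \<Longrightarrow> l w = 0"
  shows "\<exists>p\<in>W. \<forall>v\<in>W. b p v = l v"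
  using assms(1-4,6-8)
proof (induction F arbitrary: W l rule: finite_induct)
  case empty
  obtain p where p: "p \<in> W" using empty.prems(2) by blast
  have "b p v = l v" if v: "v \<in> W" for v
  proof -
    have "b v v = 0" using empty.prems(4)[OF v] by simp
    moreover have "p \<in> S" "v \<in> S" using empty.prems(1) p v by blast+
    ultimately show ?thesis using null_right[of p v] empty.prems(6)[of v] by simp
  qed
  then show ?case using p by blast
next
  case (insert i F)
  note WS = subsetD[OF insert.prems(1)]
  define W0 where "W0 = {w \<in> W. ev i w = 0}"
  have W0: "W0 \<subseteq> S" "W0 \<noteq> {}" "\<And>u v c. u \<in> W0 \<Longrightarrow> v \<in> W0 \<Longrightarrow> comb u c v \<in> W0"
    "\<And>w. w \<in> W0 \<Longrightarrow> (\<And>i. i \<in> F \<Longrightarrow> ev i w = 0) \<Longrightarrow> b w w = 0"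
  proof -
    obtain w where w: "w \<in> W" using insert.prems(2) by blast
    then have "comb w (- 1) w \<in> W0" using insert.prems(3) WS ev by (simp add: W0_def)
    then show "W0 \<noteq> {}" by blast
    show "comb u c v \<in> W0" if "u \<in> W0" "v \<in> W0" for u v c
      using that insert.prems(3) WS ev by (simp add: W0_def)
    show "b w w = 0" if "w \<in> W0" "\<And>i. i \<in> F \<Longrightarrow> ev i w = 0" for w
      using that insert.prems(4)[of w] by (auto simp: W0_def)
  qed (use WS in \<open>auto simp: W0_def\<close>)
  note IH = insert.IH[OF W0]
  obtain p0 where p0: "p0 \<in> W0" "\<And>v. v \<in> W0 \<Longrightarrow> b p0 v = l v"
    using IH[of l] insert.prems(5,6) by blast
  show ?case
  proof (cases "\<exists>a\<in>W. ev i a \<noteq> 0")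
    case False
    then have "W0 = W" by (auto simp: W0_def)
    then show ?thesis using p0 by blast
  next
    case True
    then obtain a where a: "a \<in> W" "ev i a \<noteq> 0" by blast
    obtain a0 where a0: "a0 \<in> W0" "\<And>v. v \<in> W0 \<Longrightarrow> b a0 v = b a v"
    proof -
      have "\<exists>p\<in>W0. \<forall>v\<in>W0. b p v = b a v"
        by (rule IH) (use WS[OF a(1)] in \<open>auto simp: comb_right null_right\<close>)
      then show thesis using that by blast
    qed
    have S: "a \<in> S" "a0 \<in> S" "p0 \<in> S" "a0 \<in> W" "p0 \<in> W"
      using a a0(1) p0(1) WS by (auto simp: W0_def)
    define a' where "a' = comb a (- 1) a0"
    have a': "a' \<in> W" "a' \<in> S"
      using a S insert.prems(3) WS by (auto simp: a'_def)
    have orth: "b a' v = 0" if "v \<in> W0" for v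
      using a0(2)[OF that] S W0(1) that by (simp add: a'_def comb_left subset_iff)
    have via_a': "b x a = b x a' + b x a0" if "x \<in> S" for x
      using that S by (simp add: a'_def comb_right)
    have l_a: "l a = l a' + l a0" using S insert.prems(5) by (simp add: a'_def)
    \<comment> \<open>\<open>W\<close> is spanned by \<open>W0\<close> and \<open>a\<close>, so it suffices to test on these.\<close>
    have decomp: "b p v = l v" if p: "p \<in> S" "\<And>v. v \<in> W0 \<Longrightarrow> b p v = l v" "b p a = l a" and v: "v \<in> W" for p v
    proof -
      define v0 where "v0 = comb v (- (ev i v / ev i a)) a"
      have "v0 \<in> W0" using v a insert.prems(3) WS ev by (simp add: W0_def v0_def)
      then have "b p v0 = l v0" by (rule p(2))
      then show ?thesis using p WS[OF v] S(1) insert.prems(5) by (simp add: v0_def comb_right)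
    qed
    show ?thesis
    proof (cases "b a' a' = 0")
      case True
      have "b p0 a = l a"
        using via_a'[OF S(3)] l_a p0(2)[OF a0(1)] null_right[OF S(3) a'(2) True] insert.prems(6)[OF a'(2) True] by simp
      then show ?thesis using decomp[OF S(3) p0(2)] S(5) by blast
    next
      case False
      define p where "p = comb p0 (l a' / b a' a') a'"
      have p: "p \<in> W" "p \<in> S" using S a' insert.prems(3) WS by (auto simp: p_def)
      have p_v: "b p v = b p0 v + (l a' / b a' a') * b a' v" if "v \<in> S" for v
        using S a' that by (simp add: p_def comb_left)
      have on_W0: "b p v = l v" if "v \<in> W0" for v
        using p_v[of v] that W0(1) p0(2)[OF that] orth[OF that] by auto
      have "b p0 a' = 0" using orth[OF p0(1)] sym[OF S(3) a'(2)] by simp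
      then have "b p a' = l a'" using p_v[OF a'(2)] False by simp
      then have "b p a = l a" using via_a'[OF p(2)] l_a on_W0[OF a0(1)] by simp
      then show ?thesis using decomp[OF p(2) on_W0] p(1) by blast
    qed
  qed
qed

end

section \<open>Finite element functions\<close>

lemma S10_lincomb:
  assumes D: "open D" and u: "u \<in> S10 D T" and v: "v \<in> S10 D T"
  shows "(\<lambda>x. u x + c * v x) \<in> S10 D T"
  unfolding S10_def
proof (intro CollectI conjI ballI)
  show "(\<lambda>x. u x + c * v x) \<in> H10 D" using H10_lincomb[OF D] u v by (simp add: S10_def)
  show "continuous_on UNIV (\<lambda>x. u x + c * v x)" using u v by (auto simp: S10_def intro!: continuous_intros)
  show "\<forall>x. x \<notin> D \<longrightarrow> u x + c * v x = 0" using u v by (simp add: S10_def)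
  fix K assume K: "K \<in> T"
  obtain b r where u': "\<forall>x\<in>hull_of K. u x = b \<bullet> x + r"
    using u K unfolding S10_def by blast
  obtain b' r' where v': "\<forall>x\<in>hull_of K. v x = b' \<bullet> x + r'"
    using v K unfolding S10_def by blast
  show "\<exists>b r. \<forall>x\<in>hull_of K. u x + c * v x = b \<bullet> x + r"
    by (rule exI[of _ "b + c *\<^sub>R b'"], rule exI[of _ "r + c * r'"])
       (use u' v' in \<open>auto simp: inner_simps algebra_simps\<close>)
qed

lemma zero_S10: "open D \<Longrightarrow> (\<lambda>x. 0) \<in> S10 D T"
  using zero_H10[of D] unfolding S10_def by (auto intro!: exI[of _ 0])

text \<open>On each simplex the zero set of the affine function is convex and contains the vertices; the
  simplices cover \<open>D\<close>.\<close>

lemma S10_eq_0_if_vertex_values_eq_0: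
  assumes T: "conforming_mesh D T" and v: "v \<in> S10 D T" and zero: "\<And>\<xi>. \<xi> \<in> vertices T \<Longrightarrow> v \<xi> = 0"
  shows "v x = 0"
proof (cases "x \<in> D")
  case True
  then have "x \<in> (\<Union>K\<in>T. hull_of K)"
    using T closure_subset[of D] by (auto simp: conforming_mesh_def)
  then obtain K where K: "K \<in> T" "x \<in> hull_of K" by blast
  obtain b c where bc: "\<forall>x\<in>hull_of K. v x = b \<bullet> x + c"
    using v K(1) unfolding S10_def by blast
  have "set (fst K) \<subseteq> {x. b \<bullet> x = - c}"
  proof
    fix \<xi> assume \<xi>: "\<xi> \<in> set (fst K)"
    then have "v \<xi> = 0" using zero K(1) by (auto simp: vertices_def)
    moreover have "\<xi> \<in> hull_of K" using \<xi> by (simp add: hull_of_def hull_inc)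
    ultimately show "\<xi> \<in> {x. b \<bullet> x = - c}" using bc by fastforce
  qed
  then have "hull_of K \<subseteq> {x. b \<bullet> x = - c}"
    unfolding hull_of_def by (rule hull_minimal) (rule convex_hyperplane)
  then show ?thesis using K(2) bc by fastforce
qed (use v in \<open>simp add: S10_def\<close>)

section \<open>Galerkin projections\<close>

context sgfem
begin

text \<open>Polynomials are bounded on \<open>[-1,1]\<close>, to which the parameters are confined. If \<open>\<nu>\<close> is not
  finitely supported, the product over its infinite support is \<open>1\<close> by convention.\<close>

lemma PP_bounded: "\<exists>C. \<forall>y\<in>space (par pr). \<bar>PP pr \<nu> y\<bar> \<le> C"
proof (cases "finite {m. \<nu> m \<noteq> 0}")
  case True
  have "\<exists>C. \<forall>t\<in>{-1..1}. \<bar>poly (opoly pr m (\<nu> m)) t\<bar> \<le> C" for m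
  proof -
    have "bounded (poly (opoly pr m (\<nu> m)) ` {-1..1})"
      by (intro compact_imp_bounded compact_continuous_image continuous_intros) auto
    then show ?thesis unfolding bounded_iff by auto
  qed
  then obtain C where C: "\<And>m t. t \<in> {-1..1} \<Longrightarrow> \<bar>poly (opoly pr m (\<nu> m)) t\<bar> \<le> C m" by metis
  have "\<bar>PP pr \<nu> y\<bar> \<le> (\<Prod>m\<in>{m. \<nu> m \<noteq> 0}. C m)" if y: "y \<in> space (par pr)" for y
    unfolding PP_def abs_prod
  proof (rule prod_mono)
    fix m
    have "y m \<in> {-1..1}" using par_component_bound[OF y, of m] by (auto simp: abs_le_iff)
    then show "0 \<le> \<bar>poly (opoly pr m (\<nu> m)) (y m)\<bar> \<and> \<bar>poly (opoly pr m (\<nu> m)) (y m)\<bar> \<le> C m"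
      using C by simp
  qed
  then show ?thesis by blast
qed (auto simp: PP_def intro: exI[of _ 1])

lemma PP_measurable: "PP pr \<nu> \<in> borel_measurable (par pr)"
proof -
  have "(\<lambda>y. poly p (y m)) \<in> borel_measurable (par pr)" for p m
    by (rule borel_measurable_continuous_on[OF _ par_component_measurable]) (intro continuous_intros)
  then show ?thesis unfolding PP_def[abs_def] by (intro borel_measurable_prod)
qed

text \<open>A single family of coefficient functions and meshes covers both discrete spaces: the detail
  indices of the enriched space carry the initial mesh.\<close>

definition expansion :: "mindex set \<Rightarrow> (mindex \<Rightarrow> real^'n \<Rightarrow> real) \<Rightarrow> 'n rfun" where
  "expansion J c = (\<lambda>y x. \<Sum>\<nu>\<in>J. c \<nu> x * PP pr \<nu> y)"

definition coefficients :: "mindex set \<Rightarrow> (mindex \<Rightarrow> 'n mesh) \<Rightarrow> (mindex \<Rightarrow> real^'n \<Rightarrow> real) set" where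
  "coefficients J T = {c. \<forall>\<nu>\<in>J. c \<nu> \<in> S10 D (T \<nu>)}"

lemma expansion_VV:
  assumes c: "c \<in> coefficients J T" shows "expansion J c \<in> VV pr"
proof -
  interpret prob_space "par pr" by (rule prob_par)
  show ?thesis unfolding expansion_def VV_eq
  proof (rule H10.bochner_L2_sum[OF finite_measure_axioms zero_H10[OF open_D]])
    fix \<nu> assume "\<nu> \<in> J"
    then have "c \<nu> \<in> H10 D" using c by (auto simp: coefficients_def S10_def)
    moreover obtain C where "\<And>y. y \<in> space (par pr) \<Longrightarrow> \<bar>PP pr \<nu> y\<bar> \<le> C" using PP_bounded by blast
    ultimately show "(\<lambda>y x. c \<nu> x * PP pr \<nu> y) \<in> bochner_L2 (par pr) (H10 D) H10.nrm"
      by (intro H10.bochner_L2_elementary[OF finite_measure_axioms] PP_measurable)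
  qed
qed

lemma expansion_lincomb:
  "expansion J (\<lambda>\<nu> x. c \<nu> x + r * d \<nu> x) = (\<lambda>y x. expansion J c y x + r * expansion J d y x)"
  by (simp add: expansion_def sum.distrib sum_distrib_left distrib_right mult.assoc)

lemma coefficients_lincomb:
  "c \<in> coefficients J T \<Longrightarrow> d \<in> coefficients J T \<Longrightarrow> (\<lambda>\<nu> x. c \<nu> x + r * d \<nu> x) \<in> coefficients J T"
  by (auto simp: coefficients_def intro: S10_lincomb[OF open_D])

lemma zero_VV: "(\<lambda>y x. 0) \<in> VV pr"
  using expansion_VV[of "\<lambda>_ _. 0" "{}"] by (simp add: expansion_def coefficients_def)

lemma BB_zero: "v \<in> VV pr \<Longrightarrow> BB pr (\<lambda>y x. 0) v = 0"
  using energy.comb_left[OF zero_VV zero_VV, of v "-1"] by simp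

text \<open>The coordinates are the vertex values of all coefficient functions. On families of
  coefficient functions they are well defined, even where different families have the same
  expansion; therefore the form is pulled back to these families.\<close>

lemma galerkin_exists:
  assumes J: "finite J" and T: "\<And>\<nu>. \<nu> \<in> J \<Longrightarrow> conforming_mesh D (T \<nu>)" and w: "w \<in> VV pr"
  shows "\<exists>p \<in> expansion J ` coefficients J T. \<forall>v \<in> expansion J ` coefficients J T. BB pr p v = BB pr w v"
proof -
  interpret coeff: psd_form "coefficients J T" "\<lambda>c r d \<nu> x. c \<nu> x + r * d \<nu> x"
    "\<lambda>c d. BB pr (expansion J c) (expansion J d)"
    by (rule energy.psd_form_pullback) (auto intro: expansion_VV coefficients_lincomb simp: expansion_lincomb)
  have "finite (SIGMA \<nu>:J. vertices (T \<nu>))"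
    using J T by (auto simp: conforming_mesh_def vertices_def)
  moreover have "(\<lambda>_ _. 0) \<in> coefficients J T"
    using zero_S10[OF open_D] by (simp add: coefficients_def)
  ultimately have "\<exists>p\<in>coefficients J T. \<forall>v\<in>coefficients J T.
      BB pr (expansion J p) (expansion J v) = BB pr w (expansion J v)"
  proof (intro coeff.riesz_finite_coordinates[where ev="\<lambda>(\<nu>, \<xi>) c. c \<nu> \<xi>"])
    fix c assume c: "c \<in> coefficients J T"
      and z: "\<And>i. i \<in> (SIGMA \<nu>:J. vertices (T \<nu>)) \<Longrightarrow> (case i of (\<nu>, \<xi>) \<Rightarrow> \<lambda>c. c \<nu> \<xi>) c = 0"
    have "c \<nu> x = 0" if "\<nu> \<in> J" for \<nu> x
      by (rule S10_eq_0_if_vertex_values_eq_0[OF T[OF that]]) (use c z that in \<open>auto simp: coefficients_def\<close>)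
    then have "expansion J c = (\<lambda>y x. 0)" by (simp add: expansion_def)
    then show "BB pr (expansion J c) (expansion J c) = 0" using BB_zero zero_VV by simp
  next
    fix c d r assume "c \<in> coefficients J T" "d \<in> coefficients J T"
    then show "BB pr w (expansion J (\<lambda>\<nu> x. c \<nu> x + r * d \<nu> x)) = BB pr w (expansion J c) + r * BB pr w (expansion J d)"
      unfolding expansion_lincomb by (intro energy.comb_right expansion_VV w)
  next
    fix c assume "c \<in> coefficients J T" "BB pr (expansion J c) (expansion J c) = 0"
    then show "BB pr w (expansion J c) = 0" using energy.null_right[OF w expansion_VV] by blast
  next
    fix c d r assume "c \<in> coefficients J T" "d \<in> coefficients J T"
    then show "(\<lambda>\<nu> x. c \<nu> x + r * d \<nu> x) \<in> coefficients J T" by (rule coefficients_lincomb)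
  next
    fix i c d r
    show "(case i of (\<nu>, \<xi>) \<Rightarrow> \<lambda>c. c \<nu> \<xi>) (\<lambda>\<nu> x. c \<nu> x + r * d \<nu> x)
        = (case i of (\<nu>, \<xi>) \<Rightarrow> \<lambda>c. c \<nu> \<xi>) c + r * (case i of (\<nu>, \<xi>) \<Rightarrow> \<lambda>c. c \<nu> \<xi>) d"
      by (simp split: prod.split)
  qed blast+
  then show ?thesis by blast
qed

text \<open>What the error analysis uses about a discrete space.\<close>

definition galerkin_space :: "'n rfun set \<Rightarrow> bool" where
  "galerkin_space W \<longleftrightarrow> W \<subseteq> VV pr \<and>
     (\<forall>u\<in>W. \<forall>v\<in>W. \<forall>c. (\<lambda>y x. u y x + c * v y x) \<in> W) \<and>
     (\<forall>w\<in>VV pr. \<exists>p\<in>W. \<forall>v\<in>W. BB pr p v = BB pr w v)"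

lemma galerkin_space_expansions:
  assumes "finite J" "\<And>\<nu>. \<nu> \<in> J \<Longrightarrow> conforming_mesh D (T \<nu>)"
  shows "galerkin_space (expansion J ` coefficients J T)"
  unfolding galerkin_space_def
proof (intro conjI ballI allI)
  show "expansion J ` coefficients J T \<subseteq> VV pr" using expansion_VV by blast
  fix u v r assume "u \<in> expansion J ` coefficients J T" "v \<in> expansion J ` coefficients J T"
  then show "(\<lambda>y x. u y x + r * v y x) \<in> expansion J ` coefficients J T"
    by (auto simp: expansion_lincomb[symmetric] intro!: imageI coefficients_lincomb)
qed (rule galerkin_exists[OF assms])

lemma finite_detail_indices:
  assumes "finite P" shows "finite (detail_indices P)"
proof -
  let ?M = "card (\<Union>\<nu>'\<in>P. {k. \<nu>' k \<noteq> 0})"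
  have "detail_indices P \<subseteq> (\<Union>\<nu>\<in>P. \<Union>m\<le>?M. {\<nu>(m := \<nu> m + 1), \<nu>(m := \<nu> m - 1)})"
    unfolding detail_indices_def by blast
  then show ?thesis by (rule finite_subset) (use assms in simp)
qed

lemma multilevel_structure_props:
  "multilevel_structure pr P \<Longrightarrow> finite (inds P) \<and> (\<forall>\<nu>. conforming_mesh D (mesh P \<nu>))"
proof (induction rule: multilevel_structure.induct)
  case initial
  then show ?case using problem by (simp add: parametric_problem_def)
next
  case (refined P \<M> T')
  have "finite \<M>" using refined.hyps(2) finite_detail_indices refined.IH finite_subset by blast
  moreover have "conforming_mesh D (T' \<nu>)" for \<nu>
  proof (cases "\<nu> \<in> inds P")
    case True
    then show ?thesis using refined.hyps(3)[OF True] by (auto simp: is_refine_def refinements_def)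
  next
    case False
    then show ?thesis using refined.hyps(4)[OF False] problem by (simp add: parametric_problem_def)
  qed
  ultimately show ?case using refined.IH by simp
qed

lemma galerkin_space_Vspace:
  assumes "multilevel_structure pr P" shows "galerkin_space (Vspace pr P)"
proof -
  have "Vspace pr P = expansion (inds P) ` coefficients (inds P) (mesh P)"
    by (auto simp: Vspace_def expansion_def coefficients_def)
  then show ?thesis using galerkin_space_expansions multilevel_structure_props[OF assms] by simp
qed

lemma galerkin_space_Vhat_space:
  assumes P: "multilevel_structure pr P" and Th: "uniform_refinements pr P Th"
  shows "galerkin_space (Vhat_space pr P Th)"
proof -
  let ?I = "inds P" and ?Q = "detail_indices (inds P)"
  let ?T = "\<lambda>\<nu>. if \<nu> \<in> ?I then Th \<nu> else mesh0 pr"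
  have fin: "finite ?I" "finite ?Q" using multilevel_structure_props[OF P] finite_detail_indices by auto
  have disj: "?I \<inter> ?Q = {}" by (auto simp: detail_indices_def)
  have "coefficients (?I \<union> ?Q) ?T = {c. (\<forall>\<nu>\<in>?I. c \<nu> \<in> S10 D (Th \<nu>)) \<and> (\<forall>\<nu>\<in>?Q. c \<nu> \<in> S10 D (mesh0 pr))}"
    using disj by (auto simp: coefficients_def)
  then have "Vhat_space pr P Th = expansion (?I \<union> ?Q) ` coefficients (?I \<union> ?Q) ?T"
    by (auto simp: Vhat_space_def expansion_def[abs_def] sum.union_disjoint[OF fin disj])
  moreover have "conforming_mesh D (?T \<nu>)" for \<nu>
  proof (cases "\<nu> \<in> ?I")
    case True
    then have "is_uniform_refinement D (mesh P \<nu>) (Th \<nu>)" using Th by (simp add: uniform_refinements_def)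
    then have "conforming_mesh D (Th \<nu>)"
      by (auto simp: is_uniform_refinement_def is_refine_def refinements_def split: if_splits)
    then show ?thesis using True by simp
  qed (use problem in \<open>simp add: parametric_problem_def\<close>)
  ultimately show ?thesis using galerkin_space_expansions[of "?I \<union> ?Q" ?T] fin by simp
qed

lemma galerkin_spaceD:
  assumes W: "galerkin_space W" and w: "w \<in> VV pr"
  shows "galerkin pr W w \<in> W" "galerkin pr W w \<in> VV pr" "v \<in> W \<Longrightarrow> BB pr (galerkin pr W w) v = BB pr w v"
proof -
  have sub: "W \<subseteq> VV pr" and "\<exists>p\<in>W. \<forall>v\<in>W. BB pr p v = BB pr w v"
    using W w unfolding galerkin_space_def by (blast, blast)
  then have "\<exists>p. p \<in> W \<and> (\<forall>v\<in>W. BB pr p v = BB pr w v)" by blast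
  from someI_ex[OF this]
  have *: "galerkin pr W w \<in> W \<and> (\<forall>v\<in>W. BB pr (galerkin pr W w) v = BB pr w v)"
    unfolding galerkin_def .
  from * show "galerkin pr W w \<in> W" "v \<in> W \<Longrightarrow> BB pr (galerkin pr W w) v = BB pr w v" by blast+
  with sub show "galerkin pr W w \<in> VV pr" by blast
qed

end

section \<open>The goal-oriented error estimate\<close>

text \<open>The factor \<open>Cest / (1 - q)\<close> relates the primal error to its estimator. Of the five terms
  \<open>Cgoal * \<parallel>e\<parallel>\<close>, one stems from the linearization and four from exchanging the two dual
  solutions.\<close>

definition reliability_constant :: "real \<Rightarrow> real \<Rightarrow> real \<Rightarrow> real" where
  "reliability_constant Cgoal Cest q =
     Cest / (1 - q) * (5 * Cgoal * (Cest / (1 - q)) + Cest) / (1 - q)"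

lemma reliability_constant_pos:
  assumes "0 \<le> Cgoal" "1 \<le> Cest" "q < 1" shows "0 < reliability_constant Cgoal Cest q"
proof -
  have "0 \<le> 5 * Cgoal * (Cest / (1 - q))" using assms by simp
  then show ?thesis using assms unfolding reliability_constant_def
    by (intro divide_pos_pos mult_pos_pos add_nonneg_pos) auto
qed

context sgfem
begin

lemma diff_eq: "u - v = (\<lambda>y x. u y x + (-1) * v y x)" for u v :: "'n rfun"
  by (simp add: fun_eq_iff)

lemma diff_VV: "u \<in> VV pr \<Longrightarrow> v \<in> VV pr \<Longrightarrow> u - v \<in> VV pr"
  unfolding diff_eq by (rule VV_lincomb)

lemma BB_diff_left: "u \<in> VV pr \<Longrightarrow> v \<in> VV pr \<Longrightarrow> w \<in> VV pr \<Longrightarrow> BB pr (u - v) w = BB pr u w - BB pr v w"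
  unfolding diff_eq by (subst energy.comb_left) auto

lemma BB_diff_right: "u \<in> VV pr \<Longrightarrow> v \<in> VV pr \<Longrightarrow> w \<in> VV pr \<Longrightarrow> BB pr w (u - v) = BB pr w u - BB pr w v"
  unfolding diff_eq by (subst energy.comb_right) auto

lemma energy_norm_nonneg: "v \<in> VV pr \<Longrightarrow> 0 \<le> energy_norm pr v"
  by (simp add: energy_norm_eq energy.nrm_nonneg)

lemma energy_norm_square: "v \<in> VV pr \<Longrightarrow> (energy_norm pr v)\<^sup>2 = BB pr v v"
  by (simp add: energy_norm_eq energy.nrm_square)

lemma energy_dist_triangle:
  assumes "u \<in> VV pr" "v \<in> VV pr" "w \<in> VV pr"
  shows "energy_norm pr (u - w) \<le> energy_norm pr (u - v) + energy_norm pr (v - w)"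
proof -
  have "u - w = (\<lambda>y x. (u - v) y x + 1 * (v - w) y x)" by (simp add: fun_eq_iff)
  then show ?thesis
    using energy.nrm_triangle[OF diff_VV[OF assms(1,2)] diff_VV[OF assms(2,3)], of 1]
    by (simp add: energy_norm_eq)
qed

lemma energy_norm_scale:
  assumes "v \<in> VV pr" shows "energy_norm pr (\<lambda>y x. r * v y x) = \<bar>r\<bar> * energy_norm pr v"
proof -
  have "(\<lambda>y x. r * v y x) = (\<lambda>y x. v y x + (r - 1) * v y x)" by (simp add: algebra_simps)
  then have "BB pr (\<lambda>y x. r * v y x) (\<lambda>y x. r * v y x) = r\<^sup>2 * BB pr v v"
    using energy.comb_square[OF assms assms, of "r - 1"] by (simp add: power2_eq_square algebra_simps)
  then show ?thesis by (simp add: energy_norm_def real_sqrt_mult)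
qed

lemma energy_dist_commute:
  assumes "u \<in> VV pr" "v \<in> VV pr" shows "energy_norm pr (u - v) = energy_norm pr (v - u)"
  using energy_norm_scale[OF diff_VV[OF assms], of "-1"]
  by (simp add: fun_diff_def)

text \<open>The difference of the projections is itself an admissible test function.\<close>

lemma galerkin_stable:
  assumes W: "galerkin_space W" and v: "v \<in> VV pr" and w: "w \<in> VV pr"
  shows "energy_norm pr (galerkin pr W v - galerkin pr W w) \<le> energy_norm pr (v - w)"
proof -
  let ?p = "galerkin pr W v - galerkin pr W w"
  note gv = galerkin_spaceD[OF W v] and gw = galerkin_spaceD[OF W w]
  have pW: "?p \<in> W" unfolding diff_eq using W gv(1) gw(1) unfolding galerkin_space_def by blast
  have pV: "?p \<in> VV pr" by (rule diff_VV[OF gv(2) gw(2)])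
  have "(energy_norm pr ?p)\<^sup>2 = BB pr (v - w) ?p"
    using gv(3)[OF pW] gw(3)[OF pW] gv(2) gw(2) v w pV
    by (simp add: energy_norm_square BB_diff_left)
  also have "\<dots> \<le> energy_norm pr (v - w) * energy_norm pr ?p"
    using energy.cauchy_schwarz[OF diff_VV[OF v w] pV] by (simp add: energy_norm_eq)
  finally show ?thesis
    using energy_norm_nonneg[OF pV] energy_norm_nonneg[OF diff_VV[OF v w]]
    by (cases "energy_norm pr ?p = 0") (auto simp: power2_eq_square)
qed

lemma estimator_nonneg: "0 \<le> estimator pr P Th w"
  unfolding estimator_def by (intro real_sqrt_ge_zero add_nonneg_nonneg sum_nonneg) auto

text \<open>The derivative of \<open>t \<mapsto> g (v + t (u - v))\<close> is \<open>g' (v + t (u - v)) (u - v)\<close>, so the difference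
  \<open>g u - g v\<close> is one of these values, for some \<open>t\<close> between \<open>0\<close> and \<open>1\<close>.\<close>

lemma goal_linearization_error:
  assumes g: "goal_functional pr Cgoal g g'" and Cgoal: "0 \<le> Cgoal" and u: "u \<in> VV pr" and v: "v \<in> VV pr"
  shows "\<bar>g u - g v - g' v (u - v)\<bar> \<le> Cgoal * (energy_norm pr (u - v))\<^sup>2"
proof -
  let ?e = "u - v"
  define s where "s t = (\<lambda>y x. v y x + t * ?e y x)" for t
  have eV: "?e \<in> VV pr" by (rule diff_VV[OF u v])
  have sV: "s t \<in> VV pr" for t unfolding s_def by (rule VV_lincomb[OF v eV])
  have "((\<lambda>t. g (s t)) has_real_derivative g' (s t) ?e) (at t)" for t
  proof -
    have "((\<lambda>h. (g (\<lambda>y x. s t y x + h * ?e y x) - g (s t)) / h) \<longlongrightarrow> g' (s t) ?e) (at 0)"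
      using g sV eV unfolding goal_functional_def by blast
    moreover have "(\<lambda>y x. s t y x + h * ?e y x) = s (t + h)" for h
      by (simp add: s_def fun_eq_iff algebra_simps)
    ultimately show ?thesis by (simp add: DERIV_def)
  qed
  then obtain z where z: "0 < z" "z < 1" "g (s 1) - g (s 0) = (1 - 0) * g' (s z) ?e"
    using MVT2[of 0 1 "\<lambda>t. g (s t)" "\<lambda>t. g' (s t) ?e"] by auto
  have "s 1 = u" "s 0 = v" by (simp_all add: s_def fun_eq_iff)
  with z have "g u - g v = g' (s z) ?e" by simp
  moreover have "\<bar>g' (s z) ?e - g' v ?e\<bar> \<le> Cgoal * energy_norm pr (s z - v) * energy_norm pr ?e"
    using g sV eV v unfolding goal_functional_def by blast
  moreover have "s z - v = (\<lambda>y x. z * ?e y x)" by (simp add: s_def fun_eq_iff)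
  ultimately have "\<bar>g u - g v - g' v ?e\<bar> \<le> Cgoal * (z * energy_norm pr ?e) * energy_norm pr ?e"
    using z energy_norm_scale[OF eV, of z] by simp
  also have "\<dots> \<le> Cgoal * energy_norm pr ?e * energy_norm pr ?e"
    using z energy_norm_nonneg[OF eV] Cgoal by (intro mult_mono mult_left_mono) (auto simp: mult_left_le_one_le)
  finally show ?thesis by (simp add: power2_eq_square mult.assoc)
qed

text \<open>Test the difference of the two dual problems with the difference of their solutions.\<close>

lemma dual_solutions_dist:
  assumes g: "goal_functional pr Cgoal g g'" and Cgoal: "0 \<le> Cgoal" and u: "u \<in> VV pr" and v: "v \<in> VV pr"
    and zu: "dual_solution pr (g' u) zu" and zv: "dual_solution pr (g' v) zv"
  shows "energy_norm pr (zu - zv) \<le> Cgoal * energy_norm pr (u - v)"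
proof -
  let ?d = "zu - zv"
  have zV: "zu \<in> VV pr" "zv \<in> VV pr" using zu zv by (auto simp: dual_solution_def)
  have dV: "?d \<in> VV pr" by (rule diff_VV[OF zV])
  have "(energy_norm pr ?d)\<^sup>2 = g' u ?d - g' v ?d"
    using zu zv dV zV by (simp add: energy_norm_square BB_diff_right[OF zV dV] dual_solution_def)
  also have "\<dots> \<le> Cgoal * energy_norm pr (u - v) * energy_norm pr ?d"
    using g u v dV unfolding goal_functional_def by (meson abs_ge_self order_trans)
  finally have *: "energy_norm pr ?d * energy_norm pr ?d \<le> Cgoal * energy_norm pr (u - v) * energy_norm pr ?d"
    by (simp add: power2_eq_square)
  show ?thesis
  proof (cases "energy_norm pr ?d = 0")
    case True
    then show ?thesis using Cgoal energy_norm_nonneg[OF diff_VV[OF u v]] by simp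
  next
    case False
    then show ?thesis using * energy_norm_nonneg[OF dV] by simp
  qed
qed

lemma saturated_error_le:
  assumes V: "galerkin_space (Vspace pr P)" and Vh: "galerkin_space (Vhat_space pr P Th)" and w: "w \<in> VV pr"
    and sat: "saturation pr P Th q w" and q: "q < 1"
  shows "(1 - q) * energy_norm pr (w - galerkin pr (Vspace pr P) w)
     \<le> energy_norm pr (galerkin pr (Vhat_space pr P Th) w - galerkin pr (Vspace pr P) w)"
  using energy_dist_triangle[OF w galerkin_spaceD(2)[OF Vh w] galerkin_spaceD(2)[OF V w]] sat
  by (simp add: saturation_def algebra_simps)

text \<open>The combination of the preceding bounds: \<open>E\<close> is the primal error, \<open>Z\<close> the error of the dual
  problem linearized at the discrete solution and \<open>d\<close> the distance of the two dual solutions.\<close>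

lemma goal_oriented_estimate:
  assumes Cgoal: "0 \<le> Cgoal" and Cest: "1 \<le> Cest" and q: "0 < q" "q < 1"
    and g: "goal_functional pr Cgoal g g'"
    and P: "multilevel_structure pr P" and Th: "uniform_refinements pr P Th"
    and two: "two_level_constant pr Cest"
    and u: "primal_solution pr u" and ub: "ub = galerkin pr (Vspace pr P) u"
    and zu: "dual_solution pr (g' u) zu" and zub: "dual_solution pr (g' ub) zub"
    and sat_u: "saturation pr P Th q u" and sat_z: "saturation pr P Th q zu"
  shows "\<bar>g u - g ub\<bar> \<le> reliability_constant Cgoal Cest q * estimator pr P Th u *
            sqrt ((estimator pr P Th u)\<^sup>2 + (estimator pr P Th zub)\<^sup>2)"
proof -
  define \<kappa> where "\<kappa> = Cest / (1 - q)"
  define \<mu> where "\<mu> = estimator pr P Th u"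
  define \<zeta> where "\<zeta> = estimator pr P Th zub"
  let ?G = "galerkin pr (Vspace pr P)" and ?H = "galerkin pr (Vhat_space pr P Th)"
  let ?n = "energy_norm pr"
  note V = galerkin_space_Vspace[OF P] and Vh = galerkin_space_Vhat_space[OF P Th]
  have uV: "u \<in> VV pr" and zuV: "zu \<in> VV pr" and zubV: "zub \<in> VV pr"
    using u zu zub by (auto simp: primal_solution_def dual_solution_def)
  note G = galerkin_spaceD[OF V] and H = galerkin_spaceD[OF Vh]
  have ubV: "ub \<in> VV pr" using G(2)[OF uV] ub by simp
  have rel: "?n (?H w - ?G w) \<le> Cest * estimator pr P Th w" if "w \<in> VV pr" for w
  proof -
    have "inverse Cest * ?n (?H w - ?G w) \<le> estimator pr P Th w"
      using two P Th that unfolding two_level_constant_def by blast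
    then show ?thesis using Cest by (simp add: field_simps)
  qed
  have nonneg: "0 \<le> \<mu>" "0 \<le> \<zeta>" by (auto simp: \<mu>_def \<zeta>_def estimator_nonneg)
  have \<kappa>: "0 < \<kappa>" using Cest q by (simp add: \<kappa>_def)
  define E where "E = ?n (u - ub)"
  have E0: "0 \<le> E" unfolding E_def by (rule energy_norm_nonneg[OF diff_VV[OF uV ubV]])
  have "(1 - q) * E \<le> Cest * \<mu>"
    using saturated_error_le[OF V Vh uV sat_u q(2)] rel[OF uV] unfolding E_def ub \<mu>_def by linarith
  then have E: "E \<le> \<kappa> * \<mu>" using q by (simp add: \<kappa>_def pos_le_divide_eq mult.commute)
  define d where "d = ?n (zu - zub)"
  have d: "d \<le> Cgoal * E" using dual_solutions_dist[where g=g and g'=g' and u=u and v=ub, OF g Cgoal uV ubV zu zub] by (simp only: d_def E_def)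
  define Z where "Z = ?n (zub - ?G zub)"
  have Z: "(1 - q) * Z \<le> 4 * d + Cest * \<zeta>"
  proof -
    \<comment> \<open>Saturation is available for \<open>zu\<close>, the estimator for \<open>zub\<close>; both projections of
      \<open>zu - zub\<close> are at most \<open>d\<close> by stability.\<close>
    have "?n (?H zu - ?G zu) \<le> ?n (?H zu - ?H zub) + (?n (?H zub - ?G zub) + ?n (?G zub - ?G zu))"
      using energy_dist_triangle[OF H(2)[OF zuV] H(2)[OF zubV] G(2)[OF zuV]]
        energy_dist_triangle[OF H(2)[OF zubV] G(2)[OF zubV] G(2)[OF zuV]] by linarith
    also have "\<dots> \<le> d + (Cest * \<zeta> + d)"
      using galerkin_stable[OF Vh zuV zubV] galerkin_stable[OF V zuV zubV] rel[OF zubV]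
        energy_dist_commute[OF G(2)[OF zubV] G(2)[OF zuV]]
      unfolding d_def \<zeta>_def by linarith
    finally have 1: "(1 - q) * ?n (zu - ?G zu) \<le> 2 * d + Cest * \<zeta>"
      using saturated_error_le[OF V Vh zuV sat_z q(2)] by linarith
    have "Z \<le> ?n (zub - zu) + (?n (zu - ?G zu) + ?n (?G zu - ?G zub))"
      unfolding Z_def
      using energy_dist_triangle[OF zubV zuV G(2)[OF zubV]]
        energy_dist_triangle[OF zuV G(2)[OF zuV] G(2)[OF zubV]] by linarith
    also have "\<dots> \<le> 2 * d + ?n (zu - ?G zu)"
      using galerkin_stable[OF V zuV zubV] energy_dist_commute[OF zuV zubV] unfolding d_def by linarith
    finally have "(1 - q) * Z \<le> (1 - q) * (2 * d + ?n (zu - ?G zu))" using q by (intro mult_left_mono) auto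
    also have "\<dots> \<le> 2 * d + (1 - q) * ?n (zu - ?G zu)"
    proof -
      have "0 \<le> q * d" using q energy_norm_nonneg[OF diff_VV[OF zuV zubV]] by (simp add: d_def)
      then show ?thesis by (simp add: algebra_simps)
    qed
    finally show ?thesis using 1 by linarith
  qed
  have Z0: "0 \<le> Z" unfolding Z_def by (rule energy_norm_nonneg[OF diff_VV[OF zubV G(2)[OF zubV]]])
  have "\<bar>g' ub (u - ub)\<bar> \<le> E * Z"
  proof -
    have e: "u - ub \<in> VV pr" by (rule diff_VV[OF uV ubV])
    have "BB pr (u - ub) (?G zub) = 0"
      using G(3)[OF uV G(1)[OF zubV]] BB_diff_left[OF uV ubV G(2)[OF zubV]] by (simp add: ub)
    then have "g' ub (u - ub) = BB pr (u - ub) (zub - ?G zub)"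
      using zub e by (simp add: dual_solution_def BB_diff_right zubV G(2)[OF zubV])
    then show ?thesis
      using energy.cauchy_schwarz[OF e diff_VV[OF zubV G(2)[OF zubV]]] by (simp add: E_def Z_def energy_norm_eq)
  qed
  then have "\<bar>g u - g ub\<bar> \<le> Cgoal * E\<^sup>2 + E * Z"
    using goal_linearization_error[OF g Cgoal uV ubV] unfolding E_def by linarith
  also have "\<dots> = E * (Cgoal * E + Z)" by (simp add: power2_eq_square algebra_simps)
  also have "\<dots> \<le> (\<kappa> * \<mu>) * ((5 * Cgoal * \<kappa> * \<mu> + Cest * \<zeta>) / (1 - q))"
  proof (rule mult_mono[OF E])
    have "(1 - q) * (Cgoal * E + Z) \<le> 5 * (Cgoal * E) + Cest * \<zeta>"
    proof -
      have "0 \<le> q * (Cgoal * E)" using q Cgoal E0 by simp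
      then show ?thesis using Z d by (simp add: algebra_simps)
    qed
    also have "\<dots> \<le> 5 * Cgoal * \<kappa> * \<mu> + Cest * \<zeta>" using mult_left_mono[OF E Cgoal] by simp
    finally show "Cgoal * E + Z \<le> (5 * Cgoal * \<kappa> * \<mu> + Cest * \<zeta>) / (1 - q)"
      using q by (simp add: pos_le_divide_eq mult.commute)
    show "0 \<le> \<kappa> * \<mu>" using \<kappa> nonneg by simp
    show "0 \<le> Cgoal * E + Z" using Cgoal E0 Z0 by simp
  qed
  also have "\<dots> \<le> (\<kappa> * \<mu>) * ((5 * Cgoal * \<kappa> + Cest) * sqrt (\<mu>\<^sup>2 + \<zeta>\<^sup>2) / (1 - q))"
  proof (intro mult_left_mono divide_right_mono)
    have "\<mu> \<le> sqrt (\<mu>\<^sup>2 + \<zeta>\<^sup>2)" "\<zeta> \<le> sqrt (\<mu>\<^sup>2 + \<zeta>\<^sup>2)" by (auto intro: real_le_rsqrt)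
    then have "5 * Cgoal * \<kappa> * \<mu> \<le> 5 * Cgoal * \<kappa> * sqrt (\<mu>\<^sup>2 + \<zeta>\<^sup>2)" "Cest * \<zeta> \<le> Cest * sqrt (\<mu>\<^sup>2 + \<zeta>\<^sup>2)"
      using Cgoal \<kappa> Cest by (auto intro!: mult_left_mono)
    then show "5 * Cgoal * \<kappa> * \<mu> + Cest * \<zeta> \<le> (5 * Cgoal * \<kappa> + Cest) * sqrt (\<mu>\<^sup>2 + \<zeta>\<^sup>2)"
      by (simp add: distrib_right)
  qed (use q \<kappa> nonneg in auto)
  finally show ?thesis
    unfolding \<mu>_def \<zeta>_def reliability_constant_def \<kappa>_def by (simp add: mult_ac)
qed

end

theorem proposition5:
  shows "\<exists>Crel :: real \<Rightarrow> real \<Rightarrow> real \<Rightarrow> real.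
    \<forall>Cgoal Cest qsat. 0 \<le> Cgoal \<and> 1 \<le> Cest \<and> 0 < qsat \<and> qsat < 1 \<longrightarrow>
       0 < Crel Cgoal Cest qsat \<and>
       (\<forall>(pr :: 2 sgfem_data) g g' P Th u zu zub ub.
          parametric_problem pr \<and> goal_functional pr Cgoal g g' \<and>
          multilevel_structure pr P \<and> uniform_refinements pr P Th \<and>
          two_level_constant pr Cest \<and>
          primal_solution pr u \<and> ub = galerkin pr (Vspace pr P) u \<and>
          dual_solution pr (g' u) zu \<and> dual_solution pr (g' ub) zub \<and>
          saturation pr P Th qsat u \<and> saturation pr P Th qsat zu \<longrightarrow>
          \<bar>g u - g ub\<bar> \<le> Crel Cgoal Cest qsat * estimator pr P Th u *
            sqrt ((estimator pr P Th u)\<^sup>2 + (estimator pr P Th zub)\<^sup>2)) \<and>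
       (\<forall>(pr :: 3 sgfem_data) g g' P Th u zu zub ub.
          parametric_problem pr \<and> goal_functional pr Cgoal g g' \<and>
          multilevel_structure pr P \<and> uniform_refinements pr P Th \<and>
          two_level_constant pr Cest \<and>
          primal_solution pr u \<and> ub = galerkin pr (Vspace pr P) u \<and>
          dual_solution pr (g' u) zu \<and> dual_solution pr (g' ub) zub \<and>
          saturation pr P Th qsat u \<and> saturation pr P Th qsat zu \<longrightarrow>
          \<bar>g u - g ub\<bar> \<le> Crel Cgoal Cest qsat * estimator pr P Th u *
            sqrt ((estimator pr P Th u)\<^sup>2 + (estimator pr P Th zub)\<^sup>2))"
proof (intro exI[of _ reliability_constant] allI impI, intro conjI)
  fix Cgoal Cest qsat :: real
  assume c: "0 \<le> Cgoal \<and> 1 \<le> Cest \<and> 0 < qsat \<and> qsat < 1"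
  then show "0 < reliability_constant Cgoal Cest qsat"
    by (simp add: reliability_constant_pos)
qed (intro allI impI, elim conjE, rule sgfem.goal_oriented_estimate[OF sgfem.intro], assumption+)+

end
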